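(* (a) For $n=13$ or $n=17$, there are, up to isomorphism, exactly $2$ distinct $n$-vertex degree-regular combinatorial $2$-manifolds of Euler characteristic $0$. These are $T_{n,1,2}$ and $T_{n,1,3}$. (b) There are, up to isomorphism, exactly $3$ distinct $19$-vertex degree-regular combinatorial $2$-manifolds of Euler characteristic $0$. These are $T_{19,1,2}$, $T_{19,1,3}$ and $T_{19,1,7}$.
   Context: A combinatorial $2$-manifold is a $2$-dimensional simplicial complex whose geometric carrier is a closed surface. The degree of a vertex is the number of edges containing it. A combinatorial $2$-manifold is degree-regular if it is connected and all its vertices have the same degree. The Euler characteristic is $\chi(X)=f_0(X)-f_1(X)+f_2(X)$, where $f_i(X)$ is the number of $i$-simplices. Isomorphism means simplicial isomorphism (a bijection of vertex-sets preserving simplices in both directions); isomorphic complexes are identified. For $n\geq 7$ and $k\in\{2,\dots,\lfloor\frac{n-3}{2}\rfloor\}\cup\{\lceil\frac{n+1}{2}\rceil,\dots,n-3\}$, $T_{n,1,k}$ is the $2$-dimensional simplicial complex with vertex-set $\{1,\dots,n\}$ whose $2$-simplices are $\{i,i+k,i+k+1\}$ and $\{i,i+1,i+k+1\}$ for $1\leq i\leq n$, where addition is modulo $n$ (all non-empty subsets of these are simplices, and there are no others). *)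

theory Defs
  imports "HOL-Analysis.Analysis"
begin

text \<open>Finiteness loses nothing here, since a closed surface is compact.\<close>

definition finite_complex :: "'a set set \<Rightarrow> bool" where
  "finite_complex K \<longleftrightarrow> finite K \<and> (\<forall>\<sigma>\<in>K. finite \<sigma> \<and> \<sigma> \<noteq> {}) \<and>
     (\<forall>\<sigma>\<in>K. \<forall>\<tau>. \<tau> \<subseteq> \<sigma> \<and> \<tau> \<noteq> {} \<longrightarrow> \<tau> \<in> K)"

definition vertices :: "'a set set \<Rightarrow> 'a set" where
  "vertices K = \<Union>K"

definition faces :: "nat \<Rightarrow> 'a set set \<Rightarrow> 'a set set" where
  "faces i K = {\<sigma> \<in> K. card \<sigma> = i + 1}"

definition two_dimensional :: "'a set set \<Rightarrow> bool" where
  "two_dimensional K \<longleftrightarrow> faces 2 K \<noteq> {} \<and> (\<forall>\<sigma>\<in>K. card \<sigma> \<le> 3)"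

text \<open>Points of the carrier are given by barycentric coordinates, extended by 0 to the whole
  vertex type. For finite complexes the product topology induces the usual topology.\<close>

definition carrier_points :: "'a set set \<Rightarrow> ('a \<Rightarrow> real) set" where
  "carrier_points K = {t. (\<forall>v. 0 \<le> t v) \<and> {v. t v \<noteq> 0} \<in> K \<and> (\<Sum>v | t v \<noteq> 0. t v) = 1}"

definition geometric_carrier :: "'a set set \<Rightarrow> ('a \<Rightarrow> real) topology" where
  "geometric_carrier K =
     subtopology (product_topology (\<lambda>_. euclideanreal) UNIV) (carrier_points K)"

text \<open>Second countability follows from compactness and local Euclideanness.
  Closed surfaces are not required to be connected.\<close>

definition closed_surface :: "'b topology \<Rightarrow> bool" where
  "closed_surface X \<longleftrightarrow> compact_space X \<and> Hausdorff_space X \<and>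
     (\<forall>x\<in>topspace X. \<exists>U V. openin X U \<and> x \<in> U \<and> open (V :: (real^2) set) \<and>
        subtopology X U homeomorphic_space top_of_set V)"

definition combinatorial_2_manifold :: "'a set set \<Rightarrow> bool" where
  "combinatorial_2_manifold K \<longleftrightarrow>
     finite_complex K \<and> two_dimensional K \<and> closed_surface (geometric_carrier K)"

definition vertex_degree :: "'a set set \<Rightarrow> 'a \<Rightarrow> nat" where
  "vertex_degree K v = card {e \<in> faces 1 K. v \<in> e}"

definition degree_regular :: "'a set set \<Rightarrow> bool" where
  "degree_regular K \<longleftrightarrow> connected_space (geometric_carrier K) \<and>
     (\<exists>d. \<forall>v\<in>vertices K. vertex_degree K v = d)"

definition euler_char :: "'a set set \<Rightarrow> int" where
  "euler_char K = int (card (faces 0 K)) - int (card (faces 1 K)) + int (card (faces 2 K))"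

definition complex_isomorphic :: "'a set set \<Rightarrow> 'b set set \<Rightarrow> bool"  (infix "\<simeq>\<^sub>s" 50) where
  "K \<simeq>\<^sub>s L \<longleftrightarrow> (\<exists>f. bij_betw f (vertices K) (vertices L) \<and>
     (\<forall>\<sigma>. \<sigma> \<subseteq> vertices K \<longrightarrow> (\<sigma> \<in> K \<longleftrightarrow> f ` \<sigma> \<in> L)))"

definition dr_manifold_chi0 :: "nat \<Rightarrow> 'a set set \<Rightarrow> bool" where
  "dr_manifold_chi0 n K \<longleftrightarrow> combinatorial_2_manifold K \<and> degree_regular K \<and>
     card (vertices K) = n \<and> euler_char K = 0"

text \<open>The representative in \<open>{1..n}\<close> of the residue class of \<open>x \<ge> 1\<close> modulo \<open>n\<close>.\<close>

definition wrap :: "nat \<Rightarrow> nat \<Rightarrow> nat" where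
  "wrap n x = (x - 1) mod n + 1"

text \<open>The complex \<open>T\<^bsub>n,1,k\<^esub>\<close>, meant for \<open>n \<ge> 7\<close> and
  \<open>k \<in> {2..\<lfloor>(n-3)/2\<rfloor>} \<union> {\<lceil>(n+1)/2\<rceil>..n-3}\<close>.\<close>

definition T1 :: "nat \<Rightarrow> nat \<Rightarrow> nat set set" where
  "T1 n k = {\<sigma>. \<sigma> \<noteq> {} \<and> (\<exists>i\<in>{1..n}.
     \<sigma> \<subseteq> {i, wrap n (i + k), wrap n (i + k + 1)} \<or>
     \<sigma> \<subseteq> {i, wrap n (i + 1), wrap n (i + k + 1)})}"

end

theory Submission
  imports Defs "HOL-Combinatorics.Cycles"
begin

text \<open>
  Topology enters only to establish the following equivalence: the manifolds in question are the
  connected complexes in which the link of every vertex is a hexagon. In one direction, invariance of domain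
  shows that every edge lies in exactly two triangles (\<open>edge_in_two_triangles\<close>,
  \<open>edge_in_at_most_two_triangles\<close>); counting incidences, Euler characteristic 0 forces degree 6; and a link
  consisting of two 3-cycles is impossible because the cone over one of them already is a neighbourhood of the
  vertex (\<open>chi0_hexagonal\<close>). In the other direction, the open star of a vertex with a hexagonal link
  is an open hexagon in the plane (\<open>hexagonal_dr_manifold\<close>).

  A complex with hexagonal links is locally the triangular lattice, and is a quotient of it. Instead of
  constructing the universal covering, one can let the lattice \<open>\<int>\<^sup>2\<close> act on the finite set of frames
  (a triangle with a chosen base point and first edge) by parallel transport along straight lines.
  That the two generating translations commute is a statement about a single hexagon. The base points of
  an orbit are all vertices, by connectedness. If two frames of one orbit have the same base point, they differ by
  a rotation or a reflection. A rotation would give a deck transformation with a fixed vertex,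
  edge or triangle, which is impossible. A reflection, the case of a Klein bottle, would make the orbit an
  abelian group of order \<open>2 n\<close> with an automorphism that exchanges two lattice vectors \<open>x\<close> and \<open>y\<close>;
  for an odd prime \<open>n\<close> this forces \<open>x = y\<close> or \<open>x = - y\<close> in the group
  (\<open>swap_symmetric_orbit\<close>), so two vertices at distance at most 2 in the lattice would coincide.

  Hence the orbit is in bijection with the vertices and has prime size \<open>n\<close>. One translation is an \<open>n\<close>-cycle and
  the other one is its \<open>k\<close>-th power, so the complex is \<open>T\<^bsub>n,1,k\<^esub>\<close> for some residue \<open>k\<close>
  (\<open>chi0_cyclic_torus\<close>). Multiplying the residues by units and permuting the three directions \<open>1\<close>, \<open>k\<close>,
  \<open>- 1 - k\<close> reduces \<open>k\<close> to the listed values by a finite computation. The listed complexes are told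
  apart by the numbers of common neighbours of two vertices.
\<close>

section \<open>Discs inside the carrier\<close>

lemma geometric_carrier_eq: "geometric_carrier K = top_of_set (carrier_points K)"
  by (simp add: geometric_carrier_def euclidean_product_topology)

text \<open>The local condition in the definition of a closed surface, with the chart unpacked into a map
  \<open>h\<close> and its left inverse \<open>k\<close>, which is the form in which invariance of domain is applied below.\<close>

definition locally_planar :: "'b::topological_space set \<Rightarrow> bool" where
  "locally_planar S \<longleftrightarrow> (\<forall>x\<in>S. \<exists>U (V :: (real^2) set) h k. openin (top_of_set S) U \<and> x \<in> U \<and>
     open V \<and> continuous_on U h \<and> h ` U = V \<and> continuous_on V k \<and> (\<forall>z\<in>U. k (h z) = z))"

lemma locally_planarE:
  assumes "locally_planar S" "x \<in> S"
  obtains U and V :: "(real^2) set" and h k where "openin (top_of_set S) U" "x \<in> U" "open V"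
    "continuous_on U h" "h ` U = V" "continuous_on V k" "\<forall>z\<in>U. k (h z) = z"
proof -
  note ex = bspec[OF assms(1)[unfolded locally_planar_def] assms(2)]
  then show ?thesis by (elim exE conjE) (rule that)
qed

lemma closed_surface_locally_planar:
  assumes "closed_surface (top_of_set S)"
  shows "locally_planar S"
  unfolding locally_planar_def
proof
  fix x assume "x \<in> S"
  then obtain U V where U: "openin (top_of_set S) U" "x \<in> U" "open (V :: (real^2) set)"
      "subtopology (top_of_set S) U homeomorphic_space top_of_set V"
    using assms unfolding closed_surface_def by force
  have US: "U \<subseteq> S" using U(1) openin_imp_subset by blast
  then have "top_of_set U homeomorphic_space top_of_set V"
    using U(4) by (simp add: subtopology_subtopology Int_absorb1)
  then obtain h k where "homeomorphic_maps (top_of_set U) (top_of_set V) h k"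
    unfolding homeomorphic_space_def by blast
  then have hk: "continuous_on U h" "continuous_on V k" "h ` U \<subseteq> V" "k ` V \<subseteq> U"
     "\<forall>z\<in>U. k (h z) = z" "\<forall>z\<in>V. h (k z) = z"
    by (auto simp: homeomorphic_maps_def)
  then have "h ` U = V" by force
  with hk U show "\<exists>U (V :: (real^2) set) h k. openin (top_of_set S) U \<and> x \<in> U \<and>
     open V \<and> continuous_on U h \<and> h ` U = V \<and> continuous_on V k \<and> (\<forall>z\<in>U. k (h z) = z)"
    by blast
qed

text \<open>Precompose \<open>f\<close> with the inverse of a chart: the result is an injective continuous map
  between planar open sets, to which invariance of domain applies. This is used against a patch of
  the carrier that would look like a half-plane or a line.\<close>

lemma planar_image_open:
  fixes S :: "'b::topological_space set" and f :: "'b \<Rightarrow> real \<times> real"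
  assumes S: "locally_planar S" and W: "openin (top_of_set S) W"
    and f: "continuous_on W f" "inj_on f W"
  shows "open (f ` W)"
proof (subst open_subopen, intro ballI)
  fix y assume "y \<in> f ` W"
  then obtain x where x: "x \<in> W" "y = f x" by blast
  have WS: "W \<subseteq> S" using W openin_imp_subset by blast
  obtain U V h k where U: "openin (top_of_set S) U" "x \<in> U" "open (V :: (real^2) set)"
      "continuous_on U h" "h ` U = V" "continuous_on V k" "\<forall>z\<in>U. k (h z) = z"
    using locally_planarE[OF S subsetD[OF WS x(1)]] .
  have US: "U \<subseteq> S" using U(1) openin_imp_subset by blast
  have kV: "k ` V = U" using U(5,7) by force
  have hk: "\<forall>z\<in>V. h (k z) = z" using U(5,7) by auto
  define V' where "V' = V \<inter> k -` (U \<inter> W)"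
  have "openin (top_of_set S) (U \<inter> W)" using U(1) W by blast
  then have "openin (top_of_set U) (U \<inter> W)"
    by (rule openin_subset_trans) (use US in auto)
  then have "openin (top_of_set V) V'"
    unfolding V'_def using U(6) kV continuous_on_open by blast
  then have oV': "open V'" using U(3) openin_open_trans by blast
  have kV': "k ` V' = U \<inter> W" unfolding V'_def using kV by auto
  have "open ((f \<circ> k) ` V')"
  proof (rule invariance_of_domain_gen[OF oV'])
    show "continuous_on V' (f \<circ> k)"
      by (rule continuous_on_compose)
        (use U(6) f(1) kV' V'_def in \<open>auto intro: continuous_on_subset\<close>)
    show "inj_on (f \<circ> k) V'"
      by (rule comp_inj_on) (use hk f(2) kV' in \<open>auto simp: V'_def inj_on_def, metis\<close>)
  qed simp
  moreover have "(f \<circ> k) ` V' = f ` (U \<inter> W)" using kV' by (metis image_comp)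
  ultimately show "\<exists>T. open T \<and> y \<in> T \<and> T \<subseteq> f ` W" using x U(2) by (metis IntI Int_lower2 image_eqI image_mono)
qed

text \<open>The dual use of invariance of domain, with the chart composed after \<open>g\<close>: a disc that sits
  injectively inside a surface already fills a neighbourhood of each of its points, so nothing else
  can be attached there.\<close>

lemma planar_patch_open:
  fixes S :: "'b::topological_space set" and g :: "real \<times> real \<Rightarrow> 'b"
  assumes S: "locally_planar S" and V0: "open V0"
    and g: "continuous_on V0 g" "inj_on g V0" "g ` V0 \<subseteq> S"
  shows "openin (top_of_set S) (g ` V0)"
proof (subst openin_subopen, intro ballI)
  fix y assume "y \<in> g ` V0"
  then obtain p where p: "p \<in> V0" "y = g p" by blast
  then have yS: "y \<in> S" using g(3) by blast
  obtain U V h k where U: "openin (top_of_set S) U" "y \<in> U" "open (V :: (real^2) set)"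
      "continuous_on U h" "h ` U = V" "continuous_on V k" "\<forall>z\<in>U. k (h z) = z"
    using locally_planarE[OF S yS] .
  have US: "U \<subseteq> S" using U(1) openin_imp_subset by blast
  define V1 where "V1 = V0 \<inter> g -` U"
  have "openin (top_of_set V0) V1"
    unfolding V1_def by (rule continuous_openin_preimage[OF g(1) _ U(1)]) (use g in blast)
  then have oV1: "open V1" using V0 openin_open_trans by blast
  have gV1: "g ` V1 = U \<inter> g ` V0" unfolding V1_def by auto
  define W where "W = (h \<circ> g) ` V1"
  have "open W"
    unfolding W_def
  proof (rule invariance_of_domain_gen[OF oV1])
    show "continuous_on V1 (h \<circ> g)"
      by (rule continuous_on_compose)
        (use U(4) g(1) gV1 V1_def in \<open>auto intro: continuous_on_subset\<close>)
    show "inj_on (h \<circ> g) V1"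
      by (rule comp_inj_on) (use U(7) g(2) in \<open>auto simp: V1_def inj_on_def, metis\<close>)
  qed simp
  have "W = h ` (U \<inter> g ` V0)"
    by (simp add: W_def gV1[symmetric] image_comp)
  moreover have "inj_on h U" using U(7) by (metis inj_onI)
  ultimately have "U \<inter> h -` W = U \<inter> g ` V0"
    by (auto dest: inj_onD)
  moreover have "openin (top_of_set U) (U \<inter> h -` W)"
    using U(4) \<open>open W\<close> by (rule continuous_openin_preimage_gen)
  ultimately have "openin (top_of_set U) (U \<inter> g ` V0)"
    by simp
  then have "openin (top_of_set S) (U \<inter> g ` V0)"
    using U(1) by (rule openin_trans)
  then show "\<exists>T. openin (top_of_set S) T \<and> y \<in> T \<and> T \<subseteq> g ` V0"
    using U(2) p by blast
qed

lemma simplex_subset: "finite_complex K \<Longrightarrow> \<sigma> \<in> K \<Longrightarrow> \<tau> \<subseteq> \<sigma> \<Longrightarrow> \<tau> \<noteq> {} \<Longrightarrow> \<tau> \<in> K"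
  unfolding finite_complex_def by blast

lemma finite_simplex: "finite_complex K \<Longrightarrow> \<sigma> \<in> K \<Longrightarrow> finite \<sigma>"
  unfolding finite_complex_def by blast

lemma simplex_nonempty: "finite_complex K \<Longrightarrow> \<sigma> \<in> K \<Longrightarrow> \<sigma> \<noteq> {}"
  unfolding finite_complex_def by blast

lemma carrier_pointsI:
  assumes "\<And>v. 0 \<le> t v" "{v. t v \<noteq> 0} = \<sigma>" "\<sigma> \<in> K" "(\<Sum>v\<in>A. t v) = 1" "finite A" "\<sigma> \<subseteq> A"
  shows "t \<in> carrier_points K"
proof -
  have "(\<Sum>v | t v \<noteq> 0. t v) = (\<Sum>v\<in>A. t v)"
    by (rule sum.mono_neutral_left) (use assms in auto)
  then show ?thesis using assms by (simp add: carrier_points_def)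
qed

text \<open>If a disc were embedded near \<open>g p\<close> without ever using the vertex \<open>w\<close>, then the segment from
  \<open>g p\<close> towards \<open>w\<close>, which lies in the carrier, would leave the disc at once. This contradicts
  \<open>planar_patch_open\<close>. Superfluous triangles at an edge and superfluous cycles in a link are
  both excluded in this way.\<close>

lemma patch_absorbs:
  fixes g :: "real \<times> real \<Rightarrow> 'a \<Rightarrow> real"
  assumes K: "finite_complex K" and S: "locally_planar (carrier_points K)" and V0: "open V0"
    and g: "continuous_on V0 g" "inj_on g V0" "g ` V0 \<subseteq> carrier_points K"
    and p: "p \<in> V0" and w: "insert w {v. g p v \<noteq> 0} \<in> K"
  shows "\<exists>q\<in>V0. g q w > 0"
proof (rule ccontr)
  assume neg: "\<not> ?thesis"
  let ?S = "carrier_points K"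
  define \<gamma> where "\<gamma> s v = (1 - s) * g p v + s * (if v = w then 1 else 0)" for s :: real and v
  have gp: "g p \<in> ?S" using g p by blast
  have gp0: "0 \<le> g p v" for v using gp by (simp add: carrier_points_def)
  have gpw: "g p w = 0" using neg p gp0 by (metis less_eq_real_def)
  let ?\<sigma> = "{v. g p v \<noteq> 0}"
  have fin: "finite ?\<sigma>"
    using K w unfolding finite_complex_def by (meson finite_insert)
  have s1: "sum (g p) ?\<sigma> = 1"
    using gp by (simp add: carrier_points_def)
  have \<gamma>S: "\<gamma> s \<in> ?S" if "s \<in> {0<..<1}" for s
  proof (rule carrier_pointsI[where \<sigma> = "insert w ?\<sigma>" and A = "insert w ?\<sigma>"])
    show "(\<Sum>v\<in>insert w ?\<sigma>. \<gamma> s v) = 1"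
    proof -
      have "(\<Sum>v\<in>?\<sigma>. \<gamma> s v) = (\<Sum>v\<in>?\<sigma>. (1 - s) * g p v)"
        by (rule sum.cong) (use gpw in \<open>auto simp: \<gamma>_def\<close>)
      also have "\<dots> = 1 - s" using s1 by (simp add: sum_distrib_left[symmetric])
      finally show ?thesis using fin gpw by (simp add: \<gamma>_def)
    qed
  qed (use that gp0 gpw w fin in \<open>auto simp: \<gamma>_def\<close>)
  have \<gamma>0: "\<gamma> 0 = g p" by (auto simp: \<gamma>_def)
  have cont: "continuous_on {0..<1} \<gamma>"
    unfolding \<gamma>_def by (intro continuous_intros)
  have "\<gamma> s \<in> ?S" if "s \<in> {0..<1}" for s
    using \<gamma>S[of s] \<gamma>0 gp that by (cases "s = 0") auto
  then have im: "\<gamma> \<in> {0..<1} \<rightarrow> ?S" by auto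
  have "openin (top_of_set {0..<1}) ({0..<1} \<inter> \<gamma> -` (g ` V0))"
    by (rule continuous_openin_preimage[OF cont im planar_patch_open[OF S V0 g]])
  then obtain T where T: "open T" "{0..<1} \<inter> \<gamma> -` (g ` V0) = {0..<1} \<inter> T"
    by (auto simp: openin_open)
  have "0 \<in> T" using T(2) \<gamma>0 p by (metis Int_iff atLeastLessThan_iff imageI order_refl vimage_eq zero_less_one)
  then obtain e where e: "e > 0" "ball 0 e \<subseteq> T" using T(1) open_contains_ball by blast
  define s where "s = min (e/2) (1/2)"
  have s: "s > 0" "s < 1" "s < e" using e by (auto simp: s_def)
  then have "s \<in> T" using e by (auto simp: dist_real_def)
  then have "\<gamma> s \<in> g ` V0" using T(2) s by (metis Int_iff atLeastLessThan_iff less_eq_real_def vimage_eq)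
  then obtain q where "q \<in> V0" "g q = \<gamma> s" by (elim imageE) metis
  moreover have "\<gamma> s w > 0" using s gpw by (simp add: \<gamma>_def)
  ultimately show False using neg by metis
qed

section \<open>Edges and links of a triangulated surface\<close>

definition tri :: "'a set set \<Rightarrow> 'a \<Rightarrow> 'a \<Rightarrow> 'a \<Rightarrow> bool" where
  "tri K a b c \<longleftrightarrow> {a, b, c} \<in> K \<and> a \<noteq> b \<and> b \<noteq> c \<and> a \<noteq> c"

lemma tri_commute: "tri K a b c \<longleftrightarrow> tri K b a c" "tri K a b c \<longleftrightarrow> tri K a c b"
  by (auto simp: tri_def insert_commute)

lemma continuous_on_coordinate: "continuous_on A (\<lambda>t. t v :: real)"
  by (rule continuous_on_subset[OF continuous_on_product_coordinates]) simp

lemma open_positive_coordinate: "open {t. 0 < (t v :: real)}"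
  by (rule open_Collect_less) (auto intro: continuous_on_coordinate)

lemma carrier_supp:
  assumes "t \<in> carrier_points K"
  shows "0 \<le> t v" "{v. t v \<noteq> 0} \<in> K" "{v. t v \<noteq> 0} \<subseteq> A \<Longrightarrow> finite A \<Longrightarrow> sum t A = 1"
proof -
  show "0 \<le> t v" "{v. t v \<noteq> 0} \<in> K" using assms by (auto simp: carrier_points_def)
  have "(\<Sum>v | t v \<noteq> 0. t v) = sum t A" if "{v. t v \<noteq> 0} \<subseteq> A" "finite A"
    by (rule sum.mono_neutral_left) (use that in auto)
  then show "{v. t v \<noteq> 0} \<subseteq> A \<Longrightarrow> finite A \<Longrightarrow> sum t A = 1"
    using assms by (simp add: carrier_points_def)
qed

text \<open>These are the possible supports of points near the interior of the edge \<open>uv\<close>.\<close>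

lemma coface_of_edge:
  assumes dim: "\<forall>\<sigma>\<in>K. card \<sigma> \<le> 3" and K: "finite_complex K"
    and \<sigma>: "\<sigma> \<in> K" "u \<in> \<sigma>" "v \<in> \<sigma>" "u \<noteq> v"
  shows "\<sigma> = {u, v} \<or> (\<exists>c. tri K u v c \<and> \<sigma> = {u, v, c})"
proof (cases "\<sigma> = {u, v}")
  case False
  then obtain c where c: "c \<in> \<sigma>" "c \<noteq> u" "c \<noteq> v" using \<sigma> by blast
  have "finite \<sigma>" "card \<sigma> \<le> 3" using \<sigma>(1) dim finite_simplex[OF K] by auto
  moreover have "{u, v, c} \<subseteq> \<sigma>" using c \<sigma> by blast
  moreover have "card {u, v, c} = 3" using c \<sigma>(4) by auto
  ultimately have eq: "{u, v, c} = \<sigma>" using card_seteq[of \<sigma> "{u, v, c}"] by linarith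
  then have "tri K u v c" using \<sigma>(1,4) c(2,3) by (simp add: tri_def)
  with eq show ?thesis by blast
qed simp

text \<open>With at most one triangle on it, the open star of the edge \<open>uv\<close> is mapped injectively to the
  closed upper half-plane by the weight of \<open>u\<close> and the weight of the apex, and the midpoint of the
  edge goes to the boundary line. Hence the image is not open.\<close>

lemma edge_in_two_triangles:
  assumes K: "finite_complex K" and dim: "\<forall>\<sigma>\<in>K. card \<sigma> \<le> 3"
    and S: "locally_planar (carrier_points K)"
    and uv: "{u, v} \<in> K" "u \<noteq> v"
  shows "\<exists>c c'. tri K u v c \<and> tri K u v c' \<and> c \<noteq> c'"
proof (rule ccontr)
  assume neg: "\<not> ?thesis"
  let ?S = "carrier_points K"
  obtain c where c: "\<And>c'. tri K u v c' \<Longrightarrow> c' = c"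
    using neg by metis
  define W where "W = ?S \<inter> ({t. 0 < t u} \<inter> {t. 0 < t v})"
  \<comment> \<open>the second coordinate is the weight of the apex if there is a triangle, and 0 otherwise\<close>
  define f :: "('a \<Rightarrow> real) \<Rightarrow> real \<times> real" where "f t = (t u, 1 - t u - t v)" for t
  have W: "openin (top_of_set ?S) W"
    unfolding W_def by (intro openin_open_Int open_Int open_positive_coordinate)
  have supp: "{w. t w \<noteq> 0} \<subseteq> {u, v, c}" if "t \<in> W" for t
  proof -
    have "{w. t w \<noteq> 0} \<in> K" "u \<in> {w. t w \<noteq> 0}" "v \<in> {w. t w \<noteq> 0}"
      using that carrier_supp(2) by (auto simp: W_def)
    from coface_of_edge[OF dim K this uv(2)] show ?thesis using c by auto
  qed
  have rest: "t w = (if w = u then fst (f t) else if w = v then 1 - fst (f t) - snd (f t)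
      else if w = c then snd (f t) else 0)" if "t \<in> W" for t w
  proof -
    have "sum t {u, v, c} = 1"
      using carrier_supp(3)[OF _ supp[OF that]] that by (auto simp: W_def)
    then show ?thesis using supp[OF that] uv(2)
      by (cases "c = u \<or> c = v") (auto simp: f_def insert_absorb)
  qed
  have "inj_on f W"
    by (rule inj_onI, rule ext) (simp add: rest)
  moreover have "continuous_on W f"
    unfolding f_def by (intro continuous_intros continuous_on_coordinate)
  ultimately have op: "open (f ` W)"
    using planar_image_open[OF S W] by blast
  define t0 where "t0 w = (if w = u \<or> w = v then 1/2 else 0 :: real)" for w
  have "t0 \<in> ?S"
    by (rule carrier_pointsI[where \<sigma> = "{u, v}" and A = "{u, v}"]) (use uv in \<open>auto simp: t0_def\<close>)
  then have "t0 \<in> W" by (simp add: W_def t0_def)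
  moreover have "f t0 = (1/2, 0)" using uv by (simp add: f_def t0_def)
  ultimately have "(1/2, 0) \<in> f ` W" by (metis imageI)
  then obtain e where e: "e > 0" "ball (1/2, 0 :: real) e \<subseteq> f ` W"
    using op open_contains_ball by blast
  have "(1/2, -(e/2)) \<in> ball (1/2 :: real, 0 :: real) e" using e by (simp add: dist_Pair_Pair dist_real_def)
  then have "(1/2, -(e/2)) \<in> f ` W" using e(2) by blast
  then obtain t where t': "t \<in> W" "(1/2, -(e/2)) = f t" by (rule imageE) (rule that)
  have t: "t \<in> W" "snd (f t) = - (e / 2)" using t'(1) by (simp_all add: t'(2)[symmetric])
  have "t u + t v \<le> sum t {u, v, c}"
  proof -
    have "sum t {u, v} \<le> sum t {u, v, c}"
      by (rule sum_mono2) (use t carrier_supp(1) in \<open>auto simp: W_def\<close>)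
    then show ?thesis using uv by simp
  qed
  also have "\<dots> = 1" using carrier_supp(3)[OF _ supp[OF t(1)]] t(1) by (auto simp: W_def)
  finally show False using t(2) e(1) by (simp add: f_def)
qed

text \<open>Two triangles on an edge form a disc around its midpoint; the apex of a third one would have
  to be absorbed by it.\<close>

lemma edge_in_at_most_two_triangles:
  assumes K: "finite_complex K" and S: "locally_planar (carrier_points K)"
    and c: "tri K u v c1" "tri K u v c2" "tri K u v c3" "c1 \<noteq> c2" "c1 \<noteq> c3"
  shows "c2 = c3"
proof (rule ccontr)
  assume c23: "c2 \<noteq> c3"
  have ne: "u \<noteq> v" "u \<noteq> c1" "v \<noteq> c1" "u \<noteq> c2" "v \<noteq> c2" "u \<noteq> c3" "v \<noteq> c3"
    using c by (auto simp: tri_def)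
  have uvK: "{u, v} \<in> K"
    by (rule simplex_subset[OF K, of "{u, v, c1}"]) (use c in \<open>auto simp: tri_def\<close>)
  define g :: "real \<times> real \<Rightarrow> 'a \<Rightarrow> real" where "g p w =
     (if w = u then fst p else if w = v then 1 - fst p - \<bar>snd p\<bar>
      else if w = c1 then max 0 (snd p) else if w = c2 then max 0 (- snd p) else 0)" for p w
  define V0 where "V0 = {p :: real \<times> real. 0 < fst p \<and> fst p + \<bar>snd p\<bar> < 1}"
  have V0: "open V0"
    unfolding V0_def by (intro open_Collect_conj open_Collect_less continuous_intros)
  have "continuous_on V0 (\<lambda>p. g p w)" for w
    unfolding g_def
    by (cases "w = u"; cases "w = v"; cases "w = c1"; cases "w = c2") (simp_all add: continuous_intros)
  then have cont: "continuous_on V0 g" by (rule continuous_on_coordinatewise_then_product)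
  have inj: "inj_on g V0"
  proof (rule inj_onI)
    fix p q assume "g p = g q"
    then have "g p w = g q w" for w by simp
    from this[of u] this[of c1] this[of c2] show "p = q"
      using ne c by (auto simp: g_def prod_eq_iff max_def split: if_splits)
  qed
  have sub: "g ` V0 \<subseteq> carrier_points K"
  proof (clarify)
    fix x y assume xy: "(x, y) \<in> V0"
    let ?\<sigma> = "if y = 0 then {u, v} else if y > 0 then {u, v, c1} else {u, v, c2}"
    show "g (x, y) \<in> carrier_points K"
    proof (rule carrier_pointsI[where \<sigma> = ?\<sigma> and A = "{u, v, c1, c2}"])
      show "{w. g (x, y) w \<noteq> 0} = ?\<sigma>" using xy ne c(4) by (auto simp: g_def V0_def)
      show "?\<sigma> \<in> K" using c uvK by (auto simp: tri_def)
      show "(\<Sum>w\<in>{u, v, c1, c2}. g (x, y) w) = 1" using ne c(4) by (auto simp: g_def)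
    qed (use xy in \<open>auto simp: g_def V0_def\<close>)
  qed
  have p: "(1/2, 0) \<in> V0" by (simp add: V0_def)
  have "{w. g (1/2, 0) w \<noteq> 0} = {u, v}" using ne by (auto simp: g_def)
  then have "insert c3 {w. g (1/2, 0) w \<noteq> 0} \<in> K"
    using c(3) by (simp add: tri_def insert_commute)
  from patch_absorbs[OF K S V0 cont inj sub p this] show False
    using ne c c23 by (auto simp: g_def)
qed

text \<open>The cone over a 3-cycle of the link is a disc around \<open>v\<close>. Its planar model is the fan of the
  directions \<open>(1, 0)\<close>, \<open>(0, 1)\<close> and \<open>(-1, -1)\<close>.\<close>

lemma link_3cycle_is_whole_link:
  assumes K: "finite_complex K" and S: "locally_planar (carrier_points K)"
    and c: "tri K v a b" "tri K v b c" "tri K v c a" and w: "{v, w} \<in> K" "w \<noteq> v"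
  shows "w \<in> {a, b, c}"
proof (rule ccontr)
  assume wn: "w \<notin> {a, b, c}"
  have ne: "v \<noteq> a" "v \<noteq> b" "v \<noteq> c" "a \<noteq> b" "b \<noteq> c" "c \<noteq> a"
    using c by (auto simp: tri_def)
  \<comment> \<open>the coefficient of the direction \<open>(-1, -1)\<close>\<close>
  define m where "m p = max 0 (max (- fst p) (- snd p))" for p :: "real \<times> real"
  define g :: "real \<times> real \<Rightarrow> 'a \<Rightarrow> real" where "g p w =
     (if w = a then fst p + m p else if w = b then snd p + m p else if w = c then m p
      else if w = v then 1 - fst p - snd p - 3 * m p else 0)" for p w
  define V0 where "V0 = {p :: real \<times> real. fst p + snd p + 3 * m p < 1}"
  have V0: "open V0"
    unfolding V0_def m_def by (intro open_Collect_less continuous_intros)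
  have "continuous_on V0 (\<lambda>p. g p w)" for w
    unfolding g_def m_def
    by (cases "w = a"; cases "w = b"; cases "w = c"; cases "w = v") (simp_all add: continuous_intros)
  then have cont: "continuous_on V0 g" by (rule continuous_on_coordinatewise_then_product)
  have inj: "inj_on g V0"
  proof (rule inj_onI)
    fix p q assume "g p = g q"
    then have "g p w = g q w" for w by simp
    from this[of a] this[of b] this[of c] show "p = q"
      using ne by (simp add: g_def prod_eq_iff)
  qed
  have sub: "g ` V0 \<subseteq> carrier_points K"
  proof
    fix t assume "t \<in> g ` V0"
    then obtain p where p: "p \<in> V0" "t = g p" by blast
    let ?\<sigma> = "{w. g p w \<noteq> 0}"
    have "g p \<in> carrier_points K"
    proof (rule carrier_pointsI[where \<sigma> = ?\<sigma> and A = "{v, a, b, c}"])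
      have m: "m p = 0 \<or> m p = - fst p \<or> m p = - snd p" by (auto simp: m_def max_def)
      have "v \<in> ?\<sigma>" using p ne by (auto simp: g_def V0_def)
      moreover have "?\<sigma> \<subseteq> {v, a, b} \<or> ?\<sigma> \<subseteq> {v, b, c} \<or> ?\<sigma> \<subseteq> {v, c, a}"
      proof -
        have "g p w = 0" if "w \<notin> {v, a, b, c}" for w using that by (simp add: g_def)
        moreover have "g p c = 0 \<or> g p a = 0 \<or> g p b = 0"
          using m ne by (elim disjE) (simp_all add: g_def)
        ultimately show ?thesis by blast
      qed
      moreover have "{v, a, b} \<in> K" "{v, b, c} \<in> K" "{v, c, a} \<in> K"
        using c by (auto simp: tri_def)
      ultimately show "?\<sigma> \<in> K" using simplex_subset[OF K] by blast
      show "(\<Sum>w\<in>{v, a, b, c}. g p w) = 1" using ne by (auto simp: g_def)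
    qed (use p in \<open>auto simp: g_def m_def V0_def\<close>)
    then show "t \<in> carrier_points K" using p by simp
  qed
  have p: "(0, 0) \<in> V0" by (simp add: V0_def m_def)
  have "{w. g (0, 0) w \<noteq> 0} = {v}" using ne by (auto simp: g_def m_def)
  then have "insert w {w. g (0, 0) w \<noteq> 0} \<in> K"
    using w by (simp add: insert_commute)
  from patch_absorbs[OF K S V0 cont inj sub p this] show False
    using w wn by (auto simp: g_def)
qed

definition edge_connected :: "'a set set \<Rightarrow> bool" where
  "edge_connected K \<longleftrightarrow> (\<forall>A\<subseteq>vertices K. A \<noteq> {} \<longrightarrow>
     (\<forall>u\<in>A. \<forall>v. {u, v} \<in> K \<longrightarrow> v \<in> A) \<longrightarrow> A = vertices K)"

text \<open>A set of vertices that is closed under edges and its complement cut the carrier into two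
  disjoint open sets: no simplex has vertices in both.\<close>

lemma edge_connected_if_connected:
  assumes K: "finite_complex K" and conn: "connected (carrier_points K)"
  shows "edge_connected K"
  unfolding edge_connected_def
proof (intro allI impI, rule ccontr)
  fix A assume A: "A \<subseteq> vertices K" "A \<noteq> {}" and closed: "\<forall>u\<in>A. \<forall>v. {u, v} \<in> K \<longrightarrow> v \<in> A"
  assume "A \<noteq> vertices K"
  then obtain b where b: "b \<in> vertices K" "b \<notin> A" using A by blast
  obtain a where a: "a \<in> A" using A by blast
  let ?S = "carrier_points K"
  define E1 where "E1 = (\<Union>v\<in>A. {t. 0 < (t v :: real)})"
  define E2 where "E2 = (\<Union>v\<in>vertices K - A. {t. 0 < (t v :: real)})"
  have vertex_pt: "(\<lambda>w. if w = v then 1 else 0) \<in> ?S" if "v \<in> vertices K" for v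
  proof (rule carrier_pointsI[where \<sigma> = "{v}" and A = "{v}"])
    show "{v} \<in> K" using that simplex_subset[OF K] unfolding vertices_def by blast
  qed auto
  have "open E1" "open E2" unfolding E1_def E2_def
    by (intro open_UN ballI open_positive_coordinate)+
  moreover have "?S \<subseteq> E1 \<union> E2"
  proof
    fix t assume t: "t \<in> ?S"
    have "{v. t v \<noteq> 0} \<noteq> {}" using carrier_supp(2)[OF t] simplex_nonempty[OF K] by blast
    then obtain v where v: "t v \<noteq> 0" by blast
    then have "v \<in> vertices K" using carrier_supp(2)[OF t] unfolding vertices_def by blast
    moreover have "0 < t v" using v carrier_supp(1)[OF t, of v] by linarith
    ultimately show "t \<in> E1 \<union> E2" unfolding E1_def E2_def by blast
  qed
  moreover have "E1 \<inter> E2 \<inter> ?S = {}"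
  proof (rule ccontr)
    assume "E1 \<inter> E2 \<inter> ?S \<noteq> {}"
    then obtain t u v where t: "t \<in> ?S" "u \<in> A" "0 < t u" "v \<in> vertices K - A" "0 < t v"
      unfolding E1_def E2_def by blast
    have "{u, v} \<in> K"
      by (rule simplex_subset[OF K carrier_supp(2)[OF t(1)]]) (use t in auto)
    then show False using closed t by blast
  qed
  moreover have "E1 \<inter> ?S \<noteq> {}" "E2 \<inter> ?S \<noteq> {}"
  proof -
    have "(\<lambda>w. if w = a then 1 else 0) \<in> E1 \<inter> ?S"
      using a A vertex_pt unfolding E1_def by force
    moreover have "(\<lambda>w. if w = b then 1 else 0) \<in> E2 \<inter> ?S"
      using b vertex_pt unfolding E2_def by force
    ultimately show "E1 \<inter> ?S \<noteq> {}" "E2 \<inter> ?S \<noteq> {}" by blast+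
  qed
  ultimately show False using conn unfolding connected_def by blast
qed

section \<open>Hexagonal links\<close>

text \<open>The vertices \<open>b, c, d, e, f, g\<close> are listed in cyclic order around \<open>a\<close>.\<close>

definition link_hexagon :: "'a set set \<Rightarrow> 'a \<Rightarrow> 'a \<Rightarrow> 'a \<Rightarrow> 'a \<Rightarrow> 'a \<Rightarrow> 'a \<Rightarrow> 'a \<Rightarrow> bool" where
  "link_hexagon K a b c d e f g \<longleftrightarrow> distinct [a, b, c, d, e, f, g] \<and>
     (\<forall>u w. tri K a u w \<longleftrightarrow> {u, w} \<in> {{b, c}, {c, d}, {d, e}, {e, f}, {f, g}, {g, b}})"

definition hexagonal :: "'a set set \<Rightarrow> bool" where
  "hexagonal K \<longleftrightarrow> finite_complex K \<and> (\<forall>\<sigma>\<in>K. \<exists>a b c. \<sigma> \<subseteq> {a, b, c} \<and> tri K a b c) \<and>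
     (\<forall>a\<in>vertices K. \<exists>b c d e f g. link_hexagon K a b c d e f g)"

lemma hexagonalD:
  assumes "hexagonal K"
  shows "finite_complex K" "\<sigma> \<in> K \<Longrightarrow> \<exists>a b c. \<sigma> \<subseteq> {a, b, c} \<and> tri K a b c"
    "a \<in> vertices K \<Longrightarrow> \<exists>b c d e f g. link_hexagon K a b c d e f g"
  using assms by (simp_all add: hexagonal_def)

lemma link_hexagon_rotate:
  "link_hexagon K a b c d e f g \<Longrightarrow> link_hexagon K a c d e f g b"
  unfolding link_hexagon_def by (simp add: insert_commute) blast

lemma link_hexagon_rotations:
  assumes "link_hexagon K a b c d e f g"
  shows "link_hexagon K a c d e f g b" "link_hexagon K a d e f g b c" "link_hexagon K a e f g b c d"
    "link_hexagon K a f g b c d e" "link_hexagon K a g b c d e f"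
  using assms by (meson link_hexagon_rotate)+

lemma link_hexagon_reflect:
  "link_hexagon K a b c d e f g \<Longrightarrow> link_hexagon K a c b g f e d"
  unfolding link_hexagon_def by (simp add: insert_commute) blast

text \<open>The dihedral group of the hexagon acts transitively on its directed edges, so the listing can
  start with any prescribed triangle.\<close>

lemma hexagonal_flag:
  assumes K: "hexagonal K" and t: "tri K a b c"
  shows "\<exists>d e f g. link_hexagon K a b c d e f g"
proof -
  have "a \<in> vertices K" using t by (auto simp: tri_def vertices_def)
  then obtain p q r s x y where h: "link_hexagon K a p q r s x y"
    by (elim hexagonalD(3)[OF K, THEN exE] exE) (rule that)
  note h1_5 = link_hexagon_rotations[OF h]
  define P where "P b c \<longleftrightarrow> (\<exists>d e f g. link_hexagon K a b c d e f g)" for b c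
  have P: "P b c \<and> P c b" if "link_hexagon K a b c d e f g" for b c d e f g
    unfolding P_def using that link_hexagon_reflect[OF that] by blast
  have "{b, c} \<in> {{p, q}, {q, r}, {r, s}, {s, x}, {x, y}, {y, p}}"
    using h t by (simp add: link_hexagon_def)
  then have "P b c"
    using P[OF h] P[OF h1_5(1)] P[OF h1_5(2)] P[OF h1_5(3)] P[OF h1_5(4)] P[OF h1_5(5)] by (auto simp: doubleton_eq_iff)
  then show ?thesis unfolding P_def .
qed

text \<open>A 2-regular graph on six vertices is a hexagon or two disjoint triangles. Starting from a vertex
  \<open>b\<close> with neighbours \<open>c\<close> and \<open>g\<close>, their other neighbours \<open>d\<close> and \<open>f\<close> are new,
  as there is no 3-cycle; they are different, since otherwise a 4-cycle would leave two vertices that cannot both have degree two; so the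
  remaining vertex \<open>e\<close> closes the hexagon.\<close>

lemma two_regular_on_six:
  assumes N: "card N = 6" and nb: "\<And>x. x \<in> N \<Longrightarrow> card {y. R x y} = 2"
    and RN: "\<And>x y. R x y \<Longrightarrow> x \<in> N" and sym: "\<And>x y. R x y \<Longrightarrow> R y x"
    and irr: "\<And>x. \<not> R x x" and no3: "\<And>x y z. R x y \<Longrightarrow> R y z \<Longrightarrow> \<not> R z x"
  shows "\<exists>b c d e f g. N = {b, c, d, e, f, g} \<and> distinct [b, c, d, e, f, g] \<and>
     (\<forall>u w. R u w \<longleftrightarrow> {u, w} \<in> {{b, c}, {c, d}, {d, e}, {e, f}, {f, g}, {g, b}})"
proof -
  have finN: "finite N" using N card.infinite by fastforce
  have other: "\<exists>z. z \<noteq> y \<and> {w. R x w} = {y, z}" if "R x y" for x y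
  proof -
    have "card {w. R x w} = 2" using nb RN that by blast
    then obtain p q where "{w. R x w} = {p, q}" "p \<noteq> q" by (auto simp: card_2_iff)
    then show ?thesis using that by (intro exI[of _ "if y = p then q else p"]) auto
  qed
  have RN': "R x y \<Longrightarrow> y \<in> N" for x y using RN sym by blast
  obtain b where b: "b \<in> N" using N by fastforce
  obtain c g where Nb: "{y. R b y} = {c, g}" "c \<noteq> g" using nb[OF b] by (auto simp: card_2_iff)
  then have Rbc: "R b c" "R b g" by auto
  obtain d where Nc: "{y. R c y} = {b, d}" "d \<noteq> b" using other[OF sym[OF Rbc(1)]] by blast
  obtain f where Ng: "{y. R g y} = {b, f}" "f \<noteq> b" using other[OF sym[OF Rbc(2)]] by blast
  have Rcd: "R c d" and Rgf: "R g f" using Nc Ng by auto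
  have n1: "d \<noteq> g" "f \<noteq> c" using no3 Rbc Rcd Rgf sym by blast+
  have n2: "b \<noteq> c" "b \<noteq> g" "c \<noteq> d" "g \<noteq> f" using irr Rbc Rcd Rgf by metis+
  have df: "d \<noteq> f"
  proof
    assume "d = f"
    have "{c, g} \<subseteq> {y. R d y}" using Rcd Rgf sym \<open>d = f\<close> by blast
    moreover have "finite {y. R d y}" "card {y. R d y} = 2"
      using nb[OF RN'[OF Rcd]] by (auto intro: card_ge_0_finite)
    ultimately have Nd: "{y. R d y} = {c, g}" using Nb(2) by (metis card_2_iff card_seteq order_refl)
    have "card {b, c, d, g} \<le> 4" by (simp add: card_insert_if)
    then have c2: "card (N - {b, c, d, g}) \<ge> 2" using N diff_card_le_card_Diff[of "{b,c,d,g}" N] by simp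
    then have "N - {b, c, d, g} \<noteq> {}" by (intro notI) simp
    then obtain x where x: "x \<in> N - {b, c, d, g}" by blast
    have cl4: "z \<in> {b, c, d, g}" if "p \<in> {b, c, d, g}" "R p z" for p z
    proof -
      have "z \<in> {y. R p y}" using that(2) by simp
      moreover have "{y. R p y} \<subseteq> {b, c, d, g}"
        using that(1) Nb(1) Nc(1) Nd Ng(1) \<open>d = f\<close> by (elim insertE) simp_all
      ultimately show ?thesis by blast
    qed
    have "{y. R x y} \<subseteq> N - {b, c, d, g} - {x}"
    proof
      fix y assume "y \<in> {y. R x y}"
      then have y: "R x y" "R y x" using sym by auto
      then show "y \<in> N - {b, c, d, g} - {x}"
        using RN[OF y(2)] cl4[OF _ y(2)] x irr[of y] y(1) by blast
    qed
    moreover have "card (N - {b, c, d, g} - {x}) = 1"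
    proof -
      have "card {b, c, d, g} = 4" using n1 n2 Nb(2) Nc(2) by auto
      moreover have "{b, c, d, g} \<subseteq> N" using b RN' Rbc Rcd by auto
      ultimately have "card (N - {b, c, d, g}) = 2" using N by (simp add: card_Diff_subset)
      then show ?thesis using x by (simp add: card_Diff_singleton)
    qed
    ultimately have "card {y. R x y} \<le> 1" by (metis card_mono card.infinite finN finite_Diff)
    then show False using nb x by fastforce
  qed
  have five: "card {b, c, d, f, g} = 5" using df n1 n2 Nb(2) Nc(2) Ng(2) by auto
  have five': "{b, c, d, f, g} \<subseteq> N" using b RN' Rbc Rcd Rgf by auto
  have "card (N - {b, c, d, f, g}) = 1" using N five five' by (simp add: card_Diff_subset)
  then obtain e where e: "N - {b, c, d, f, g} = {e}" by (auto simp: card_1_singleton_iff)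
  then have Neq: "N = {b, c, d, e, f, g}" using five' by blast
  have ne: "e \<noteq> b" "e \<noteq> c" "e \<noteq> d" "e \<noteq> f" "e \<noteq> g" using e by blast+
  have "{y. R e y} \<subseteq> {d, f}"
  proof
    fix y assume "y \<in> {y. R e y}"
    then have y: "R e y" "R y e" using sym by auto
    then have "y \<in> N" "y \<noteq> e" using RN irr by blast+
    moreover have "y \<noteq> b" "y \<noteq> c" "y \<noteq> g" using y(2) ne Nb(1) Nc(1) Ng(1) by blast+
    ultimately show "y \<in> {d, f}" using Neq by blast
  qed
  moreover have "card {y. R e y} = 2" using nb Neq by blast
  ultimately have Ne: "{y. R e y} = {d, f}" using df by (intro card_seteq) auto
  have Rde: "R d e" "R f e" using Ne sym by blast+
  have pin: "{y. R p y} = {e, q}" if pq: "R p e" "R p q" "q \<noteq> e" for p q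
  proof -
    obtain z where z: "{y. R p y} = {e, z}" using other[OF pq(1)] by blast
    have "q \<in> {y. R p y}" using pq(2) by simp
    then show ?thesis using pq(3) unfolding z by simp
  qed
  have Nd: "{y. R d y} = {e, c}" by (rule pin[OF Rde(1) sym[OF Rcd]]) (use ne in simp)
  have Nf: "{y. R f y} = {e, g}" by (rule pin[OF Rde(2) sym[OF Rgf]]) (use ne in simp)
  have dist: "distinct [b, c, d, e, f, g]" using df n1 n2 ne Nb(2) Nc(2) Ng(2) by auto
  have nbs: "R b w \<longleftrightarrow> w = c \<or> w = g" "R c w \<longleftrightarrow> w = b \<or> w = d" "R d w \<longleftrightarrow> w = e \<or> w = c"
     "R e w \<longleftrightarrow> w = d \<or> w = f" "R f w \<longleftrightarrow> w = e \<or> w = g" "R g w \<longleftrightarrow> w = b \<or> w = f" for w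
    using Nb(1) Nc(1) Nd Ne Nf Ng(1) by blast+
  have "R u w \<longleftrightarrow> {u, w} \<in> {{b, c}, {c, d}, {d, e}, {e, f}, {f, g}, {g, b}}" for u w
  proof (cases "u \<in> N")
    case True
    then consider "u = b" | "u = c" | "u = d" | "u = e" | "u = f" | "u = g" using Neq by blast
    then show ?thesis
      by cases (use dist in \<open>simp_all add: nbs doubleton_eq_iff, blast+\<close>)
  next
    case False
    then show ?thesis using RN Neq by (auto simp: doubleton_eq_iff)
  qed
  then show ?thesis using Neq dist by blast
qed

lemma finite_vertices: "finite_complex K \<Longrightarrow> finite (vertices K)"
  by (simp add: vertices_def finite_complex_def)

lemma singleton_simplex: "finite_complex K \<Longrightarrow> v \<in> vertices K \<Longrightarrow> {v} \<in> K"
  unfolding vertices_def using simplex_subset by blast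

lemma faces_1: "faces 1 K = {e \<in> K. card e = 2}" "faces (Suc 0) K = {e \<in> K. card e = 2}" and faces_2: "faces 2 K = {t \<in> K. card t = 3}"
  by (simp_all add: faces_def eval_nat_numeral)

lemma card_faces_0:
  assumes K: "finite_complex K"
  shows "card (faces 0 K) = card (vertices K)"
proof -
  have "faces 0 K = (\<lambda>v. {v}) ` vertices K"
    using singleton_simplex[OF K] by (auto simp: faces_def card_1_singleton_iff vertices_def)
  then show ?thesis by (simp add: card_image)
qed

lemma edge_cofaces:
  assumes uv: "u \<noteq> v"
  shows "card {t \<in> faces 2 K. {u, v} \<subseteq> t} = card {c. tri K u v c}"
proof -
  have "{t \<in> faces 2 K. {u, v} \<subseteq> t} = (\<lambda>c. {u, v, c}) ` {c. tri K u v c}" (is "?L = ?R")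
  proof
    show "?R \<subseteq> ?L" by (auto simp: faces_1 faces_2 tri_def)
    show "?L \<subseteq> ?R"
    proof
      fix t assume t: "t \<in> ?L"
      then have "card (t - {u, v}) = 1" using uv by (simp add: faces_1 faces_2 card_Diff_subset)
      then obtain c where "t - {u, v} = {c}" by (auto simp: card_1_singleton_iff)
      then have "t = {u, v, c}" "c \<noteq> u" "c \<noteq> v" using t by blast+
      then show "t \<in> ?R" using t uv by (auto simp: faces_1 faces_2 tri_def)
    qed
  qed
  moreover have "inj_on (\<lambda>c. {u, v, c}) {c. tri K u v c}"
  proof (rule inj_onI)
    fix x y assume xy: "x \<in> {c. tri K u v c}" "y \<in> {c. tri K u v c}" and eq: "{u, v, x} = {u, v, y}"
    have "x \<in> {u, v, y}" unfolding eq[symmetric] by simp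
    then show "x = y" using xy(1) by (auto simp: tri_def)
  qed
  ultimately show ?thesis by (simp add: card_image)
qed

text \<open>Double counting of incident pairs: \<open>n d = 2 f\<^sub>1\<close> and \<open>3 f\<^sub>2 = 2 f\<^sub>1\<close>.\<close>

lemma euler_char_regular:
  assumes K: "finite_complex K"
    and two: "\<And>u v. {u, v} \<in> K \<Longrightarrow> u \<noteq> v \<Longrightarrow> card {c. tri K u v c} = 2"
    and deg: "\<And>v. v \<in> vertices K \<Longrightarrow> vertex_degree K v = d"
  shows "6 * euler_char K = int (card (vertices K)) * (6 - int d)"
proof -
  have "finite K" using K by (simp add: finite_complex_def)
  then have fin: "finite (faces i K)" for i by (simp add: faces_def)
  have "(\<Sum>e\<in>faces 1 K. card {t \<in> faces 2 K. e \<subseteq> t}) = 3 * card (faces 2 K)"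
  proof (rule sum_multicount[OF fin fin], intro ballI)
    fix t assume t: "t \<in> faces 2 K"
    then have ft: "finite t" "card t = 3" "t \<in> K" using finite_simplex[OF K] by (auto simp: faces_1 faces_2)
    have "e \<in> K" if "e \<subseteq> t" "card e = 2" for e
      using simplex_subset[OF K ft(3) that(1)] that(2) by fastforce
    then have "{e \<in> faces 1 K. e \<subseteq> t} = {e. e \<subseteq> t \<and> card e = 2}"
      unfolding faces_1 by blast
    then show "card {e \<in> faces 1 K. e \<subseteq> t} = 3" using n_subsets[OF ft(1), of 2] ft(2)
      by (simp add: eval_nat_numeral)
  qed
  moreover have "(\<Sum>e\<in>faces 1 K. card {t \<in> faces 2 K. e \<subseteq> t}) = (\<Sum>e\<in>faces 1 K. 2)"
  proof (rule sum.cong[OF refl])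
    fix e assume "e \<in> faces 1 K"
    then obtain u v where "e = {u, v}" "u \<noteq> v" "{u, v} \<in> K" by (auto simp: faces_1 faces_2 card_2_iff)
    then show "card {t \<in> faces 2 K. e \<subseteq> t} = 2" using edge_cofaces two by metis
  qed
  ultimately have 1: "2 * card (faces 1 K) = 3 * card (faces 2 K)" by simp
  have "(\<Sum>v\<in>vertices K. card {e \<in> faces 1 K. v \<in> e}) = 2 * card (faces 1 K)"
  proof (rule sum_multicount[OF finite_vertices[OF K] fin], intro ballI)
    fix e assume e: "e \<in> faces 1 K"
    then have "{v \<in> vertices K. v \<in> e} = e" by (auto simp: faces_1 faces_2 vertices_def)
    then show "card {v \<in> vertices K. v \<in> e} = 2" using e by (simp add: faces_1 faces_2)
  qed
  moreover have "(\<Sum>v\<in>vertices K. card {e \<in> faces 1 K. v \<in> e}) = card (vertices K) * d"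
    using deg by (simp add: vertex_degree_def)
  ultimately have 2: "card (vertices K) * d = 2 * card (faces 1 K)" by simp
  have "6 * euler_char K = 6 * int (card (vertices K)) - int (2 * card (faces 1 K))
      - int (2 * (2 * card (faces 1 K))) + int (2 * (3 * card (faces 2 K)))"
    by (simp add: euler_char_def card_faces_0[OF K])
  also have "\<dots> = 6 * int (card (vertices K)) - int (card (vertices K) * d)"
    unfolding 1[symmetric] 2[symmetric] by simp
  finally show ?thesis by (simp add: algebra_simps)
qed

lemma vertex_degree_neighbours: "vertex_degree K v = card {w. {v, w} \<in> K \<and> w \<noteq> v}"
proof -
  have "{e \<in> faces 1 K. v \<in> e} = (\<lambda>w. {v, w}) ` {w. {v, w} \<in> K \<and> w \<noteq> v}"
  proof (intro equalityI subsetI)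
    fix e assume "e \<in> {e \<in> faces 1 K. v \<in> e}"
    then obtain p q where e: "e = {p, q}" "p \<noteq> q" "e \<in> K" "v \<in> e"
      by (auto simp: faces_1 card_2_iff)
    then obtain w where "e = {v, w}" "w \<noteq> v" by blast
    then show "e \<in> (\<lambda>w. {v, w}) ` {w. {v, w} \<in> K \<and> w \<noteq> v}" using e(3) by blast
  qed (auto simp: faces_1)
  moreover have "inj_on (\<lambda>w. {v, w}) {w. {v, w} \<in> K \<and> w \<noteq> v}"
    by (auto simp: inj_on_def doubleton_eq_iff)
  ultimately show ?thesis by (simp add: vertex_degree_def card_image)
qed

lemma chi0_edge_connected:
  assumes "dr_manifold_chi0 n K"
  shows "edge_connected K"
proof (rule edge_connected_if_connected)
  show "finite_complex K"
    using assms by (simp add: dr_manifold_chi0_def combinatorial_2_manifold_def)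
  show "connected (carrier_points K)"
    using assms connectedin_iff_connected[of "carrier_points K"]
    by (simp add: dr_manifold_chi0_def degree_regular_def geometric_carrier_eq connectedin_def)
qed

text \<open>Invariance of domain puts exactly two triangles on each edge, so by the Euler characteristic
  all degrees are 6. Links are then 2-regular graphs on six vertices, and a 3-cycle in a link
  would already be the whole link.\<close>

theorem chi0_hexagonal:
  assumes M: "dr_manifold_chi0 n K" and n: "n > 0"
  shows "hexagonal K"
proof -
  let ?S = "carrier_points K"
  have K: "finite_complex K" and dim: "\<forall>\<sigma>\<in>K. card \<sigma> \<le> 3" and "closed_surface (geometric_carrier K)"
    using M by (auto simp: dr_manifold_chi0_def combinatorial_2_manifold_def two_dimensional_def)
  then have S: "locally_planar ?S"
    using closed_surface_locally_planar by (simp add: geometric_carrier_eq)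
  have two: "card {c. tri K u v c} = 2" if uv: "{u, v} \<in> K" "u \<noteq> v" for u v
  proof -
    obtain c c' where c: "tri K u v c" "tri K u v c'" "c \<noteq> c'"
      using edge_in_two_triangles[OF K dim S uv] by blast
    then have "{c. tri K u v c} = {c, c'}"
      using edge_in_at_most_two_triangles[OF K S c(1,2) _ c(3)] by blast
    then show ?thesis using c(3) by simp
  qed
  obtain d where deg: "\<And>v. v \<in> vertices K \<Longrightarrow> vertex_degree K v = d"
    using M by (auto simp: dr_manifold_chi0_def degree_regular_def)
  have "int n * (6 - int d) = 0"
    using euler_char_regular[OF K two deg] M by (simp add: dr_manifold_chi0_def)
  then have d6: "d = 6" using n by simp
  have edge_tri: "\<exists>c. tri K u v c" if "{u, v} \<in> K" "u \<noteq> v" for u v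
    using edge_in_two_triangles[OF K dim S that] by blast
  have edge: "{u, v} \<in> K" if "tri K u v w" for u v w
    by (rule simplex_subset[OF K, of "{u, v, w}"]) (use that in \<open>auto simp: tri_def\<close>)
  have nbrs: "card {w. {v, w} \<in> K \<and> w \<noteq> v} = 6" if "v \<in> vertices K" for v
    using deg[OF that] d6 by (simp add: vertex_degree_neighbours)
  have pure: "\<exists>a b c. \<sigma> \<subseteq> {a, b, c} \<and> tri K a b c" if \<sigma>: "\<sigma> \<in> K" for \<sigma>
  proof -
    obtain a where a: "a \<in> \<sigma>" using simplex_nonempty[OF K \<sigma>] by blast
    show ?thesis
    proof (cases "\<sigma> = {a}")
      case True
      have "a \<in> vertices K" using a \<sigma> by (auto simp: vertices_def)
      then obtain w where "{a, w} \<in> K" "w \<noteq> a" using nbrs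
        by (metis (mono_tags, lifting) Collect_empty_eq card.empty zero_neq_numeral)
      then obtain c where "tri K a w c" using edge_tri by metis
      then show ?thesis using True by blast
    next
      case False
      then obtain b where b: "b \<in> \<sigma>" "a \<noteq> b" using a by blast
      from coface_of_edge[OF dim K \<sigma> a b] show ?thesis
      proof
        assume "\<sigma> = {a, b}"
        then obtain c where "tri K a b c" using edge_tri \<sigma> b by blast
        then show ?thesis using \<open>\<sigma> = {a, b}\<close> by blast
      qed blast
    qed
  qed
  have hex: "\<exists>b c d e f g. link_hexagon K a b c d e f g" if a: "a \<in> vertices K" for a
  proof -
    let ?N = "{w. {a, w} \<in> K \<and> w \<noteq> a}"
    have "\<exists>b c d e f g. ?N = {b, c, d, e, f, g} \<and> distinct [b, c, d, e, f, g] \<and>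
     (\<forall>u w. tri K a u w \<longleftrightarrow> {u, w} \<in> {{b, c}, {c, d}, {d, e}, {e, f}, {f, g}, {g, b}})"
    proof (rule two_regular_on_six)
      show "card ?N = 6" by (rule nbrs[OF a])
      show "card {y. tri K a x y} = 2" if "x \<in> ?N" for x using that two[of a x] by auto
      show "tri K a x y \<Longrightarrow> x \<in> ?N" for x y using edge[of a x y] by (auto simp: tri_def)
      show "\<not> tri K a x x" for x by (simp add: tri_def)
      fix x y
      assume xy: "tri K a x y"
      then show "tri K a y x" using tri_commute by metis
      fix z assume yz: "tri K a y z"
      show "\<not> tri K a z x"
      proof
        assume zx: "tri K a z x"
        have "?N \<subseteq> {x, y, z}"
          using link_3cycle_is_whole_link[OF K S xy yz zx] by blast
        then have "card ?N \<le> card {x, y, z}" by (intro card_mono) auto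
        also have "\<dots> \<le> 3" by (simp add: card_insert_if)
        finally show False using nbrs[OF a] by simp
      qed
    qed
    then obtain b c d e f g where *: "?N = {b, c, d, e, f, g}" "distinct [b, c, d, e, f, g]"
     "\<forall>u w. tri K a u w \<longleftrightarrow> {u, w} \<in> {{b, c}, {c, d}, {d, e}, {e, f}, {f, g}, {g, b}}"
      by (elim exE conjE) (rule that)
    have "a \<notin> {b, c, d, e, f, g}" unfolding *(1)[symmetric] by simp
    then have "link_hexagon K a b c d e f g" using *(2,3) unfolding link_hexagon_def by simp
    then show ?thesis by blast
  qed
  show ?thesis unfolding hexagonal_def using K pure hex by simp
qed

section \<open>Hexagonal complexes are closed surfaces\<close>

text \<open>The carrier is the intersection of a cube, which is compact by Tychonoff's theorem, with the
  finite union of the closed sets cut out by the individual simplices.\<close>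

lemma compact_carrier_points:
  assumes K: "finite_complex K"
  shows "compact (carrier_points K)"
proof -
  define box :: "('a \<Rightarrow> real) set" where "box = (\<Pi>\<^sub>E v\<in>UNIV. {0..1})"
  have "compactin (product_topology (\<lambda>_. euclideanreal) (UNIV :: 'a set)) box"
    unfolding box_def by (simp add: compactin_PiE)
  then have box: "compact box"
    by (simp add: euclidean_product_topology)
  have "closed (\<Union>\<sigma>\<in>K. {t. (\<forall>v. v \<notin> \<sigma> \<longrightarrow> t v = 0) \<and> sum t \<sigma> = (1::real)})"
  proof (intro closed_UN ballI closed_Collect_conj closed_Collect_all)
    show "finite K" using K by (simp add: finite_complex_def)
    show "closed {t. v \<notin> \<sigma> \<longrightarrow> t v = (0::real)}" for v \<sigma>
      by (cases "v \<in> \<sigma>") (auto intro!: closed_Collect_eq continuous_on_coordinate)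
    show "closed {t. sum t \<sigma> = (1::real)}" for \<sigma> :: "'a set"
      by (intro closed_Collect_eq continuous_on_sum continuous_on_coordinate continuous_on_const)
  qed
  moreover have "carrier_points K = box \<inter> (\<Union>\<sigma>\<in>K. {t. (\<forall>v. v \<notin> \<sigma> \<longrightarrow> t v = 0) \<and> sum t \<sigma> = 1})"
    (is "_ = _ \<inter> ?U")
  proof (intro equalityI subsetI IntI)
    fix t assume t: "t \<in> carrier_points K"
    let ?\<sigma> = "{v. t v \<noteq> 0}"
    note t' = carrier_supp(1,2)[OF t]
    have fin: "finite ?\<sigma>" using finite_simplex[OF K t'(2)] .
    have s: "sum t ?\<sigma> = 1" using carrier_supp(3)[OF t order_refl fin] .
    show "t \<in> ?U" using t' s by (intro UN_I[of ?\<sigma>]) auto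
    have "t v \<le> 1" for v
    proof (cases "t v = 0")
      case False
      then have "t v \<le> sum t ?\<sigma>" by (intro member_le_sum) (use t' fin in auto)
      then show ?thesis using s by simp
    qed simp
    then show "t \<in> box" using t' by (auto simp: box_def)
  next
    fix t assume "t \<in> box \<inter> ?U"
    then obtain \<sigma> where \<sigma>: "\<sigma> \<in> K" "\<And>v. v \<notin> \<sigma> \<Longrightarrow> t v = 0" "sum t \<sigma> = 1" and t0: "\<And>v. 0 \<le> t v"
      by (auto simp: box_def PiE_iff)
    have sub: "{v. t v \<noteq> 0} \<subseteq> \<sigma>" using \<sigma>(2) by blast
    have "{v. t v \<noteq> 0} \<noteq> {}" using \<sigma>(3) by (metis (mono_tags, lifting) Collect_empty_eq sum.neutral zero_neq_one)
    then have "{v. t v \<noteq> 0} \<in> K" using simplex_subset[OF K \<sigma>(1) sub] by blast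
    then show "t \<in> carrier_points K"
      using carrier_pointsI[OF t0 refl _ \<sigma>(3) finite_simplex[OF K \<sigma>(1)] sub] by blast
  qed
  ultimately show ?thesis using box by (simp add: compact_Int_closed)
qed

text \<open>The six triangles spanned by consecutive vectors among \<open>(1,0), (1,1), (0,1), (-1,0), (-1,-1),
  (0,-1)\<close> tile a neighbourhood of the origin. These are the six coefficients of \<open>(x, y)\<close> when it is
  written as a non-negative combination of the two vectors that span its sector.\<close>

definition fan :: "real \<Rightarrow> real \<Rightarrow> real list" where
  "fan x y = [max 0 (min x (x - y)), max 0 (min x y), max 0 (min y (y - x)),
     max 0 (min (- x) (y - x)), max 0 (min (- x) (- y)), max 0 (min (- y) (x - y))]"

lemma triangle_rotate_to_vertex:
  assumes "tri K x y z" "a \<in> {x, y, z}"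
  shows "\<exists>p q. {x, y, z} = {a, p, q} \<and> tri K a p q"
proof -
  have "tri K y x z" "tri K z x y" using assms(1) tri_commute by metis+
  moreover have "{x, y, z} = {y, x, z}" "{x, y, z} = {z, x, y}" by auto
  ultimately show ?thesis using assms by blast
qed

text \<open>The piecewise linear map that sends \<open>a\<close> to the origin and its neighbours to the six vectors of
  the fan identifies the open star of \<open>a\<close> with an open planar hexagon; its inverse is given
  explicitly by the coefficients of the fan.\<close>

lemma hexagon_chart:
  assumes K: "hexagonal K" and h: "link_hexagon K a b c d e f g"
  shows "top_of_set {t \<in> carrier_points K. 0 < t a} homeomorphic_space
     top_of_set {z :: real^2. sum_list (fan (z$1) (z$2)) < 1}"
proof -
  let ?S = "carrier_points K"
  let ?U = "{t \<in> ?S. 0 < t a}" and ?V = "{z :: real^2. sum_list (fan (z$1) (z$2)) < 1}"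
  note fc = hexagonalD(1)[OF K]
  define \<psi> :: "('a \<Rightarrow> real) \<Rightarrow> real^2" where
    "\<psi> t = (\<chi> i. if i = 1 then t b + t c - t e - t f else t c + t d - t f - t g)" for t
  define \<phi> :: "real^2 \<Rightarrow> 'a \<Rightarrow> real" where "\<phi> z w =
    (let F = fan (z$1) (z$2) in
     if w = a then 1 - sum_list F else if w = b then F ! 0 else if w = c then F ! 1
     else if w = d then F ! 2 else if w = e then F ! 3 else if w = f then F ! 4
     else if w = g then F ! 5 else 0)" for z w
  have ne: "distinct [a, b, c, d, e, f, g]" using h by (simp add: link_hexagon_def)
  then have "distinct [g, f, e, d, c, b, a]" by auto
  note nes = ne[simplified] this[simplified]
  have tris: "{a, b, c} \<in> K" "{a, c, d} \<in> K" "{a, d, e} \<in> K" "{a, e, f} \<in> K" "{a, f, g} \<in> K" "{a, g, b} \<in> K"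
    using h unfolding link_hexagon_def tri_def by blast+
  have \<phi>a: "\<phi> z a = 1 - sum_list (fan (z$1) (z$2))" for z by (simp add: \<phi>_def Let_def)
  have \<phi>o: "\<phi> z b = max 0 (min (z$1) (z$1 - z$2))" "\<phi> z c = max 0 (min (z$1) (z$2))"
     "\<phi> z d = max 0 (min (z$2) (z$2 - z$1))" "\<phi> z e = max 0 (min (- z$1) (z$2 - z$1))"
     "\<phi> z f = max 0 (min (- z$1) (- z$2))" "\<phi> z g = max 0 (min (- z$2) (z$1 - z$2))" for z
    by (simp_all add: \<phi>_def Let_def fan_def nes)
  have \<phi>a': "\<phi> z a = 1 - (\<phi> z b + \<phi> z c + \<phi> z d + \<phi> z e + \<phi> z f + \<phi> z g)" for z
    unfolding \<phi>a \<phi>o by (simp add: fan_def)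
  have \<phi>0: "\<phi> z w = 0" if "w \<notin> {a, b, c, d, e, f, g}" for z w
    using that by (simp add: \<phi>_def)
  have max0: "max 0 (min p q) = 0" if "p \<le> 0 \<or> q \<le> 0" for p q :: real
    using that by auto
  have \<psi>: "\<psi> t $ 1 = t b + t c - t e - t f" "\<psi> t $ 2 = t c + t d - t f - t g" for t
    by (simp_all add: \<psi>_def)
  have sectors: "(x \<ge> y \<and> y \<ge> 0) \<or> (y \<ge> x \<and> x \<ge> 0) \<or> (x \<le> 0 \<and> y \<ge> 0) \<or>
     (x \<le> y \<and> y \<le> 0) \<or> (y \<le> x \<and> x \<le> 0) \<or> (x \<ge> 0 \<and> y \<le> 0)" for x y :: real
    by linarith
  have \<psi>\<phi>: "\<psi> (\<phi> z) = z" for z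
  proof -
    have "\<psi> (\<phi> z) $ 1 = z $ 1" "\<psi> (\<phi> z) $ 2 = z $ 2"
      unfolding \<psi> \<phi>o by linarith+
    then show ?thesis by (simp add: vec_eq_iff forall_2)
  qed
  have \<phi>nn: "0 \<le> \<phi> z w" if "w \<noteq> a" for z w
    using that by (simp add: \<phi>_def Let_def fan_def)
  have \<phi>V: "\<phi> z \<in> ?U" if z: "z \<in> ?V" for z
  proof -
    have a: "0 < \<phi> z a" using z by (simp add: \<phi>a)
    then have nn: "0 \<le> \<phi> z w" for w using \<phi>nn[of w z] by (cases "w = a") auto
    have "\<exists>p q. {a, p, q} \<in> K \<and> {w. \<phi> z w \<noteq> 0} \<subseteq> {a, p, q}"
    proof -
      have sup: "{w. \<phi> z w \<noteq> 0} \<subseteq> {a, p, q}"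
        if "\<forall>w\<in>{b, c, d, e, f, g} - {p, q}. \<phi> z w = 0" for p q
        using that \<phi>0 by blast
      consider "z$1 \<ge> z$2" "z$2 \<ge> 0"
        | "z$2 \<ge> z$1" "z$1 \<ge> 0"
        | "z$1 \<le> 0" "z$2 \<ge> 0"
        | "z$1 \<le> z$2" "z$2 \<le> 0"
        | "z$2 \<le> z$1" "z$1 \<le> 0"
        | "z$1 \<ge> 0" "z$2 \<le> 0"
        using sectors[of "z$1" "z$2"] by blast
      then show ?thesis
      proof cases
        case 1
        then have "{w. \<phi> z w \<noteq> 0} \<subseteq> {a, b, c}" by (intro sup) (auto simp: \<phi>o intro!: max0)
        then show ?thesis using tris by blast
      next
        case 2
        then have "{w. \<phi> z w \<noteq> 0} \<subseteq> {a, c, d}" by (intro sup) (auto simp: \<phi>o intro!: max0)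
        then show ?thesis using tris by blast
      next
        case 3
        then have "{w. \<phi> z w \<noteq> 0} \<subseteq> {a, d, e}" by (intro sup) (auto simp: \<phi>o intro!: max0)
        then show ?thesis using tris by blast
      next
        case 4
        then have "{w. \<phi> z w \<noteq> 0} \<subseteq> {a, e, f}" by (intro sup) (auto simp: \<phi>o intro!: max0)
        then show ?thesis using tris by blast
      next
        case 5
        then have "{w. \<phi> z w \<noteq> 0} \<subseteq> {a, f, g}" by (intro sup) (auto simp: \<phi>o intro!: max0)
        then show ?thesis using tris by blast
      next
        case 6
        then have "{w. \<phi> z w \<noteq> 0} \<subseteq> {a, g, b}" by (intro sup) (auto simp: \<phi>o intro!: max0)
        then show ?thesis using tris by blast
      qed
    qed
    then obtain p q where pq: "{a, p, q} \<in> K" "{w. \<phi> z w \<noteq> 0} \<subseteq> {a, p, q}" by blast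
    have "{w. \<phi> z w \<noteq> 0} \<in> K"
      using simplex_subset[OF fc pq] a by force
    moreover have "(\<Sum>w\<in>{a, b, c, d, e, f, g}. \<phi> z w) = 1"
      using ne by (simp add: \<phi>o \<phi>a fan_def)
    ultimately have "\<phi> z \<in> ?S"
      by (intro carrier_pointsI[OF nn refl, where A = "{a, b, c, d, e, f, g}"]) (use \<phi>0 in auto)
    then show ?thesis using a by simp
  qed
  have \<phi>\<psi>: "\<phi> (\<psi> t) = t" if t: "t \<in> ?U" for t
  proof -
    have tS: "t \<in> ?S" and ta: "0 < t a" using t by auto
    note nn = carrier_supp(1)[OF tS]
    obtain x y z where xyz: "{v. t v \<noteq> 0} \<subseteq> {x, y, z}" "tri K x y z"
      using hexagonalD(2)[OF K carrier_supp(2)[OF tS]] by blast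
    have "a \<in> {v. t v \<noteq> 0}" using ta by simp
    then have "a \<in> {x, y, z}" using xyz(1) by blast
    from triangle_rotate_to_vertex[OF xyz(2) this] obtain p q where "{x, y, z} = {a, p, q}" "tri K a p q" by blast
    with xyz have pq: "{v. t v \<noteq> 0} \<subseteq> {a, p, q}" "tri K a p q" by simp_all
    then have "{p, q} \<in> {{b, c}, {c, d}, {d, e}, {e, f}, {f, g}, {g, b}}"
      using h by (simp add: link_hexagon_def)
    then have sup: "\<exists>\<tau>\<in>{{b, c}, {c, d}, {d, e}, {e, f}, {f, g}, {g, b}}. \<forall>w. w \<notin> insert a \<tau> \<longrightarrow> t w = 0"
      using pq(1) by (intro bexI[of _ "{p, q}"]) auto
    have zero: "t w = 0" if "w \<notin> {a, b, c, d, e, f, g}" for w using sup that by auto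
    have "sum t {a, b, c, d, e, f, g} = 1"
      by (rule carrier_supp(3)[OF tS]) (use zero in auto)
    then have sum: "t a = 1 - (t b + t c + t d + t e + t f + t g)" using ne by simp
    have main: "\<phi> (\<psi> t) w = t w" if "w \<in> {b, c, d, e, f, g}" for w
      using sup
    proof (elim bexE insertE emptyE)
      fix \<tau> assume "\<forall>w. w \<notin> insert a \<tau> \<longrightarrow> t w = 0" "\<tau> = {b, c}"
      then have "t d = 0" "t e = 0" "t f = 0" "t g = 0" using ne by auto
      then show ?thesis using that nn[of b] nn[of c] by (auto simp: \<phi>o \<psi> max_def min_def)
    next
      fix \<tau> assume "\<forall>w. w \<notin> insert a \<tau> \<longrightarrow> t w = 0" "\<tau> = {c, d}"
      then have "t b = 0" "t e = 0" "t f = 0" "t g = 0" using ne by auto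
      then show ?thesis using that nn[of d] nn[of c] by (auto simp: \<phi>o \<psi> max_def min_def)
    next
      fix \<tau> assume "\<forall>w. w \<notin> insert a \<tau> \<longrightarrow> t w = 0" "\<tau> = {d, e}"
      then have "t b = 0" "t c = 0" "t f = 0" "t g = 0" using ne by auto
      then show ?thesis using that nn[of d] nn[of e] by (auto simp: \<phi>o \<psi> max_def min_def)
    next
      fix \<tau> assume "\<forall>w. w \<notin> insert a \<tau> \<longrightarrow> t w = 0" "\<tau> = {e, f}"
      then have "t b = 0" "t c = 0" "t d = 0" "t g = 0" using ne by auto
      then show ?thesis using that nn[of f] nn[of e] by (auto simp: \<phi>o \<psi> max_def min_def)
    next
      fix \<tau> assume "\<forall>w. w \<notin> insert a \<tau> \<longrightarrow> t w = 0" "\<tau> = {f, g}"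
      then have "t b = 0" "t c = 0" "t d = 0" "t e = 0" using ne by auto
      then show ?thesis using that nn[of f] nn[of g] by (auto simp: \<phi>o \<psi> max_def min_def)
    next
      fix \<tau> assume "\<forall>w. w \<notin> insert a \<tau> \<longrightarrow> t w = 0" "\<tau> = {g, b}"
      then have "t c = 0" "t d = 0" "t e = 0" "t f = 0" using ne by auto
      then show ?thesis using that nn[of b] nn[of g] by (auto simp: \<phi>o \<psi> max_def min_def)
    qed
    have "\<phi> (\<psi> t) a = t a"
      using main[of b] main[of c] main[of d] main[of e] main[of f] main[of g]
      unfolding \<phi>a' sum by simp
    moreover have "\<phi> (\<psi> t) w = t w" if "w \<notin> {a, b, c, d, e, f, g}" for w
      using zero[OF that] \<phi>0[OF that] by simp
    ultimately have "\<phi> (\<psi> t) w = t w" for w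
      using main[of w] by (cases "w = a"; cases "w \<in> {b, c, d, e, f, g}") auto
    then show ?thesis by (rule ext)
  qed
  have "\<psi> t \<in> ?V" if t: "t \<in> ?U" for t
    using \<phi>\<psi>[OF t] \<phi>a[of "\<psi> t"] t by simp
  moreover have "continuous_on ?U \<psi>"
    unfolding \<psi>_def
  proof (rule continuous_on_vec_lambda)
    show "continuous_on ?U (\<lambda>t. if i = 1 then t b + t c - t e - t f else t c + t d - t f - t g)" for i :: 2
      by (cases "i = 1") (auto intro!: continuous_intros continuous_on_coordinate)
  qed
  moreover have "continuous_on ?V (\<lambda>z. \<phi> z w)" for w
  proof -
    consider "w = a" | "w = b" | "w = c" | "w = d" | "w = e" | "w = f" | "w = g" | "w \<notin> {a, b, c, d, e, f, g}"
      by blast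
    then show ?thesis
      by cases (auto simp: \<phi>a \<phi>o \<phi>0 fan_def intro!: continuous_intros)
  qed
  then have "continuous_on ?V \<phi>" by (rule continuous_on_coordinatewise_then_product)
  ultimately have "homeomorphic_maps (top_of_set ?U) (top_of_set ?V) \<psi> \<phi>"
    using \<psi>\<phi> \<phi>\<psi> \<phi>V by (auto simp: homeomorphic_maps_def)
  then show ?thesis unfolding homeomorphic_space_def by blast
qed

text \<open>Every point of the carrier gives positive weight to some vertex, hence lies in an open star.\<close>

theorem hexagonal_closed_surface:
  assumes K: "hexagonal K"
  shows "closed_surface (geometric_carrier K)"
proof -
  let ?S = "carrier_points K"
  note fc = hexagonalD(1)[OF K]
  have "compact_space (top_of_set ?S)"
    using compact_carrier_points[OF fc] by (simp add: compact_space_subtopology)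
  moreover have "Hausdorff_space (geometric_carrier K)"
    unfolding geometric_carrier_def
    by (intro Hausdorff_space_subtopology) (simp add: Hausdorff_space_product_topology)
  moreover have "\<exists>U V. openin (top_of_set ?S) U \<and> t \<in> U \<and> open (V :: (real^2) set) \<and>
        subtopology (top_of_set ?S) U homeomorphic_space top_of_set V" if t: "t \<in> ?S" for t
  proof -
    have "{v. t v \<noteq> 0} \<noteq> {}" using simplex_nonempty[OF fc carrier_supp(2)[OF t]] .
    then obtain a where a: "t a \<noteq> 0" by blast
    then have ta: "0 < t a" using carrier_supp(1)[OF t, of a] by simp
    have "a \<in> vertices K" using a carrier_supp(2)[OF t] unfolding vertices_def by blast
    then obtain b c d e f g where h: "link_hexagon K a b c d e f g"
      by (elim hexagonalD(3)[OF K, THEN exE] exE) (rule that)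
    let ?U = "{t \<in> ?S. 0 < t a}" and ?V = "{z :: real^2. sum_list (fan (z$1) (z$2)) < 1}"
    have "?U = ?S \<inter> {t. 0 < t a}" by blast
    then have "openin (top_of_set ?S) ?U"
      by (simp add: openin_open_Int open_positive_coordinate)
    moreover have "open ?V"
      unfolding fan_def by (intro open_Collect_less) (auto intro!: continuous_intros)
    moreover have "subtopology (top_of_set ?S) ?U homeomorphic_space top_of_set ?V"
      using hexagon_chart[OF K h] by (simp add: subtopology_subtopology Int_absorb1)
    ultimately show ?thesis using t ta by (intro exI[of _ ?U] exI[of _ ?V]) simp
  qed
  ultimately show ?thesis by (simp add: closed_surface_def geometric_carrier_eq)
qed

lemma link_neighbours:
  assumes "link_hexagon K a b c d e f g"
  shows "(\<exists>x. tri K a w x) \<longleftrightarrow> w \<in> {b, c, d, e, f, g}"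
proof -
  have "(\<exists>x. tri K a w x) \<longleftrightarrow> (\<exists>x. {w, x} \<in> {{b, c}, {c, d}, {d, e}, {e, f}, {f, g}, {g, b}})"
    using assms by (simp add: link_hexagon_def)
  also have "\<dots> \<longleftrightarrow> w \<in> {b, c, d, e, f, g}" by (simp add: doubleton_eq_iff) blast
  finally show ?thesis .
qed

lemma hexagonal_neighbours:
  assumes K: "hexagonal K" and h: "link_hexagon K v b c d e f g"
  shows "{v, w} \<in> K \<and> w \<noteq> v \<longleftrightarrow> w \<in> {b, c, d, e, f, g}"
  unfolding link_neighbours[OF h, symmetric]
proof
  assume w: "{v, w} \<in> K \<and> w \<noteq> v"
  then obtain x y z where "{v, w} \<subseteq> {x, y, z}" "tri K x y z" using hexagonalD(2)[OF K] by blast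
  then show "\<exists>x. tri K v w x" using w tri_commute[of K] by (metis insertE insert_subset singletonD)
next
  assume "\<exists>x. tri K v w x"
  then obtain x where "tri K v w x" by blast
  then show "{v, w} \<in> K \<and> w \<noteq> v"
    using simplex_subset[OF hexagonalD(1)[OF K], of "{v, w, x}" "{v, w}"] by (auto simp: tri_def)
qed

lemma two_dimensional_hexagonal:
  assumes K: "hexagonal K" and ne: "K \<noteq> {}"
  shows "two_dimensional K"
proof -
  have "card \<sigma> \<le> 3" if "\<sigma> \<in> K" for \<sigma>
  proof -
    obtain a b c where "\<sigma> \<subseteq> {a, b, c}" using hexagonalD(2)[OF K \<open>\<sigma> \<in> K\<close>] by blast
    then have "card \<sigma> \<le> card {a, b, c}" by (intro card_mono) auto
    also have "\<dots> \<le> 3" by (simp add: card_insert_if)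
    finally show ?thesis .
  qed
  moreover obtain a b c where "tri K a b c" using ne hexagonalD(2)[OF K] by blast
  then have "{a, b, c} \<in> faces 2 K" by (auto simp: tri_def faces_def)
  ultimately show ?thesis unfolding two_dimensional_def by blast
qed

text \<open>Each point is joined by a segment to each vertex of its supporting simplex, and adjacent
  vertices are joined through the midpoint of their edge.\<close>

lemma connected_carrier:
  assumes K: "finite_complex K" and step: "edge_connected K"
  shows "connected_space (geometric_carrier K)"
proof -
  let ?S = "carrier_points K"
  define pt :: "'a \<Rightarrow> 'a \<Rightarrow> real" where "pt v w = (if w = v then 1 else 0)" for v w
  have pt: "pt v \<in> ?S" if "v \<in> vertices K" for v
    by (rule carrier_pointsI[where \<sigma> = "{v}" and A = "{v}"])
      (use singleton_simplex[OF K that] in \<open>auto simp: pt_def\<close>)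
  have near: "connected_component ?S (pt v) t" if t: "t \<in> ?S" and v: "t v \<noteq> 0" for t v
  proof -
    define \<gamma> where "\<gamma> s w = (1 - s) * pt v w + s * t w" for s :: real and w
    note t' = carrier_supp[OF t]
    have "\<gamma> s \<in> ?S" if s: "s \<in> {0..1}" for s
    proof -
      have nn: "0 \<le> \<gamma> s w" for w using s t'(1) by (auto simp: \<gamma>_def pt_def)
      have fin: "finite {w. t w \<noteq> 0}" using finite_simplex[OF K t'(2)] .
      have sub: "{w. \<gamma> s w \<noteq> 0} \<subseteq> {w. t w \<noteq> 0}" using v by (auto simp: \<gamma>_def pt_def)
      have "sum (pt v) {w. t w \<noteq> 0} = 1" using fin v by (simp add: pt_def)
      moreover have "sum t {w. t w \<noteq> 0} = 1" using t'(3)[OF order_refl fin] .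
      ultimately have s1: "sum (\<gamma> s) {w. t w \<noteq> 0} = 1"
        by (simp add: \<gamma>_def sum.distrib sum_distrib_left[symmetric])
      then have "{w. \<gamma> s w \<noteq> 0} \<noteq> {}"
        by (metis (mono_tags, lifting) Collect_empty_eq sum.neutral zero_neq_one)
      then have "{w. \<gamma> s w \<noteq> 0} \<in> K" using simplex_subset[OF K t'(2) sub] by blast
      then show ?thesis using carrier_pointsI[OF nn refl _ s1 fin sub] by blast
    qed
    moreover have "connected (\<gamma> ` {0..1})"
      by (intro connected_continuous_image) (auto simp: \<gamma>_def intro!: continuous_intros)
    moreover have "\<gamma> 0 = pt v" "\<gamma> 1 = t" by (auto simp: \<gamma>_def)
    then have "pt v \<in> \<gamma> ` {0..1}" "t \<in> \<gamma> ` {0..1}" by (metis atLeastAtMost_iff imageI order_refl zero_le_one)+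
    ultimately show ?thesis unfolding connected_component_def by blast
  qed
  have adj: "connected_component ?S (pt u) (pt v)" if uv: "{u, v} \<in> K" for u v
  proof (cases "u = v")
    case True
    then have "u \<in> vertices K" using uv by (auto simp: vertices_def)
    then show ?thesis using pt True by simp
  next
    case False
    define m where "m w = (if w = u \<or> w = v then 1/2 else 0 :: real)" for w
    have "m \<in> ?S"
      by (rule carrier_pointsI[where \<sigma> = "{u, v}" and A = "{u, v}"]) (use uv False in \<open>auto simp: m_def\<close>)
    then have "connected_component ?S (pt u) m" "connected_component ?S (pt v) m"
      by (auto intro!: near simp: m_def)
    then show ?thesis using connected_component_sym connected_component_trans by metis
  qed
  have "connected_component ?S s t" if st: "s \<in> ?S" "t \<in> ?S" for s t
  proof -
    have "\<exists>v. r v \<noteq> 0" if "r \<in> ?S" for r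
      using simplex_nonempty[OF K carrier_supp(2)[OF that]] by blast
    then obtain u v where uv: "s u \<noteq> 0" "t v \<noteq> 0" using st by metis
    have V: "u \<in> vertices K" "v \<in> vertices K"
      using uv carrier_supp(2)[OF st(1)] carrier_supp(2)[OF st(2)] unfolding vertices_def by blast+
    let ?A = "{w \<in> vertices K. connected_component ?S (pt u) (pt w)}"
    have "?A = vertices K"
    proof (rule step[unfolded edge_connected_def, rule_format])
      show "?A \<noteq> {}" using V(1) pt[OF V(1)] by auto
      show "y \<in> ?A" if "x \<in> ?A" "{x, y} \<in> K" for x y
        using that adj[OF that(2)] connected_component_trans by (auto simp: vertices_def)
    qed blast
    then have "connected_component ?S (pt u) (pt v)" using V by blast
    then show ?thesis using near[OF st(1) uv(1)] near[OF st(2) uv(2)]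
      by (meson connected_component_sym connected_component_trans)
  qed
  then have "connected ?S" by (simp add: connected_iff_connected_component)
  then show ?thesis
    using connectedin_iff_connected[of ?S] by (simp add: geometric_carrier_eq connectedin_def)
qed

theorem hexagonal_dr_manifold:
  assumes K: "hexagonal K" and n: "card (vertices K) = n" "n > 0"
    and step: "edge_connected K"
  shows "dr_manifold_chi0 n K"
proof -
  note fc = hexagonalD(1)[OF K]
  have ne: "K \<noteq> {}" using n by (auto simp: vertices_def)
  have deg: "vertex_degree K v = 6" if v: "v \<in> vertices K" for v
  proof -
    obtain b c d e f g where h: "link_hexagon K v b c d e f g"
      using v by (elim hexagonalD(3)[OF K, THEN exE] exE) (rule that)
    have "{w. {v, w} \<in> K \<and> w \<noteq> v} = {b, c, d, e, f, g}"
      unfolding hexagonal_neighbours[OF K h] by blast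
    then show ?thesis using h by (simp add: vertex_degree_neighbours link_hexagon_def)
  qed
  have two: "card {c. tri K u v c} = 2" if uv: "{u, v} \<in> K" "u \<noteq> v" for u v
  proof -
    obtain x y z where "{u, v} \<subseteq> {x, y, z}" "tri K x y z" using hexagonalD(2)[OF K uv(1)] by blast
    then obtain w where "tri K u v w" using uv(2) tri_commute[of K] by (metis insertE insert_subset singletonD)
    then obtain d e f g where "link_hexagon K u v w d e f g" using hexagonal_flag[OF K] by blast
    then have "{c. tri K u v c} = {w, g}" "w \<noteq> g"
      by (auto simp: link_hexagon_def doubleton_eq_iff)
    then show ?thesis by simp
  qed
  have "6 * euler_char K = 0" using euler_char_regular[OF fc two deg] by simp
  then have "euler_char K = 0" by simp
  moreover have "combinatorial_2_manifold K"
    unfolding combinatorial_2_manifold_def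
    using fc two_dimensional_hexagonal[OF K ne] hexagonal_closed_surface[OF K] by (intro conjI)
  moreover have "degree_regular K"
    unfolding degree_regular_def using connected_carrier[OF fc step] deg by (intro conjI exI[of _ 6] ballI)
  ultimately show ?thesis using n(1) unfolding dr_manifold_chi0_def by (intro conjI)
qed

section \<open>Finite orbits of the integer lattice\<close>

locale Z2_action =
  fixes act :: "int \<Rightarrow> int \<Rightarrow> 'x \<Rightarrow> 'x"
  assumes act_zero: "act 0 0 f = f"
    and act_add: "act i j (act k l f) = act (i + k) (j + l) f"
begin

definition orb :: "'x \<Rightarrow> 'x set" where
  "orb f = {act i j f | i j. True}"

lemma act_in_orb: "act i j f \<in> orb f"
  by (auto simp: orb_def)

lemma act_eq_iff: "act i j f = act k l f \<longleftrightarrow> act (i - k) (j - l) f = f"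
proof
  assume "act i j f = act k l f"
  then have "act (- k) (- l) (act i j f) = act (- k) (- l) (act k l f)" by simp
  then show "act (i - k) (j - l) f = f" by (simp add: act_add act_zero)
next
  assume "act (i - k) (j - l) f = f"
  then have "act k l (act (i - k) (j - l) f) = act k l f" by simp
  then show "act i j f = act k l f" by (simp add: act_add)
qed

lemma orb_act: "orb (act k l f) = orb f"
proof -
  have "act i j f \<in> orb (act k l f)" for i j
    using act_in_orb[of "i - k" "j - l" "act k l f"] by (simp add: act_add)
  then show ?thesis by (auto simp: orb_def act_add)
qed

lemma act_scale_fixed:
  assumes "act i j f = f"
  shows "act (m * i) (m * j) f = f"
proof (induction m rule: int_induct[of _ 0])
  case (step1 m)
  then show ?case using assms act_add[of i j "m * i" "m * j" f] by (simp add: algebra_simps)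
next
  case (step2 m)
  have "act (- i) (- j) f = act (- i) (- j) (act i j f)" using assms by simp
  then have "act (- i) (- j) f = f" by (simp add: act_add act_zero)
  then show ?case using step2 act_add[of "- i" "- j" "m * i" "m * j" f] by (simp add: algebra_simps)
qed (simp add: act_zero)

lemma act_sum_fixed: "act i j f = f \<Longrightarrow> act k l f = f \<Longrightarrow> act (i + k) (j + l) f = f"
  by (simp flip: act_add)

text \<open>Lagrange's theorem for the subgroup \<open>D\<close>: since the group is abelian and transitive on the orbit,
  translation carries any \<open>D\<close>-orbit inside it bijectively to any other, so all of them have the same
  size.\<close>

lemma suborbit_card_dvd:
  assumes fin: "finite (orb f)" and D0: "(0, 0) \<in> D"
    and D_add: "\<And>i j k l. (i, j) \<in> D \<Longrightarrow> (k, l) \<in> D \<Longrightarrow> (i + k, j + l) \<in> D"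
    and D_minus: "\<And>i j. (i, j) \<in> D \<Longrightarrow> (- i, - j) \<in> D"
  shows "card ((\<lambda>(i, j). act i j f) ` D) dvd card (orb f)"
proof -
  define r where "r = {(x, y). x \<in> orb f \<and> (\<exists>(i, j)\<in>D. y = act i j x)}"
  have orb_closed: "act i j x \<in> orb f" if x: "x \<in> orb f" for x i j
  proof -
    obtain k l where "x = act k l f" using x by (auto simp: orb_def)
    then show ?thesis using act_in_orb[of "i + k" "j + l" f] by (simp add: act_add)
  qed
  have "equiv (orb f) r"
  proof (rule equivI)
    show "r \<subseteq> orb f \<times> orb f" using orb_closed by (auto simp: r_def)
    show "refl_on (orb f) r"
      unfolding refl_on_def r_def using D0 by (auto simp: act_zero intro!: bexI[of _ "(0, 0)"])
    show "sym r"
    proof (rule symI)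
      fix x y assume "(x, y) \<in> r"
      then obtain i j where ij: "x \<in> orb f" "(i, j) \<in> D" "y = act i j x" by (auto simp: r_def)
      then have "x = act (- i) (- j) y" by (simp add: act_add act_zero)
      then show "(y, x) \<in> r" using ij D_minus[OF ij(2)] orb_closed by (auto simp: r_def)
    qed
    show "trans r"
    proof (rule transI)
      fix x y z assume "(x, y) \<in> r" "(y, z) \<in> r"
      then obtain i j k l where "x \<in> orb f" "(i, j) \<in> D" "y = act i j x" "(k, l) \<in> D" "z = act k l y"
        by (auto simp: r_def)
      then show "(x, z) \<in> r" using D_add[of k l i j] by (auto simp: r_def act_add)
    qed
  qed
  moreover have "card ((\<lambda>(i, j). act i j f) ` D) dvd card C" if C: "C \<in> orb f // r" for C
  proof -
    obtain x where x: "x \<in> orb f" "C = r `` {x}" using C by (auto elim: quotientE)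
    obtain k l where kl: "x = act k l f" using x(1) by (auto simp: orb_def)
    have "C = act k l ` ((\<lambda>(i, j). act i j f) ` D)"
    proof -
      have "C = (\<lambda>(i, j). act i j x) ` D"
        unfolding x(2) r_def using x(1) by (auto simp: image_iff)
      then show ?thesis by (simp add: kl image_image split_beta act_add add.commute)
    qed
    moreover have "inj (act k l)"
    proof (rule injI)
      fix y z assume "act k l y = act k l z"
      then have "act (- k) (- l) (act k l y) = act (- k) (- l) (act k l z)" by simp
      then show "y = z" by (simp add: act_add act_zero)
    qed
    ultimately show ?thesis by (simp add: card_image inj_on_subset)
  qed
  ultimately show ?thesis using equiv_imp_dvd_card[OF fin] by blast
qed

text \<open>The \<open>r\<close> in question is the order of the vector in the finite abelian group by which the lattice
  acts on the orbit.\<close>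

lemma cyclic_suborbit:
  assumes fin: "finite (orb f)"
  obtains r where "r dvd card (orb f)" "card ((\<lambda>m. act (m * x0) (m * x1) f) ` UNIV) = r"
    "\<And>m. act (m * x0) (m * x1) f = f \<longleftrightarrow> int r dvd m"
proof -
  define h where "h m = act (m * x0) (m * x1) f" for m
  have h_add: "act (m * x0) (m * x1) (h l) = h (m + l)" for m l
    by (simp add: h_def act_add distrib_right)
  have h_eq: "h m = h l \<longleftrightarrow> h (m - l) = f" for m l
    unfolding h_def by (simp add: act_eq_iff[of "m * x0"] left_diff_distrib)
  have "finite (range h)" by (rule finite_subset[OF _ fin]) (auto simp: h_def act_in_orb)
  then have "\<not> inj (\<lambda>m::nat. h (int m))"
    by (metis finite_subset finite_imageD infinite_UNIV_nat image_subsetI rangeI)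
  then obtain a b :: nat where ab: "a < b" "h (int a) = h (int b)"
    unfolding inj_def by (metis nat_neq_iff)
  then have "h (int (b - a)) = f" using h_eq[of "int b" "int a"] by (simp add: of_nat_diff)
  then have ex: "\<exists>r>0. h (int r) = f" using ab(1) by (intro exI[of _ "b - a"]) auto
  define r where "r = (LEAST r. r > 0 \<and> h (int r) = f)"
  have r: "r > 0" "h (int r) = f" using LeastI_ex[OF ex] by (auto simp: r_def)
  have h_mult: "h (int r * q) = f" for q
    using act_scale_fixed[of "int r * x0" "int r * x1" f q] r(2) by (simp add: h_def algebra_simps)
  have h_mod: "h m = h (m mod int r)" for m
  proof -
    have "h (m - m mod int r) = f" using h_mult[of "m div int r"] by (simp add: minus_mod_eq_mult_div)
    then show ?thesis by (simp add: h_eq)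
  qed
  have h_iff: "h m = f \<longleftrightarrow> int r dvd m" for m
  proof
    assume "h m = f"
    define s where "s = nat (m mod int r)"
    have "h (int s) = f" using \<open>h m = f\<close> h_mod[of m] r(1) by (simp add: s_def)
    moreover have "s < r" using r(1) by (simp add: nat_less_iff s_def)
    ultimately have "\<not> s > 0"
      using not_less_Least[of s "\<lambda>r. r > 0 \<and> h (int r) = f"] by (simp add: r_def)
    then have "\<not> nat (m mod int r) > 0" by (simp add: s_def)
    then have "m mod int r = 0" using r(1) pos_mod_sign[of "int r" m] by linarith
    then show "int r dvd m" by auto
  qed (auto simp: h_mult)
  have "range h = h ` {0..<int r}"
  proof
    show "range h \<subseteq> h ` {0..<int r}"
    proof clarify
      fix m show "h m \<in> h ` {0..<int r}"
        using h_mod[of m] r(1) by (intro image_eqI[of _ _ "m mod int r"]) auto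
    qed
  qed auto
  moreover have "inj_on h {0..<int r}"
  proof (rule inj_onI)
    fix m l assume "m \<in> {0..<int r}" "l \<in> {0..<int r}" "h m = h l"
    then have "int r dvd m - l" "\<bar>m - l\<bar> < int r" using h_eq h_iff by auto
    then show "m = l" using dvd_imp_le_int[of "m - l" "int r"] by auto
  qed
  ultimately have card: "card (range h) = r" by (simp add: card_image)
  have "card ((\<lambda>(i, j). act i j f) ` (range (\<lambda>m. (m * x0, m * x1)))) dvd card (orb f)"
  proof (rule suborbit_card_dvd[OF fin])
    show "(0, 0) \<in> range (\<lambda>m. (m * x0, m * x1))" by (auto intro: image_eqI[of _ _ 0])
    show "(i + k, j + l) \<in> range (\<lambda>m. (m * x0, m * x1))"
      if "(i, j) \<in> range (\<lambda>m. (m * x0, m * x1))" "(k, l) \<in> range (\<lambda>m. (m * x0, m * x1))" for i j k l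
      using that by (auto simp flip: distrib_right)
    show "(- i, - j) \<in> range (\<lambda>m. (m * x0, m * x1))" if "(i, j) \<in> range (\<lambda>m. (m * x0, m * x1))" for i j
      using that by (auto intro: image_eqI[of _ _ "- m" for m])
  qed
  also have "(\<lambda>(i, j). act i j f) ` (range (\<lambda>m. (m * x0, m * x1))) = range h"
    by (auto simp: h_def)
  finally have "r dvd card (orb f)" using card by simp
  then show ?thesis using that card h_iff unfolding h_def by blast
qed

text \<open>If \<open>w\<close> were not a multiple of \<open>u\<close>, then \<open>u\<close> and \<open>w\<close> would generate a group of order
  \<open>p\<^sup>2\<close>, whose order divides that of the orbit.\<close>

lemma p_torsion_cyclic:
  assumes fin: "finite (orb f)" and p: "prime p" and p2: "\<not> p ^ 2 dvd card (orb f)"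
    and pu: "act (int p * ua) (int p * ub) f = f" and pw: "act (int p * wa) (int p * wb) f = f"
    and u: "act ua ub f \<noteq> f"
  obtains k where "act (wa - k * ua) (wb - k * ub) f = f"
proof (rule ccontr)
  assume "\<not> thesis"
  then have no: "act (wa - k * ua) (wb - k * ub) f \<noteq> f" for k using that by blast
  have p0: "p > 0" using p prime_gt_0_nat by blast
  define h where "h i j = act (i * ua + j * wa) (i * ub + j * wb) f" for i j
  have h_eq: "h i j = h k l \<longleftrightarrow> h (i - k) (j - l) = f" for i j k l
    unfolding h_def by (subst act_eq_iff) (simp add: algebra_simps)
  have h_p: "h (int p * i) (int p * j) = f" for i j
    using act_sum_fixed[OF act_scale_fixed[OF pu, of i] act_scale_fixed[OF pw, of j]]
    by (simp add: h_def algebra_simps)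
  have h_sum: "h i j = f \<Longrightarrow> h k l = f \<Longrightarrow> h (i + k) (j + l) = f" for i j k l
    unfolding h_def using act_sum_fixed[of "i * ua + j * wa" "i * ub + j * wb" f "k * ua + l * wa" "k * ub + l * wb"]
    by (simp add: algebra_simps)
  have h_scale: "h i j = f \<Longrightarrow> h (m * i) (m * j) = f" for i j m
    unfolding h_def using act_scale_fixed[of "i * ua + j * wa" "i * ub + j * wb" f m]
    by (simp add: algebra_simps)
  have inv: "\<exists>c q. c * m = 1 + int p * q" if "\<not> int p dvd m" for m
  proof -
    have "coprime m (int p)" using that p prime_imp_coprime[of "int p" m] by (simp add: coprime_commute)
    then obtain c d where "c * m + d * int p = 1" using bezout_int[of m "int p"] by (metis coprime_iff_gcd_eq_1)
    then have "c * m = 1 + int p * (- d)" by (simp add: algebra_simps)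
    then show ?thesis by blast
  qed
  have h_iff: "int p dvd i \<and> int p dvd j" if hij: "h i j = f" for i j
  proof -
    have j: "int p dvd j"
    proof (rule ccontr)
      assume "\<not> int p dvd j"
      then obtain c q where c: "c * j = 1 + int p * q" using inv by blast
      have "h (c * i + int p * 0) (c * j + int p * (- q)) = f"
        by (rule h_sum[OF h_scale[OF hij] h_p])
      then have "h (c * i) 1 = f" by (simp add: c)
      then show False using no[of "- (c * i)"] by (simp add: h_def algebra_simps)
    qed
    moreover have "int p dvd i"
    proof (rule ccontr)
      assume "\<not> int p dvd i"
      then obtain c q where c: "c * i = 1 + int p * q" using inv by blast
      obtain j' where j': "j = int p * j'" using j by (auto simp: dvd_def)
      have "h (c * i + int p * (- q)) (c * j + int p * (- (c * j'))) = f"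
        by (rule h_sum[OF h_scale[OF hij] h_p])
      then have "h 1 0 = f" by (simp add: c j' algebra_simps)
      then show False using u by (simp add: h_def)
    qed
    ultimately show ?thesis by simp
  qed
  let ?Q = "{0..<int p} \<times> {0..<int p}"
  have h_mod: "h i j = h (i mod int p) (j mod int p)" for i j
    using h_p[of "i div int p" "j div int p"] by (simp add: h_eq minus_mod_eq_mult_div)
  have "inj_on (\<lambda>(i, j). h i j) ?Q"
  proof (rule inj_onI, clarify)
    fix i j k l assume *: "i \<in> {0..<int p}" "j \<in> {0..<int p}" "k \<in> {0..<int p}" "l \<in> {0..<int p}"
      and "h i j = h k l"
    then have "int p dvd i - k" "int p dvd j - l" using h_eq h_iff by blast+
    moreover have "\<bar>i - k\<bar> < int p" "\<bar>j - l\<bar> < int p" using * by auto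
    ultimately show "i = k \<and> j = l"
      using dvd_imp_le_int[of "i - k" "int p"] dvd_imp_le_int[of "j - l" "int p"] by auto
  qed
  then have "card ((\<lambda>(i, j). h i j) ` ?Q) = p ^ 2"
    by (simp add: card_image power2_eq_square)
  moreover have "range (\<lambda>(i, j). h i j) = (\<lambda>(i, j). h i j) ` ?Q"
  proof
    show "range (\<lambda>(i, j). h i j) \<subseteq> (\<lambda>(i, j). h i j) ` ?Q"
    proof clarify
      fix i j show "h i j \<in> (\<lambda>(i, j). h i j) ` ?Q"
        using h_mod[of i j] p0 by (intro image_eqI[of _ _ "(i mod int p, j mod int p)"]) auto
    qed
  qed auto
  moreover have "card ((\<lambda>(i, j). act i j f) ` range (\<lambda>(i, j). (i * ua + j * wa, i * ub + j * wb))) dvd card (orb f)"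
    (is "card (_ ` ?D) dvd _")
  proof (rule suborbit_card_dvd[OF fin])
    have mem: "(x, y) \<in> ?D \<longleftrightarrow> (\<exists>i j. x = i * ua + j * wa \<and> y = i * ub + j * wb)" for x y by auto
    show "(0, 0) \<in> ?D" unfolding mem by (intro exI[of _ 0]) simp
    show "(i + k, j + l) \<in> ?D" if ijkl: "(i, j) \<in> ?D" "(k, l) \<in> ?D" for i j k l
    proof -
      obtain a b c d where "i = a * ua + b * wa" "j = a * ub + b * wb" "k = c * ua + d * wa" "l = c * ub + d * wb"
        using ijkl unfolding mem by blast
      then show ?thesis unfolding mem by (intro exI[of _ "a + c"] exI[of _ "b + d"]) (simp add: algebra_simps)
    qed
    show "(- i, - j) \<in> ?D" if ij: "(i, j) \<in> ?D" for i j
    proof -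
      obtain a b where "i = a * ua + b * wa" "j = a * ub + b * wb" using ij unfolding mem by blast
      then show ?thesis unfolding mem by (intro exI[of _ "- a"] exI[of _ "- b"]) (simp add: algebra_simps)
    qed
  qed
  moreover have "(\<lambda>(i, j). act i j f) ` ?D = range (\<lambda>(i, j). h i j)"
    by (simp add: h_def image_image split_beta)
  ultimately show False using p2 by simp
qed

lemma order_dvd_card:
  assumes "finite (orb f)"
  shows "act (int (card (orb f)) * x0) (int (card (orb f)) * x1) f = f"
proof -
  obtain r where "r dvd card (orb f)" "\<And>m. act (m * x0) (m * x1) f = f \<longleftrightarrow> int r dvd m"
    using cyclic_suborbit[OF assms] by metis
  then show ?thesis by simp
qed

text \<open>In an abelian group \<open>G\<close> of order \<open>2 n\<close> with \<open>n\<close> an odd prime, let an automorphism exchange \<open>x\<close>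
  and \<open>y\<close>. The elements \<open>n x\<close> and \<open>n y\<close> lie in the 2-torsion, which has at most two elements,
  and they are exchanged, so they are equal. Therefore \<open>x - y\<close> and \<open>x + y\<close> both lie in the
  \<open>n\<close>-torsion, which is cyclic. There the automorphism is multiplication by a scalar; it
  negates \<open>x - y\<close> and fixes \<open>x + y\<close>, so one of the two is zero.\<close>

lemma swap_symmetric_orbit:
  assumes card: "card (orb f) = 2 * n" and n: "prime n" "odd n"
    and sym: "\<And>i j. act (i * x0 + j * y0) (i * x1 + j * y1) f = f \<Longrightarrow>
        act (j * x0 + i * y0) (j * x1 + i * y1) f = f"
  shows "act (x0 - y0) (x1 - y1) f = f \<or> act (x0 + y0) (x1 + y1) f = f"
proof (rule ccontr)
  assume neg: "\<not> ?thesis"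
  define h where "h i j \<longleftrightarrow> act (i * x0 + j * y0) (i * x1 + j * y1) f = f" for i j
  have fin: "finite (orb f)" using card n prime_gt_0_nat by (metis card_gt_0_iff nat_0_less_mult_iff zero_less_numeral)
  have h_sum: "h i j \<Longrightarrow> h k l \<Longrightarrow> h (i + k) (j + l)" for i j k l
    unfolding h_def using act_sum_fixed[of "i * x0 + j * y0" "i * x1 + j * y1" f "k * x0 + l * y0" "k * x1 + l * y1"]
    by (simp add: algebra_simps)
  have h_scale: "h i j \<Longrightarrow> h (m * i) (m * j)" for i j m
    unfolding h_def using act_scale_fixed[of "i * x0 + j * y0" "i * x1 + j * y1" f m]
    by (simp add: algebra_simps)
  have h_sym: "h i j \<Longrightarrow> h j i" for i j using sym by (simp add: h_def)
  have neg': "\<not> h 1 (- 1)" "\<not> h 1 1" using neg by (simp_all add: h_def)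
  let ?n = "int n"
  have ord: "h (2 * ?n) 0"
    unfolding h_def using order_dvd_card[OF fin, of x0 x1] card by simp
  have n2: "n \<noteq> 2" using n by auto
  then have dvd2: "\<not> 2 ^ 2 dvd card (orb f)" and dvdn: "\<not> n ^ 2 dvd card (orb f)"
    using n card by (auto simp: power2_eq_square primes_dvd_imp_eq)
  have nn: "h ?n ?n \<and> h ?n (- ?n)"
  proof (cases "h ?n 0")
    case True
    then show ?thesis using h_sum[OF True h_sym[OF True]]
      h_sum[OF True h_scale[OF h_sym[OF True], of "-1"]] by simp
  next
    case False
    have two: "h 0 (2 * ?n)" using ord h_sym by simp
    obtain k where "act (?n * y0 - k * (?n * x0)) (?n * y1 - k * (?n * x1)) f = f"
    proof (rule p_torsion_cyclic[OF fin _ dvd2, where ua = "?n * x0" and ub = "?n * x1" and wa = "?n * y0" and wb = "?n * y1"])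
      show "act (int 2 * (?n * x0)) (int 2 * (?n * x1)) f = f" using ord by (simp add: h_def algebra_simps)
      show "act (int 2 * (?n * y0)) (int 2 * (?n * y1)) f = f" using two by (simp add: h_def algebra_simps)
      show "act (?n * x0) (?n * x1) f \<noteq> f" using False by (simp add: h_def)
    qed auto
    then have k: "h (- (k * ?n)) ?n" by (simp add: h_def algebra_simps)
    show ?thesis
    proof (cases "even k")
      case True
      then obtain l where "k = 2 * l" by blast
      then have "h 0 ?n" using h_sum[OF k h_scale[OF ord, of l]] by (simp add: algebra_simps)
      then show ?thesis using False h_sym by blast
    next
      case odd: False
      then obtain l where l: "k = 2 * l + 1" by (elim oddE)
      then have 1: "h (- ?n) ?n" using h_sum[OF k h_scale[OF ord, of l]] by (simp add: algebra_simps)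
      then have "h ?n ?n" using h_sum[OF 1 ord] by simp
      then show ?thesis using h_sym[OF 1] by simp
    qed
  qed
  obtain k where "act (x0 + y0 - k * (x0 - y0)) (x1 + y1 - k * (x1 - y1)) f = f"
  proof (rule p_torsion_cyclic[OF fin n(1) dvdn, where ua = "x0 - y0" and ub = "x1 - y1" and wa = "x0 + y0" and wb = "x1 + y1"])
    show "act (?n * (x0 - y0)) (?n * (x1 - y1)) f = f" "act (?n * (x0 + y0)) (?n * (x1 + y1)) f = f"
      using nn by (simp_all add: h_def algebra_simps)
  qed (use neg in auto)
  then have k: "h (1 - k) (1 + k)" by (simp add: h_def algebra_simps)
  \<comment> \<open>adding the relation and its mirror image gives \<open>2 (x + y) = 0\<close>, while \<open>n\<close> is odd\<close>
  have "h 2 2" using h_sum[OF k h_sym[OF k]] by simp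
  moreover obtain l where "n = 2 * l + 1" using n(2) by (elim oddE)
  ultimately have "h 1 1" using h_sum[OF conjunct1[OF nn] h_scale[of 2 2 "- int l"]] by simp
  then show False using neg' by blast
qed

end

section \<open>Frames and their parallel transport\<close>

text \<open>The vertex opposite to \<open>c\<close> across the edge \<open>ab\<close>: the apex of the other triangle on that edge.\<close>

definition opp :: "'a set set \<Rightarrow> 'a \<Rightarrow> 'a \<Rightarrow> 'a \<Rightarrow> 'a" where
  "opp K a b c = (THE d. tri K a b d \<and> d \<noteq> c)"

text \<open>A frame is a triangle with a base point and a first direction; it stands for a local
  identification of the complex with the lattice of triangular type, in which \<open>a\<close>, \<open>b\<close> and \<open>c\<close> are at
  \<open>(0,0)\<close>, \<open>(1,0)\<close> and \<open>(1,1)\<close> and the neighbours of a point are its translates by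
  \<open>(1,0), (1,1), (0,1)\<close> and their negatives.\<close>

definition frames :: "'a set set \<Rightarrow> ('a \<times> 'a \<times> 'a) set" where
  "frames K = {(a, b, c). tri K a b c}"

text \<open>Rotation about the base point to the next triangle, a turn by one sixth.\<close>

definition rot :: "'a set set \<Rightarrow> 'a \<times> 'a \<times> 'a \<Rightarrow> 'a \<times> 'a \<times> 'a" where
  "rot K = (\<lambda>(a, b, c). (a, c, opp K a c b))"

definition swap :: "'a \<times> 'a \<times> 'a \<Rightarrow> 'a \<times> 'a \<times> 'a" where
  "swap = (\<lambda>(a, b, c). (a, c, b))"

text \<open>Parallel transport of the frame along \<open>(1,0)\<close>: the new base point is \<open>b\<close>, and the points at
  \<open>b + (1,0)\<close> and \<open>b + (1,1)\<close> are reached by crossing two edges.\<close>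

definition shift1 :: "'a set set \<Rightarrow> 'a \<times> 'a \<times> 'a \<Rightarrow> 'a \<times> 'a \<times> 'a" where
  "shift1 K = (\<lambda>(a, b, c). let d = opp K b c a in (b, opp K b d c, d))"

text \<open>Parallel transport along \<open>(0,1)\<close>.\<close>

definition shift2 :: "'a set set \<Rightarrow> 'a \<times> 'a \<times> 'a \<Rightarrow> 'a \<times> 'a \<times> 'a" where
  "shift2 K = (\<lambda>(a, b, c). let p = opp K a c b in (p, c, opp K p c a))"

locale hexagonal_complex =
  fixes K :: "'a set set"
  assumes hexagonal: "hexagonal K"
begin

lemma tri_hexagon:
  assumes "tri K a b c"
  obtains d e f g where "link_hexagon K a b c d e f g"
  using hexagonal_flag[OF hexagonal assms] by blast

lemma opp_commute: "opp K b a c = opp K a b c"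
  unfolding opp_def using tri_commute(1)[of K a b] by simp

lemma link_hexagon_tri:
  assumes "link_hexagon K a b c d e f g"
  shows "tri K a b c" "tri K a c d" "tri K a d e" "tri K a e f" "tri K a f g" "tri K a g b"
  using assms by (simp_all add: link_hexagon_def)

lemma link_hexagon_opp1:
  assumes h: "link_hexagon K a b c d e f g"
  shows "opp K a b c = g" "opp K a b g = c"
proof -
  have t: "tri K a b x \<longleftrightarrow> x = c \<or> x = g" for x
    using h by (auto simp: link_hexagon_def doubleton_eq_iff)
  have "c \<noteq> g" using h by (auto simp: link_hexagon_def)
  then show "opp K a b c = g" "opp K a b g = c" unfolding opp_def t by auto
qed

lemma link_hexagon_opp:
  assumes h: "link_hexagon K a b c d e f g"
  shows "opp K a b c = g" "opp K a b g = c" "opp K a c b = d" "opp K a c d = b"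
    "opp K a d c = e" "opp K a d e = c" "opp K a e d = f" "opp K a e f = d"
    "opp K a f e = g" "opp K a f g = e" "opp K a g f = b" "opp K a g b = f"
proof -
  note h1_5 = link_hexagon_rotations[OF h]
  show "opp K a b c = g" "opp K a b g = c" "opp K a c b = d" "opp K a c d = b"
    "opp K a d c = e" "opp K a d e = c" "opp K a e d = f" "opp K a e f = d"
    "opp K a f e = g" "opp K a f g = e" "opp K a g f = b" "opp K a g b = f"
    using link_hexagon_opp1[OF h] link_hexagon_opp1[OF h1_5(1)] link_hexagon_opp1[OF h1_5(2)]
      link_hexagon_opp1[OF h1_5(3)] link_hexagon_opp1[OF h1_5(4)] link_hexagon_opp1[OF h1_5(5)] by simp_all
qed

lemma tri_flip: "tri K a b c \<Longrightarrow> tri K a c b"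
  by (rule iffD1[OF tri_commute(2)])

lemma opp_tri:
  assumes "tri K a b c"
  shows "tri K a b (opp K a b c)" "opp K a b c \<noteq> c" "opp K a b (opp K a b c) = c"
proof -
  obtain d e f g where h: "link_hexagon K a b c d e f g" using tri_hexagon[OF assms] .
  note o = link_hexagon_opp[OF h] and t = link_hexagon_tri[OF h]
  show "tri K a b (opp K a b c)" unfolding o(1) using t(6) by (rule tri_flip)
  have "g \<noteq> c" using h by (auto simp: link_hexagon_def)
  then show "opp K a b c \<noteq> c" unfolding o(1) .
  show "opp K a b (opp K a b c) = c" using o(1,2) by simp
qed

lemma tri_cycle: "tri K a b c \<Longrightarrow> tri K b c a" "tri K a b c \<Longrightarrow> tri K c a b"
  by (auto simp: tri_def insert_commute)

lemma frames_closed: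
  assumes "f \<in> frames K"
  shows "rot K f \<in> frames K" "swap f \<in> frames K" "shift1 K f \<in> frames K" "shift2 K f \<in> frames K"
proof -
  obtain a b c where f: "f = (a, b, c)" and t: "tri K a b c"
    using assms by (auto simp: frames_def)
  have acb: "tri K a c b" using t by (rule tri_flip)
  show "rot K f \<in> frames K" using opp_tri(1)[OF acb] by (simp add: f rot_def frames_def)
  show "swap f \<in> frames K" using acb by (simp add: f swap_def frames_def)
  define d where "d = opp K b c a"
  have "tri K b c d" unfolding d_def by (rule opp_tri(1)[OF tri_cycle(1)[OF t]])
  then have "tri K b d c" by (rule tri_flip)
  from tri_flip[OF opp_tri(1)[OF this]] show "shift1 K f \<in> frames K"
    by (simp add: f shift1_def frames_def Let_def d_def)
  define p where "p = opp K a c b"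
  have "tri K a c p" unfolding p_def by (rule opp_tri(1)[OF acb])
  from opp_tri(1)[OF tri_flip[OF tri_cycle(2)[OF this]]]
  show "shift2 K f \<in> frames K" by (simp add: f shift2_def frames_def Let_def p_def)
qed

text \<open>Parallel transport around a rhombus is trivial because the hexagon at \<open>c\<close> closes up. All
  points involved are neighbours of \<open>c\<close>, so that one hexagon determines both sides; it serves in the
  same way for the relations with rotation and reflection.\<close>

lemma shifts_commute:
  assumes "f \<in> frames K"
  shows "shift1 K (shift2 K f) = shift2 K (shift1 K f)"
proof -
  obtain a b c where f: "f = (a, b, c)" and t: "tri K a b c"
    using assms by (auto simp: frames_def)
  obtain d x q p where h: "link_hexagon K c a b d x q p" using tri_hexagon[OF tri_cycle(2)[OF t]] .
  note o = link_hexagon_opp[OF h] and t = link_hexagon_tri[OF h]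
  have 1: "opp K b c a = d" "opp K a c b = p" "opp K p c a = q"
    using o opp_commute by simp_all
  have bdc: "tri K b d c" using t(2) by (rule tri_cycle(1))
  have "shift2 K (shift1 K f) = (c, d, x)"
    using opp_tri(3)[OF bdc] o(5) by (simp add: f shift1_def shift2_def Let_def 1)
  moreover have "shift1 K (shift2 K f) = (c, d, x)"
    using o(8,10) by (simp add: f shift1_def shift2_def Let_def 1)
  ultimately show ?thesis by simp
qed

lemma shift_rot:
  assumes "f \<in> frames K"
  shows "shift1 K (rot K f) = rot K (shift1 K (shift2 K f))" "shift2 K (rot K (shift1 K f)) = rot K f"
proof -
  obtain a b c where f: "f = (a, b, c)" and t: "tri K a b c"
    using assms by (auto simp: frames_def)
  obtain d x q p where h: "link_hexagon K c a b d x q p" using tri_hexagon[OF tri_cycle(2)[OF t]] .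
  note o = link_hexagon_opp[OF h] and t = link_hexagon_tri[OF h]
  have 1: "opp K b c a = d" "opp K a c b = p" "opp K p c a = q" "opp K b c d = a"
    using o opp_commute by simp_all
  have bdc: "tri K b d c" using t(2) by (rule tri_cycle(1))
  show "shift1 K (rot K f) = rot K (shift1 K (shift2 K f))"
    using o(7,8,9,10) by (simp add: f shift1_def shift2_def rot_def Let_def 1 o)
  show "shift2 K (rot K (shift1 K f)) = rot K f"
    using opp_tri(3)[OF bdc] by (simp add: f shift1_def shift2_def rot_def Let_def 1)
qed

lemma shift_swap:
  assumes "f \<in> frames K"
  shows "shift1 K (swap f) = swap (shift1 K (shift2 K f))" "shift2 K (swap (shift2 K f)) = swap f"
proof -
  obtain a b c where f: "f = (a, b, c)" and t: "tri K a b c"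
    using assms by (auto simp: frames_def)
  obtain d x q p where h: "link_hexagon K c a b d x q p" using tri_hexagon[OF tri_cycle(2)[OF t]] .
  note o = link_hexagon_opp[OF h] and t' = link_hexagon_tri[OF h]
  have 1: "opp K b c a = d" "opp K a c b = p" "opp K p c a = q" "opp K p c q = a" "opp K a c p = b"
    using o opp_commute by simp_all
  show "shift1 K (swap f) = swap (shift1 K (shift2 K f))"
    by (simp add: f shift1_def shift2_def swap_def Let_def 1 o)
  show "shift2 K (swap (shift2 K f)) = swap f"
    by (simp add: f shift2_def swap_def Let_def 1)
qed

lemma finite_frames: "finite (frames K)"
proof (rule finite_subset)
  let ?V = "vertices K"
  show "frames K \<subseteq> ?V \<times> ?V \<times> ?V" by (auto simp: frames_def tri_def vertices_def)
  show "finite (?V \<times> ?V \<times> ?V)"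
    using finite_vertices[OF hexagonalD(1)[OF hexagonal]] by simp
qed

lemma inj_shift1: "inj_on (shift1 K) (frames K)"
proof (rule inj_on_inverseI[where g = "\<lambda>(b, e, d). let c = opp K b d e in (opp K b c d, b, c)"], clarify)
  fix a b c assume "(a, b, c) \<in> frames K"
  then have t: "tri K b c a" using tri_cycle(1) by (simp add: frames_def)
  have t': "tri K b (opp K b c a) c" using tri_flip[OF opp_tri(1)[OF t]] .
  show "(case shift1 K (a, b, c) of (b, e, d) \<Rightarrow> let c = opp K b d e in (opp K b c d, b, c)) = (a, b, c)"
    using opp_tri(3)[OF t] opp_tri(3)[OF t'] by (simp add: shift1_def Let_def)
qed

lemma inj_shift2: "inj_on (shift2 K) (frames K)"
proof (rule inj_on_inverseI[where g = "\<lambda>(p, c, q). let a = opp K p c q in (a, opp K a c p, c)"], clarify)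
  fix a b c assume "(a, b, c) \<in> frames K"
  then have t: "tri K a c b" using tri_flip by (simp add: frames_def)
  have t': "tri K (opp K a c b) c a" using tri_flip[OF tri_cycle(2)[OF opp_tri(1)[OF t]]] .
  show "(case shift2 K (a, b, c) of (p, c, q) \<Rightarrow> let a = opp K p c q in (a, opp K a c p, c)) = (a, b, c)"
    using opp_tri(3)[OF t] opp_tri(3)[OF t'] by (simp add: shift2_def Let_def)
qed

end

lemma finite_perm_period:
  assumes fin: "finite F" and inj: "inj_on X F" and XF: "X ` F \<subseteq> F"
  shows "\<exists>M>0. \<forall>f. ((\<lambda>f. if f \<in> F then X f else f) ^^ M) f = f"
proof -
  let ?X = "\<lambda>f. if f \<in> F then X f else f"
  have "X ` F = F" using endo_inj_surj[OF fin XF inj] .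
  then have "bij_betw ?X F F" using inj by (auto simp: bij_betw_def inj_on_def)
  then have "?X permutes F" by (rule bij_imp_permutes) simp
  then have "permutation ?X" using fin permutation_permutes by blast
  from permutation_is_nilpotent[OF this] obtain M where "?X ^^ M = id" "M > 0" by blast
  then show ?thesis by (metis id_apply)
qed

text \<open>Both maps permute the finite set \<open>F\<close>, hence have finite order, and integer exponents can be
  reduced modulo these orders.\<close>

lemma Z2_action_of_commuting:
  assumes fin: "finite F" and X: "inj_on X F" "X ` F \<subseteq> F" and Y: "inj_on Y F" "Y ` F \<subseteq> F"
    and comm: "\<And>f. f \<in> F \<Longrightarrow> X (Y f) = Y (X f)"
  obtains act where "Z2_action act" "\<And>f. f \<in> F \<Longrightarrow> act 1 0 f = X f" "\<And>f. f \<in> F \<Longrightarrow> act 0 1 f = Y f"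
    "\<And>i j f. f \<in> F \<Longrightarrow> act i j f \<in> F"
proof -
  define X' where "X' f = (if f \<in> F then X f else f)" for f
  define Y' where "Y' f = (if f \<in> F then Y f else f)" for f
  obtain M where M: "M > 0" "\<And>f. (X' ^^ M) f = f"
    using finite_perm_period[OF fin X] unfolding X'_def by blast
  obtain N where N: "N > 0" "\<And>f. (Y' ^^ N) f = f"
    using finite_perm_period[OF fin Y] unfolding Y'_def by blast
  define P where "P Z m i = (Z :: 'a \<Rightarrow> 'a) ^^ nat (i mod int m)" for Z m i
  have P_add: "P Z m i (P Z m j f) = P Z m (i + j) f" if m: "m > 0" "\<And>f. (Z ^^ m) f = f" for Z m i j f
  proof -
    have mult: "(Z ^^ (m * q)) f = f" for q f
      by (induction q) (simp_all add: funpow_add m(2))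
    have md: "(Z ^^ k) f = (Z ^^ (k mod m)) f" for k f
    proof -
      have "(Z ^^ (k mod m + m * (k div m))) f = (Z ^^ (k mod m)) f"
        by (simp only: funpow_add comp_apply mult)
      then show ?thesis by simp
    qed
    have "P Z m i (P Z m j f) = (Z ^^ (nat (i mod int m) + nat (j mod int m))) f"
      by (simp add: P_def funpow_add)
    also have "\<dots> = (Z ^^ ((nat (i mod int m) + nat (j mod int m)) mod m)) f" by (rule md)
    also have "(nat (i mod int m) + nat (j mod int m)) mod m = nat ((i + j) mod int m)"
    proof -
      have "int ((nat (i mod int m) + nat (j mod int m)) mod m) = (i + j) mod int m"
        using m(1) by (simp add: zmod_int mod_add_eq)
      then show ?thesis by linarith
    qed
    finally show ?thesis by (simp add: P_def)
  qed
  have c1: "X' (Y' f) = Y' (X' f)" for f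
    using comm X(2) Y(2) by (auto simp: X'_def Y'_def)
  have c2: "X' ((Y' ^^ m) f) = (Y' ^^ m) (X' f)" for m f
    by (induction m) (simp_all add: c1)
  have cm: "(Y' ^^ m) ((X' ^^ k) f) = (X' ^^ k) ((Y' ^^ m) f)" for m k f
    by (induction k) (simp_all flip: c2)
  have "Z2_action (\<lambda>i j f. P X' M i (P Y' N j f))"
  proof
    show "P X' M 0 (P Y' N 0 f) = f" for f by (simp add: P_def)
    show "P X' M i (P Y' N j (P X' M k (P Y' N l f))) = P X' M (i + k) (P Y' N (j + l) f)" for i j k l f
      unfolding P_add[OF M, symmetric] P_add[OF N, symmetric] by (simp add: P_def cm)
  qed
  moreover have one: "P Z m 1 f = Z f" if "m > 0" "\<And>f. (Z ^^ m) f = f" for Z m f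
    using that by (cases "m = 1") (auto simp: P_def)
  moreover have stay: "(X' ^^ k) f \<in> F" "(Y' ^^ k) f \<in> F" if "f \<in> F" for k f
    using that X(2) Y(2) by (induction k) (auto simp: X'_def Y'_def)
  ultimately show ?thesis
    using that[of "\<lambda>i j f. P X' M i (P Y' N j f)"] one[OF M] one[OF N]
    by (auto simp: P_def X'_def Y'_def)
qed

section \<open>The developing map\<close>

locale hexagonal_action = hexagonal_complex K + Z2_action act
  for K :: "'a set set" and act :: "int \<Rightarrow> int \<Rightarrow> 'a \<times> 'a \<times> 'a \<Rightarrow> 'a \<times> 'a \<times> 'a" +
  assumes act_shift1: "f \<in> frames K \<Longrightarrow> act 1 0 f = shift1 K f"
    and act_shift2: "f \<in> frames K \<Longrightarrow> act 0 1 f = shift2 K f"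
    and act_frames: "f \<in> frames K \<Longrightarrow> act i j f \<in> frames K"
begin

text \<open>Relations for the two generators extend to the whole lattice by induction upwards and downwards.\<close>

lemma intertwine:
  assumes R: "\<And>f. f \<in> frames K \<Longrightarrow> R f \<in> frames K"
    and X: "\<And>f. f \<in> frames K \<Longrightarrow> act 1 0 (R f) = R (act xa xb f)"
    and Y: "\<And>f. f \<in> frames K \<Longrightarrow> act 0 1 (R f) = R (act ya yb f)"
    and f: "f \<in> frames K"
  shows "act i j (R f) = R (act (i * xa + j * ya) (i * xb + j * yb) f)"
proof -
  have step: "act (m * p) (m * q) (R f) = R (act (m * u) (m * v) f)"
    if 1: "\<And>f. f \<in> frames K \<Longrightarrow> act p q (R f) = R (act u v f)" and f: "f \<in> frames K" for m p q u v f
  proof (induction m rule: int_induct[of _ 0])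
    case base
    show ?case by (simp add: act_zero)
  next
    case (step1 m)
    have "act ((m + 1) * p) ((m + 1) * q) (R f) = act p q (act (m * p) (m * q) (R f))"
      by (simp add: act_add algebra_simps)
    also have "\<dots> = R (act u v (act (m * u) (m * v) f))"
      using step1 1 act_frames[OF f] by simp
    finally show ?case by (simp add: act_add algebra_simps)
  next
    case (step2 m)
    have "act p q (R (act ((m - 1) * u) ((m - 1) * v) f)) = act (m * p) (m * q) (R f)"
      using step2 1 act_frames[OF f] by (simp add: act_add algebra_simps)
    then have "act (- p) (- q) (act p q (R (act ((m - 1) * u) ((m - 1) * v) f)))
        = act (- p) (- q) (act (m * p) (m * q) (R f))" by simp
    then show ?case by (simp add: act_add act_zero algebra_simps)
  qed
  have "act i j (R f) = act (i * 1) (i * 0) (act (j * 0) (j * 1) (R f))" by (simp add: act_add)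
  also have "\<dots> = act (i * 1) (i * 0) (R (act (j * ya) (j * yb) f))"
    using step[OF Y f] by simp
  also have "\<dots> = R (act (i * xa) (i * xb) (act (j * ya) (j * yb) f))"
    by (rule step[OF X act_frames[OF f]])
  finally show ?thesis by (simp add: act_add)
qed

lemma act_11: "f \<in> frames K \<Longrightarrow> act 1 1 f = shift1 K (shift2 K f)"
  using act_add[of 1 0 0 1 f] act_shift1 act_shift2 frames_closed(4) by simp

text \<open>Rotation by one sixth is the linear map \<open>(1,0) \<mapsto> (1,1)\<close>, \<open>(0,1) \<mapsto> (-1,0)\<close> of the lattice;
  translating a rotated frame amounts to rotating the frame translated by the image vector.\<close>

lemma act_rot:
  assumes f: "f \<in> frames K"
  shows "act i j (rot K f) = rot K (act (i - j) i f)"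
proof -
  have "act i j (rot K f) = rot K (act (i * 1 + j * - 1) (i * 1 + j * 0) f)"
  proof (rule intertwine[OF frames_closed(1) _ _ f])
    fix f assume f: "f \<in> frames K"
    show "act 1 0 (rot K f) = rot K (act 1 1 f)"
      using shift_rot(1)[OF f] by (simp add: act_shift1 act_11 frames_closed f)
    define h where "h = act (- 1) 0 f"
    have h: "h \<in> frames K" "f = shift1 K h"
      using act_frames[OF f] act_shift1[of h] act_add[of 1 0 "-1" 0 f] by (simp_all add: h_def act_zero)
    show "act 0 1 (rot K f) = rot K (act (- 1) 0 f)"
      using shift_rot(2)[OF h(1)] act_shift2[OF frames_closed(1)[OF f]]
      unfolding h_def[symmetric] h(2)[symmetric] by simp
  qed
  then show ?thesis by simp
qed

text \<open>Likewise for the reflection \<open>(1,0) \<mapsto> (1,1)\<close>, \<open>(0,1) \<mapsto> (0,-1)\<close>.\<close>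

lemma act_swap:
  assumes f: "f \<in> frames K"
  shows "act i j (swap f) = swap (act i (i - j) f)"
proof -
  have "act i j (swap f) = swap (act (i * 1 + j * 0) (i * 1 + j * - 1) f)"
  proof (rule intertwine[OF frames_closed(2) _ _ f])
    fix f assume f: "f \<in> frames K"
    show "act 1 0 (swap f) = swap (act 1 1 f)"
      using shift_swap(1)[OF f] by (simp add: act_shift1 act_11 frames_closed f)
    define h where "h = act 0 (- 1) f"
    have h: "h \<in> frames K" "f = shift2 K h"
      using act_frames[OF f] act_shift2[of h] act_add[of 0 1 0 "-1" f] by (simp_all add: h_def act_zero)
    show "act 0 1 (swap f) = swap (act 0 (- 1) f)"
      using shift_swap(2)[OF h(1)] act_shift2[OF frames_closed(2)[OF f]]
      unfolding h_def[symmetric] h(2)[symmetric] by simp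
  qed
  then show ?thesis by simp
qed

text \<open>The developing map of the frame \<open>f\<close>: the vertex of the complex below the lattice point \<open>(i, j)\<close>.\<close>

definition pos :: "'a \<times> 'a \<times> 'a \<Rightarrow> int \<Rightarrow> int \<Rightarrow> 'a" where
  "pos f i j = fst (act i j f)"

lemma pos_act: "pos (act k l f) i j = pos f (i + k) (j + l)"
  by (simp add: pos_def act_add)

lemma fst_rot: "fst (rot K f) = fst f" and fst_swap: "fst (swap f) = fst f"
  by (simp_all add: rot_def swap_def split_beta)

lemma pos_rot: "f \<in> frames K \<Longrightarrow> pos (rot K f) i j = pos f (i - j) i"
  by (simp add: pos_def act_rot fst_rot)

lemma pos_00: "pos f 0 0 = fst f"
  by (simp add: pos_def act_zero)

lemma pos_10: "(a, b, c) \<in> frames K \<Longrightarrow> pos (a, b, c) 1 0 = b"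
  by (simp add: pos_def act_shift1) (simp add: shift1_def Let_def)

lemma rot_hexagon:
  "link_hexagon K a b c d e f g \<Longrightarrow> rot K (a, b, c) = (a, c, d)"
  by (simp add: rot_def link_hexagon_opp)

lemma frame_hexagon:
  "link_hexagon K a b c d e f g \<Longrightarrow> (a, b, c) \<in> frames K"
  by (simp add: frames_def link_hexagon_tri)

text \<open>The developing map is a covering near every lattice point. The first neighbour of a frame is at
  \<open>(1,0)\<close>; the other five follow by rotating the frame.\<close>

lemma star:
  assumes F: "F \<in> frames K"
  shows "link_hexagon K (pos F 0 0) (pos F 1 0) (pos F 1 1) (pos F 0 1) (pos F (-1) 0) (pos F (-1) (-1)) (pos F 0 (-1))"
proof -
  obtain a b c where F_eq: "F = (a, b, c)" and t: "tri K a b c"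
    using F by (auto simp: frames_def)
  obtain d e f g where h: "link_hexagon K a b c d e f g" using tri_hexagon[OF t] .
  note h1_5 = link_hexagon_rotations[OF h]
  note fr = frame_hexagon[OF h] frame_hexagon[OF h1_5(1)] frame_hexagon[OF h1_5(2)] frame_hexagon[OF h1_5(3)]
    frame_hexagon[OF h1_5(4)] frame_hexagon[OF h1_5(5)]
  note r = rot_hexagon[OF h] rot_hexagon[OF h1_5(1)] rot_hexagon[OF h1_5(2)] rot_hexagon[OF h1_5(3)] rot_hexagon[OF h1_5(4)]
  have p1: "pos (a, c, d) i j = pos F (i - j) i" for i j
    using pos_rot[OF fr(1)] by (simp add: r F_eq)
  have p2: "pos (a, d, e) i j = pos F (- j) (i - j)" for i j
    using pos_rot[OF fr(2)] by (simp add: r p1)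
  have p3: "pos (a, e, f) i j = pos F (- i) (- j)" for i j
    using pos_rot[OF fr(3)] by (simp add: r p2)
  have p4: "pos (a, f, g) i j = pos F (j - i) (- i)" for i j
    using pos_rot[OF fr(4)] by (simp add: r p3)
  have p5: "pos (a, g, b) i j = pos F j (j - i)" for i j
    using pos_rot[OF fr(5)] by (simp add: r p4)
  have "pos F 1 0 = b" "pos F 1 1 = c" "pos F 0 1 = d" "pos F (-1) 0 = e" "pos F (-1) (-1) = f" "pos F 0 (-1) = g"
    using pos_10[OF fr(1)] pos_10[OF fr(2)] pos_10[OF fr(3)] pos_10[OF fr(4)] pos_10[OF fr(5)] pos_10[OF fr(6)]
    by (simp_all add: p1 p2 p3 p4 p5 F_eq)
  then show ?thesis using h by (simp add: pos_00 F_eq)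
qed

text \<open>Besides the six unit vectors, the list has three vectors of the second length. They are differences
  of two neighbours of a common lattice point, and these are distinct in its hexagon.\<close>

lemma short_vectors_distinct:
  assumes F: "F \<in> frames K"
    and "(i, j) \<in> {(1, 0), (1, 1), (0, 1), (-1, 0), (-1, -1), (0, -1), (2, 1), (1, 2), (1, -1)}"
  shows "pos F i j \<noteq> pos F 0 0"
proof -
  have d: "distinct [pos F k l, pos F (1 + k) l, pos F (1 + k) (1 + l), pos F k (1 + l), pos F (-1 + k) l,
      pos F (-1 + k) (-1 + l), pos F k (-1 + l)]" for k l
  proof -
    let ?G = "act k l F"
    have "distinct [pos ?G 0 0, pos ?G 1 0, pos ?G 1 1, pos ?G 0 1, pos ?G (-1) 0, pos ?G (-1) (-1), pos ?G 0 (-1)]"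
      using star[OF act_frames[OF F, of k l]] unfolding link_hexagon_def by (rule conjunct1)
    then show ?thesis unfolding pos_act by simp
  qed
  have "pos F 2 1 \<noteq> pos F 0 0" "pos F 1 (-1) \<noteq> pos F 0 0"
    using d[of 1 0] by auto
  moreover have "pos F 1 2 \<noteq> pos F 0 0"
    using d[of 0 1] by auto
  moreover have "pos F i j \<noteq> pos F 0 0"
    if "(i, j) \<in> {(1, 0), (1, 1), (0, 1), (-1, 0), (-1, -1), (0, -1)}"
    using that d[of 0 0] by auto
  ultimately show ?thesis using assms(2) by auto
qed

lemma short_vectors_move:
  assumes "F \<in> frames K"
    and "(i, j) \<in> {(1, 0), (1, 1), (0, 1), (-1, 0), (-1, -1), (0, -1), (2, 1), (1, 2), (1, -1)}"
  shows "act i j F \<noteq> F"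
  using short_vectors_distinct[OF assms] by (metis act_zero pos_def)

lemma rot_iter_frames: "f \<in> frames K \<Longrightarrow> (rot K ^^ m) f \<in> frames K"
  by (induction m) (simp_all add: frames_closed)

lemma fst_rot_iter: "fst ((rot K ^^ m) f) = fst f"
  by (induction m) (simp_all add: fst_rot)

text \<open>The dihedral group of order 12 acts transitively on the frames at a vertex.\<close>

lemma same_base:
  assumes F: "F \<in> frames K" and G: "G \<in> frames K" and eq: "fst G = fst F"
  shows "\<exists>m<6. G = (rot K ^^ m) F \<or> G = (rot K ^^ m) (swap F)"
proof -
  obtain a b c where F_eq: "F = (a, b, c)" and t: "tri K a b c"
    using F by (auto simp: frames_def)
  obtain d e f g where h: "link_hexagon K a b c d e f g" using tri_hexagon[OF t] .
  note h1_5 = link_hexagon_rotations[OF h]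
  obtain u w where G_eq: "G = (a, u, w)" "tri K a u w"
    using G eq by (auto simp: frames_def F_eq)
  have r: "rot K (a, b, c) = (a, c, d)" "rot K (a, c, d) = (a, d, e)" "rot K (a, d, e) = (a, e, f)"
    "rot K (a, e, f) = (a, f, g)" "rot K (a, f, g) = (a, g, b)"
    "rot K (a, c, b) = (a, b, g)" "rot K (a, b, g) = (a, g, f)" "rot K (a, g, f) = (a, f, e)"
    "rot K (a, f, e) = (a, e, d)" "rot K (a, e, d) = (a, d, c)"
    by (simp_all add: rot_def link_hexagon_opp[OF h])
  have "(rot K ^^ 0) F = (a, b, c)" "(rot K ^^ 1) F = (a, c, d)" "(rot K ^^ 2) F = (a, d, e)"
    "(rot K ^^ 3) F = (a, e, f)" "(rot K ^^ 4) F = (a, f, g)" "(rot K ^^ 5) F = (a, g, b)"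
    "(rot K ^^ 0) (swap F) = (a, c, b)" "(rot K ^^ 1) (swap F) = (a, b, g)" "(rot K ^^ 2) (swap F) = (a, g, f)"
    "(rot K ^^ 3) (swap F) = (a, f, e)" "(rot K ^^ 4) (swap F) = (a, e, d)" "(rot K ^^ 5) (swap F) = (a, d, c)"
    by (simp_all add: eval_nat_numeral F_eq swap_def r)
  note it = this
  define S where "S = {G. \<exists>m<6. G = (rot K ^^ m) F \<or> G = (rot K ^^ m) (swap F)}"
  have S: "(rot K ^^ m) F \<in> S" "(rot K ^^ m) (swap F) \<in> S" if "m < 6" for m
    unfolding S_def using that by blast+
  have SS: "(a, b, c) \<in> S" "(a, c, d) \<in> S" "(a, d, e) \<in> S" "(a, e, f) \<in> S" "(a, f, g) \<in> S" "(a, g, b) \<in> S"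
    "(a, c, b) \<in> S" "(a, b, g) \<in> S" "(a, g, f) \<in> S" "(a, f, e) \<in> S" "(a, e, d) \<in> S" "(a, d, c) \<in> S"
    using S[of 0, unfolded it] S[of 1, unfolded it] S[of 2, unfolded it] S[of 3, unfolded it]
      S[of 4, unfolded it] S[of 5, unfolded it] by simp_all
  have "{u, w} \<in> {{b, c}, {c, d}, {d, e}, {e, f}, {f, g}, {g, b}}"
    using G_eq(2) h by (simp add: link_hexagon_def)
  then have "G \<in> S"
    unfolding G_eq(1) by (elim insertE emptyE) (auto simp: doubleton_eq_iff SS)
  then show ?thesis unfolding S_def by simp
qed

end

section \<open>Cyclic coordinates\<close>

text \<open>A form of the triangles that is symmetric in the three directions \<open>\<alpha>\<close>, \<open>\<beta>\<close> and
  \<open>- \<alpha> - \<beta>\<close>; the complex \<open>T\<^bsub>n,1,k\<^esub>\<close> is the case of the steps \<open>1\<close> and \<open>k\<close>.\<close>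

definition two_step_complex :: "(int \<Rightarrow> 'a) \<Rightarrow> int \<Rightarrow> int \<Rightarrow> 'a set set" where
  "two_step_complex \<phi> \<alpha> \<beta> = {\<sigma>. \<sigma> \<noteq> {} \<and>
     (\<exists>i. \<sigma> \<subseteq> {\<phi> i, \<phi> (i + \<beta>), \<phi> (i + \<beta> + \<alpha>)} \<or> \<sigma> \<subseteq> {\<phi> i, \<phi> (i + \<alpha>), \<phi> (i + \<beta> + \<alpha>)})}"

text \<open>The complex \<open>T\<^bsub>n,1,k\<^esub>\<close> with the residue classes modulo \<open>n\<close> as vertices; an \<open>n\<close>-periodic
  labelling \<open>\<phi>\<close> by all integers avoids the choice of representatives.\<close>

definition cyclic_torus :: "nat \<Rightarrow> int \<Rightarrow> 'a set set \<Rightarrow> (int \<Rightarrow> 'a) \<Rightarrow> bool" where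
  "cyclic_torus n k K \<phi> \<longleftrightarrow>
     (\<forall>i j. \<phi> i = \<phi> j \<longleftrightarrow> int n dvd i - j) \<and> K = two_step_complex \<phi> 1 k"

text \<open>The residues adjacent to 0, in cyclic order.\<close>

definition star_offsets :: "int \<Rightarrow> int list" where
  "star_offsets k = [1, k + 1, k, - 1, - k - 1, - k]"

text \<open>Without this the residue 0 could not have a hexagonal link.\<close>

definition nondegenerate :: "int \<Rightarrow> int \<Rightarrow> bool" where
  "nondegenerate n k \<longleftrightarrow> distinct (map (\<lambda>d. d mod n) (0 # star_offsets k))"

context hexagonal_action
begin

lemma orb_frames: "F \<in> frames K \<Longrightarrow> G \<in> orb F \<Longrightarrow> G \<in> frames K"
  by (auto simp: orb_def act_frames)

lemma orb_eq:
  assumes "G \<in> orb F"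
  shows "orb G = orb F"
proof -
  obtain i j where "G = act i j F" using assms by (auto simp: orb_def)
  then show ?thesis by (simp add: orb_act)
qed

text \<open>The image of the developing map contains with a vertex all its neighbours.\<close>

lemma orbit_base_surj:
  assumes F: "F \<in> frames K" and conn: "edge_connected K"
  shows "fst ` orb F = vertices K"
proof (rule conn[unfolded edge_connected_def, rule_format])
  have V: "fst G \<in> vertices K" if "G \<in> frames K" for G
    using that by (auto simp: frames_def tri_def vertices_def)
  then show "fst ` orb F \<subseteq> vertices K" using orb_frames[OF F] by blast
  show "fst ` orb F \<noteq> {}" using act_in_orb[of 0 0 F] by blast
  fix u v assume u: "u \<in> fst ` orb F" and uv: "{u, v} \<in> K"
  then obtain i j where G: "u = fst (act i j F)" by (auto simp: orb_def)
  let ?G = "act i j F"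
  have Gf: "?G \<in> frames K" by (rule act_frames[OF F])
  note h = star[OF Gf]
  show "v \<in> fst ` orb F"
  proof (cases "v = u")
    case False
    obtain x y z where xyz: "{u, v} \<subseteq> {x, y, z}" "tri K x y z"
      using hexagonalD(2)[OF hexagonal uv] by blast
    then have "tri K u v x \<or> tri K u v y \<or> tri K u v z"
      using False by (auto simp: tri_def insert_commute)
    then obtain w where "tri K u v w" by blast
    then have "tri K (pos ?G 0 0) v w" by (simp add: G pos_00)
    then have "v \<in> {pos ?G 1 0, pos ?G 1 1, pos ?G 0 1, pos ?G (-1) 0, pos ?G (-1) (-1), pos ?G 0 (-1)}"
      using h by (auto simp: link_hexagon_def doubleton_eq_iff)
    then show ?thesis by (auto simp: pos_def act_add intro!: imageI act_in_orb)
  qed (use u in simp)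
qed

lemma act_rot2: "f \<in> frames K \<Longrightarrow> act i j (rot K (rot K f)) = rot K (rot K (act (- j) (i - j) f))"
  by (simp add: act_rot frames_closed)

lemma act_rot3: "f \<in> frames K \<Longrightarrow>
    act i j (rot K (rot K (rot K f))) = rot K (rot K (rot K (act (- i) (- j) f)))"
  by (simp add: act_rot frames_closed)

lemma rot_orbit:
  assumes f: "f \<in> frames K"
  shows "rot K f \<noteq> f" "rot K (rot K f) \<noteq> f" "rot K (rot K (rot K f)) \<noteq> f" "(rot K ^^ 6) f = f"
proof -
  obtain a b c where F_eq: "f = (a, b, c)" and t: "tri K a b c"
    using f by (auto simp: frames_def)
  obtain d e x g where h: "link_hexagon K a b c d e x g" using tri_hexagon[OF t] .
  have r: "rot K (a, b, c) = (a, c, d)" "rot K (a, c, d) = (a, d, e)" "rot K (a, d, e) = (a, e, x)"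
    "rot K (a, e, x) = (a, x, g)" "rot K (a, x, g) = (a, g, b)" "rot K (a, g, b) = (a, b, c)"
    by (simp_all add: rot_def link_hexagon_opp[OF h])
  have "distinct [a, b, c, d, e, x, g]" using h unfolding link_hexagon_def by (rule conjunct1)
  then show "rot K f \<noteq> f" "rot K (rot K f) \<noteq> f" "rot K (rot K (rot K f)) \<noteq> f" "(rot K ^^ 6) f = f"
    by (auto simp: F_eq r eval_nat_numeral)
qed

text \<open>If the half-turn at \<open>f\<close> agrees with a translation, then there is a deck transformation
  \<open>z \<mapsto> (i, j) - z\<close>. Its centre is a vertex, where a frame would equal its own half-turn, or the
  midpoint of an edge, whose ends would be identified. Moving the base frame close to the centre
  reduces \<open>(i, j)\<close> modulo 2.\<close>

lemma no_half_turn: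
  assumes f: "f \<in> frames K"
  shows "rot K (rot K (rot K f)) \<notin> orb f"
proof
  assume "rot K (rot K (rot K f)) \<in> orb f"
  then obtain i j where ij: "rot K (rot K (rot K f)) = act i j f" by (auto simp: orb_def)
  define G where "G = act (i div 2) (j div 2) f"
  have G: "G \<in> frames K" by (simp add: G_def act_frames f)
  have "rot K (rot K (rot K G)) = act (- (i div 2)) (- (j div 2)) (act i j f)"
    using act_rot3[OF f, of "- (i div 2)" "- (j div 2)"] by (simp add: G_def ij)
  also have "\<dots> = act (i mod 2) (j mod 2) G"
    by (simp add: G_def act_add minus_mult_div_eq_mod[symmetric])
  finally have eq: "rot K (rot K (rot K G)) = act (i mod 2) (j mod 2) G" .
  then have "pos G (i mod 2) (j mod 2) = pos G 0 0"
    by (simp add: pos_def act_zero fst_rot flip: eq)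
  moreover have "i mod 2 = 0 \<or> i mod 2 = 1" "j mod 2 = 0 \<or> j mod 2 = 1" by auto
  ultimately have "i mod 2 = 0 \<and> j mod 2 = 0"
    using short_vectors_distinct[OF G, of "i mod 2" "j mod 2"] by auto
  then show False using eq rot_orbit(3)[OF G] by (simp add: act_zero)
qed

text \<open>A deck transformation that is a rotation by one third fixes a vertex or the centre of a triangle,
  whose corners would be identified.
  For a map \<open>z \<mapsto> g z + (i, j)\<close> with \<open>g\<close> of order three, changing the base point alters \<open>(i, j)\<close> by
  the image of \<open>1 - g\<close>, which has index 3 and \<open>(-1,0), (0,0), (1,0)\<close> as representatives.\<close>

lemma no_third_turn:
  assumes f: "f \<in> frames K"
  shows "rot K (rot K f) \<notin> orb f"
proof
  assume "rot K (rot K f) \<in> orb f"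
  then obtain i j where ij: "rot K (rot K f) = act i j f" by (auto simp: orb_def)
  define s where "s = (i + j + 1) mod 3 - 1"
  define p where "p = (i + j + 1) div 3"
  have ps: "i + j = 3 * p + s" unfolding p_def s_def by (simp add: minus_mod_eq_mult_div[symmetric])
  have s: "s = -1 \<or> s = 0 \<or> s = 1" unfolding s_def by presburger
  define q where "q = j - p"
  define G where "G = act p q f"
  have G: "G \<in> frames K" by (simp add: G_def act_frames f)
  have "rot K (rot K G) = act (q - p) (- p) (act i j f)"
    using act_rot2[OF f, of "q - p" "- p"] by (simp add: G_def ij)
  also have "\<dots> = act s 0 G"
    using ps by (simp add: G_def q_def act_add algebra_simps)
  finally have eq: "rot K (rot K G) = act s 0 G" .
  then have "pos G s 0 = pos G 0 0"
    by (simp add: pos_def act_zero fst_rot flip: eq)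
  then have "s = 0" using short_vectors_distinct[OF G, of s 0] s by auto
  then show False using eq rot_orbit(2)[OF G] by (simp add: act_zero)
qed

lemma orb_rot:
  assumes "f \<in> frames K" "g \<in> orb f"
  shows "rot K g \<in> orb (rot K f)"
proof -
  obtain i j where "g = act i j f" using assms(2) by (auto simp: orb_def)
  moreover have "act j (j - i) (rot K f) = rot K (act i j f)" using act_rot[OF assms(1), of j "j - i"] by simp
  ultimately show ?thesis by (metis act_in_orb)
qed

lemma orb_rot_iter:
  assumes "f \<in> frames K" "g \<in> orb f"
  shows "(rot K ^^ m) g \<in> orb ((rot K ^^ m) f)"
  using assms by (induction m) (simp_all add: orb_rot rot_iter_frames)

text \<open>Any non-trivial rotation has a power that is a rotation by a half or by one third.\<close>

lemma no_rotation:
  assumes f: "f \<in> frames K" and m: "(rot K ^^ m) f \<in> orb f"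
  shows "6 dvd m"
proof -
  have add: "(rot K ^^ (l + m)) f \<in> orb f" if "(rot K ^^ l) f \<in> orb f" for l
  proof -
    have "(rot K ^^ l) ((rot K ^^ m) f) \<in> orb ((rot K ^^ l) f)" by (rule orb_rot_iter[OF f m])
    also have "orb ((rot K ^^ l) f) = orb f" by (rule orb_eq[OF that])
    finally show ?thesis by (simp add: funpow_add)
  qed
  have per: "(rot K ^^ (6 * q)) f = f" for q
    by (induction q) (simp_all add: funpow_add rot_orbit(4)[OF f])
  have red: "(rot K ^^ (l mod 6)) f = (rot K ^^ l) f" for l
  proof -
    have "(rot K ^^ (l mod 6 + 6 * (l div 6))) f = (rot K ^^ (l mod 6)) f"
      by (simp only: funpow_add comp_apply per)
    then show ?thesis by simp
  qed
  have n: "(rot K ^^ 2) f \<notin> orb f" "(rot K ^^ 3) f \<notin> orb f"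
    using no_third_turn[OF f] no_half_turn[OF f] by (simp_all add: eval_nat_numeral)
  then have A: "q \<noteq> 2 \<and> q \<noteq> 3" if "(rot K ^^ q) f \<in> orb f" for q
    using that by auto
  have "(rot K ^^ ((m + m) mod 6)) f \<in> orb f" "(rot K ^^ ((m + m + m) mod 6)) f \<in> orb f"
    unfolding red using add[OF m] add[OF add[OF m]] by simp_all
  moreover have "(rot K ^^ (m mod 6)) f \<in> orb f" unfolding red by (rule m)
  ultimately have "m mod 6 \<noteq> 2" "m mod 6 \<noteq> 3" "(m + m) mod 6 \<noteq> 2" "(m + m + m) mod 6 \<noteq> 3"
    using A by blast+
  moreover define q where "q = m mod 6"
  moreover have "(m + m) mod 6 = (q + q) mod 6" "(m + m + m) mod 6 = (q + q + q) mod 6"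
    unfolding q_def by (metis mod_add_eq, metis mod_add_eq mod_add_left_eq)
  moreover have "q = 0 \<or> q = 1 \<or> q = 2 \<or> q = 3 \<or> q = 4 \<or> q = 5"
    using mod_less_divisor[of 6 m] unfolding q_def by linarith
  ultimately have "q = 0" by auto
  then show ?thesis by (simp add: q_def mod_eq_0_iff_dvd)
qed

lemma reflection_neq:
  assumes f: "f \<in> frames K" and m: "m < 6"
  shows "(rot K ^^ m) (swap f) \<noteq> f"
proof -
  obtain a b c where F_eq: "f = (a, b, c)" and t: "tri K a b c"
    using f by (auto simp: frames_def)
  obtain d e x g where h: "link_hexagon K a b c d e x g" using tri_hexagon[OF t] .
  have r: "rot K (a, c, b) = (a, b, g)" "rot K (a, b, g) = (a, g, x)" "rot K (a, g, x) = (a, x, e)"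
    "rot K (a, x, e) = (a, e, d)" "rot K (a, e, d) = (a, d, c)"
    by (simp_all add: rot_def link_hexagon_opp[OF h])
  have "distinct [a, b, c, d, e, x, g]" using h unfolding link_hexagon_def by (rule conjunct1)
  moreover have "m = 0 \<or> m = 1 \<or> m = 2 \<or> m = 3 \<or> m = 4 \<or> m = 5" using m by linarith
  ultimately show ?thesis
    by (elim disjE) (auto simp: F_eq r eval_nat_numeral swap_def)
qed

text \<open>The six reflections of the hexagon, with the linear maps of the lattice that they induce.\<close>

lemma act_reflection:
  assumes f: "f \<in> frames K"
  shows "act i j ((rot K ^^ 0) (swap f)) = (rot K ^^ 0) (swap (act i (i - j) f))"
    "act i j ((rot K ^^ 1) (swap f)) = (rot K ^^ 1) (swap (act (i - j) (- j) f))"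
    "act i j ((rot K ^^ 2) (swap f)) = (rot K ^^ 2) (swap (act (- j) (- i) f))"
    "act i j ((rot K ^^ 3) (swap f)) = (rot K ^^ 3) (swap (act (- i) (j - i) f))"
    "act i j ((rot K ^^ 4) (swap f)) = (rot K ^^ 4) (swap (act (j - i) j f))"
    "act i j ((rot K ^^ 5) (swap f)) = (rot K ^^ 5) (swap (act j i f))"
  by (simp_all add: eval_nat_numeral act_rot act_swap frames_closed f)

lemma inj_reflection:
  assumes "f \<in> frames K" "g \<in> frames K" "(rot K ^^ m) (swap f) = (rot K ^^ m) (swap g)"
  shows "f = g"
proof -
  have inj: "f = g" if "rot K f = rot K g" "f \<in> frames K" "g \<in> frames K" for f g
  proof -
    have "(rot K ^^ 5) (rot K f) = f" if "f \<in> frames K" for f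
      using rot_orbit(4)[OF that] by (simp add: eval_nat_numeral)
    then show ?thesis using that by metis
  qed
  have "swap f = swap g" using assms(3)
  proof (induction m)
    case (Suc m)
    then show ?case using inj rot_iter_frames frames_closed(2) assms(1,2) by simp
  qed simp
  then show ?thesis by (auto simp: swap_def split_beta prod_eq_iff)
qed

text \<open>If a reflection \<open>R\<close> of the frame \<open>f\<close> lies in its orbit, the complex looks like a Klein bottle. By
  \<open>no_rotation\<close> each vertex then carries exactly two frames of the orbit, exchanged by \<open>R\<close>, so the
  lattice acts on the orbit as an abelian group of order \<open>2 n\<close>, and the linear part of \<open>R\<close> induces an
  automorphism of it. This linear part exchanges two lattice vectors \<open>x\<close> and \<open>y\<close>, so by
  \<open>swap_symmetric_orbit\<close> one of \<open>x - y\<close> and \<open>x + y\<close> acts trivially. Both are too short for that.\<close>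

lemma no_reflection:
  assumes f: "f \<in> frames K" and m: "m < 6" and R: "(rot K ^^ m) (swap f) \<in> orb f"
    and conn: "edge_connected K" and n: "card (vertices K) = n" "prime n" "odd n"
  shows False
proof -
  define R where "R g = (rot K ^^ m) (swap g)" for g
  have R_frames: "R g \<in> frames K" if "g \<in> frames K" for g
    unfolding R_def by (rule rot_iter_frames[OF frames_closed(2)[OF that]])
  have m': "m = 0 \<or> m = 1 \<or> m = 2 \<or> m = 3 \<or> m = 4 \<or> m = 5" using m by linarith
  obtain t0 t1 where t: "R f = act t0 t1 f" using R by (auto simp: orb_def R_def)
  have act_R: "\<exists>k l. act k l (R g) = R (act i j g)" if "g \<in> frames K" for g i j
  proof -
    have "R (act i j g) = act i (i - j) (R g) \<or> R (act i j g) = act (i - j) (- j) (R g) \<or>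
        R (act i j g) = act (- j) (- i) (R g) \<or> R (act i j g) = act (- i) (j - i) (R g) \<or>
        R (act i j g) = act (j - i) j (R g) \<or> R (act i j g) = act j i (R g)"
      using m' unfolding R_def by (elim disjE) (simp_all only: act_reflection[OF that] diff_diff_eq2, simp_all)
    then show ?thesis by metis
  qed
  have R_orb: "R g \<in> orb f" if g: "g \<in> orb f" for g
  proof -
    obtain i j where "g = act i j f" using g by (auto simp: orb_def)
    then obtain k l where "R g = act k l (R f)" using act_R[OF f] by metis
    then show ?thesis using t by (simp add: act_add act_in_orb)
  qed
  have fin: "finite (orb f)"
    using finite_subset[OF _ finite_frames] orb_frames[OF f] by blast
  have finV: "finite (vertices K)" using finite_vertices[OF hexagonalD(1)[OF hexagonal]] .
  have fibre: "card {g \<in> orb f. fst g = v} = 2" if v: "v \<in> vertices K" for v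
  proof -
    obtain g where g: "g \<in> orb f" "fst g = v" using orbit_base_surj[OF f conn] v by (metis imageE)
    have gf: "g \<in> frames K" using orb_frames[OF f g(1)] .
    have og: "orb g = orb f" "orb (R g) = orb f" using orb_eq g(1) R_orb by blast+
    have "{g' \<in> orb f. fst g' = v} = {g, R g}"
    proof
      show "{g, R g} \<subseteq> {g' \<in> orb f. fst g' = v}"
        using g R_orb by (auto simp: R_def fst_rot_iter fst_swap)
      show "{g' \<in> orb f. fst g' = v} \<subseteq> {g, R g}"
      proof
        fix g' assume g': "g' \<in> {g' \<in> orb f. fst g' = v}"
        then have "g' \<in> frames K" "fst g' = fst g" using orb_frames[OF f] g by auto
        from same_base[OF gf this] obtain l where l: "l < 6"
          "g' = (rot K ^^ l) g \<or> g' = (rot K ^^ l) (swap g)" by blast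
        show "g' \<in> {g, R g}"
          using l(2)
        proof
          assume e: "g' = (rot K ^^ l) g"
          then have "6 dvd l" using no_rotation[OF gf] g' og by simp
          then have "l = 0" using l(1) by presburger
          then show ?thesis using e by simp
        next
          assume e: "g' = (rot K ^^ l) (swap g)"
          have sg: "swap g \<in> frames K" using frames_closed(2)[OF gf] .
          \<comment> \<open>two reflections differ by a rotation; adding 6 keeps its exponent a natural number\<close>
          have "(rot K ^^ (6 + l - m)) (R g) = (rot K ^^ (6 + l - m + m)) (swap g)"
            unfolding R_def funpow_add comp_apply ..
          also have "6 + l - m + m = l + 6" using m by simp
          also have "(rot K ^^ (l + 6)) (swap g) = g'"
            unfolding funpow_add comp_apply rot_orbit(4)[OF sg] e ..
          finally have "6 dvd 6 + l - m" using no_rotation[OF R_frames[OF gf]] g' og by simp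
          then have "l = m" using l(1) m by presburger
          then show ?thesis using e by (simp add: R_def)
        qed
      qed
    qed
    moreover have "R g \<noteq> g" unfolding R_def by (rule reflection_neq[OF gf m])
    ultimately show ?thesis by simp
  qed
  have "(\<Sum>g\<in>orb f. card {v \<in> vertices K. fst g = v}) = 2 * card (vertices K)"
    by (rule sum_multicount[OF fin finV]) (use fibre in blast)
  moreover have "card {v \<in> vertices K. fst g = v} = 1" if "g \<in> orb f" for g
  proof -
    have "{v \<in> vertices K. fst g = v} = {fst g}" using orbit_base_surj[OF f conn] that by auto
    then show ?thesis by simp
  qed
  ultimately have card: "card (orb f) = 2 * n" using n by simp
  have sym: "act k l f = f" if "act i j f = f" "\<And>g. g \<in> frames K \<Longrightarrow> act i j (R g) = R (act k l g)" for i j k l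
  proof -
    have "act i j (R f) = act t0 t1 (act i j f)" unfolding t by (simp add: act_add add.commute)
    also have "\<dots> = R f" using that(1) t by simp
    finally have "R (act k l f) = R f" using that(2)[OF f] by simp
    then show ?thesis unfolding R_def using inj_reflection[OF act_frames[OF f] f] by blast
  qed
  have clash: False
    if A: "\<And>g i j. g \<in> frames K \<Longrightarrow> act i j (R g) = R (act (u i j) (v i j) g)"
      and swap: "\<And>i j. u (i * x0 + j * y0) (i * x1 + j * y1) = j * x0 + i * y0"
        "\<And>i j. v (i * x0 + j * y0) (i * x1 + j * y1) = j * x1 + i * y1"
      and short: "act (x0 - y0) (x1 - y1) f \<noteq> f" "act (x0 + y0) (x1 + y1) f \<noteq> f"
    for u v x0 x1 y0 y1
    using swap_symmetric_orbit[OF card n(2,3), of x0 y0 x1 y1] sym[OF _ A] swap short by metis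
  note A = act_reflection and move = short_vectors_move[OF f]
  from m' show False
  proof (elim disjE)
    assume "m = 0"
    with A(1) show False
      by (intro clash[of "\<lambda>i j. i" "\<lambda>i j. i - j" 1 1 0 1]) (use move[of 0 "-1"] move[of 2 1] in \<open>simp_all add: R_def algebra_simps\<close>)
  next
    assume "m = 1"
    with A(2) show False
      by (intro clash[of "\<lambda>i j. i - j" "\<lambda>i j. - j" 0 "-1" 1 "-1"]) (use move[of 1 2] move[of "-1" 0] in \<open>simp_all add: R_def algebra_simps\<close>)
  next
    assume "m = 2"
    with A(3) show False
      by (intro clash[of "\<lambda>i j. - j" "\<lambda>i j. - i" 1 0 0 "-1"]) (use move[of 1 1] move[of 1 "-1"] in \<open>simp_all add: R_def algebra_simps\<close>)
  next
    assume "m = 3"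
    with A(4) show False
      by (intro clash[of "\<lambda>i j. - i" "\<lambda>i j. j - i" 1 "-1" 0 "-1"]) (use move[of 2 1] move[of 0 "-1"] in \<open>simp_all add: R_def algebra_simps\<close>)
  next
    assume "m = 4"
    with A(5) show False
      by (intro clash[of "\<lambda>i j. j - i" "\<lambda>i j. j" 0 1 1 1]) (use move[of "-1" 0] move[of 1 2] in \<open>simp_all add: R_def algebra_simps\<close>)
  next
    assume "m = 5"
    with A(6) show False
      by (intro clash[of "\<lambda>i j. j" "\<lambda>i j. i" 1 0 0 1]) (use move[of 1 "-1"] move[of 1 1] in \<open>simp_all add: R_def algebra_simps\<close>)
  qed
qed

text \<open>Two frames of one orbit at the same vertex would differ by a rotation or a reflection.\<close>

lemma orbit_base_inj:
  assumes F: "F \<in> frames K" and conn: "edge_connected K"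
    and n: "card (vertices K) = n" "prime n" "odd n"
  shows "inj_on fst (orb F)"
proof (rule inj_onI)
  fix g g' assume g: "g \<in> orb F" "g' \<in> orb F" "fst g = fst g'"
  have gf: "g \<in> frames K" "g' \<in> frames K" using orb_frames[OF F] g by blast+
  have og: "g' \<in> orb g" using orb_eq[OF g(1)] g(2) by simp
  obtain l where l: "l < 6" "g' = (rot K ^^ l) g \<or> g' = (rot K ^^ l) (swap g)"
    using same_base[OF gf g(3)[symmetric]] by blast
  from l(2) show "g = g'"
  proof
    assume e: "g' = (rot K ^^ l) g"
    then have "6 dvd l" using no_rotation[OF gf(1)] og by simp
    then have "l = 0" using l(1) by presburger
    then show ?thesis using e by simp
  next
    assume "g' = (rot K ^^ l) (swap g)"
    then show ?thesis using no_reflection[OF gf(1) l(1) _ conn n] og by blast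
  qed
qed

text \<open>Frames of one orbit correspond to vertices, so the orbit has prime size \<open>n\<close>. The vector \<open>(1,0)\<close> acts
  non-trivially and hence as an \<open>n\<close>-cycle, which numbers the vertices by residues, and \<open>(0,1)\<close> acts as
  some power \<open>k\<close> of it. In these coordinates the triangles of the lattice become those of
  \<open>T\<^bsub>n,1,k\<^esub>\<close>.\<close>

theorem cyclic_coordinates:
  assumes F: "F \<in> frames K" and conn: "edge_connected K"
    and n: "card (vertices K) = n" "prime n" "odd n"
  obtains k \<phi> where "cyclic_torus n k K \<phi>" "nondegenerate (int n) k"
proof -
  note inj = orbit_base_inj[OF F conn n]
  have cardO: "card (orb F) = n"
    using card_image[OF inj] orbit_base_surj[OF F conn] n(1) by simp
  have fin: "finite (orb F)"
    using finite_subset[OF _ finite_frames] orb_frames[OF F] by blast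
  have n0: "n > 0" using n(2) prime_gt_0_nat by blast
  obtain r where r: "r dvd card (orb F)" "card (range (\<lambda>m. act (m * 1) (m * 0) F)) = r"
      "\<And>m. act (m * 1) (m * 0) F = F \<longleftrightarrow> int r dvd m"
    by (rule cyclic_suborbit[OF fin, where ?x0.0 = 1 and ?x1.0 = 0]) (rule that)
  have "r \<noteq> 1" using r(3)[of 1] short_vectors_move[OF F, of 1 0] by auto
  then have rn: "r = n" using r(1) n(2) cardO by (auto simp: prime_nat_iff)
  have per: "act m 0 F = F \<longleftrightarrow> int n dvd m" for m using r(3)[of m] rn by simp
  have range: "range (\<lambda>m. act m 0 F) = orb F"
    by (rule card_seteq[OF fin]) (use r(2) rn cardO in \<open>auto simp: act_in_orb\<close>)
  then obtain k where k: "act 0 1 F = act k 0 F" using act_in_orb[of 0 1 F] unfolding range[symmetric] by blast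
  define \<phi> where "\<phi> i = pos F i 0" for i
  have col: "act i j F = act (i + k * j) 0 F" for i j
  proof -
    have "act (- k) 1 F = F" using k act_eq_iff[of 0 1 F k 0] by simp
    from act_scale_fixed[OF this, of j] have fixed: "act (- (k * j)) j F = F"
      by (simp add: mult.commute)
    have "act i j F = act (i + k * j) 0 (act (- (k * j)) j F)" by (simp add: act_add)
    then show ?thesis unfolding fixed .
  qed
  have pos_\<phi>: "pos F i j = \<phi> (i + k * j)" for i j
    unfolding pos_def \<phi>_def col[of i j] ..
  have \<phi>_eq: "\<phi> i = \<phi> j \<longleftrightarrow> int n dvd i - j" for i j
  proof -
    have "\<phi> i = \<phi> j \<longleftrightarrow> act i 0 F = act j 0 F"
      unfolding \<phi>_def pos_def by (rule inj_on_eq_iff[OF inj act_in_orb act_in_orb])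
    also have "\<dots> \<longleftrightarrow> int n dvd i - j" by (subst act_eq_iff) (simp add: per)
    finally show ?thesis .
  qed
  have hex: "link_hexagon K (\<phi> i) (\<phi> (i + 1)) (\<phi> (i + k + 1)) (\<phi> (i + k)) (\<phi> (i - 1)) (\<phi> (i - k - 1)) (\<phi> (i - k))" for i
    using star[OF act_frames[OF F, of i 0]] by (simp add: pos_act pos_\<phi> algebra_simps)
  let ?T = "two_step_complex \<phi> 1 k"
  note fc = hexagonalD(1)[OF hexagonal]
  have "?T \<subseteq> K"
  proof
    fix \<sigma> assume "\<sigma> \<in> ?T"
    then obtain i where \<sigma>: "\<sigma> \<noteq> {}" "\<sigma> \<subseteq> {\<phi> i, \<phi> (i + k), \<phi> (i + k + 1)} \<or> \<sigma> \<subseteq> {\<phi> i, \<phi> (i + 1), \<phi> (i + k + 1)}"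
      by (auto simp: two_step_complex_def)
    have "{\<phi> i, \<phi> (i + k), \<phi> (i + k + 1)} \<in> K" "{\<phi> i, \<phi> (i + 1), \<phi> (i + k + 1)} \<in> K"
      using link_hexagon_tri(1,2)[OF hex[of i]] by (auto simp: tri_def insert_commute)
    then show "\<sigma> \<in> K" using \<sigma> simplex_subset[OF fc] by blast
  qed
  moreover have "K \<subseteq> ?T"
  proof
    fix \<sigma> assume \<sigma>: "\<sigma> \<in> K"
    then obtain a b c where abc: "\<sigma> \<subseteq> {a, b, c}" "tri K a b c" using hexagonalD(2)[OF hexagonal] by blast
    have "a \<in> vertices K" using abc(2) by (auto simp: tri_def vertices_def)
    then have "a \<in> fst ` range (\<lambda>m. act m 0 F)" unfolding range orbit_base_surj[OF F conn] .
    then obtain i where i: "a = \<phi> i" by (auto simp: \<phi>_def pos_def)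
    have A: "{\<phi> j, \<phi> (j + k), \<phi> (j + k + 1)} \<supseteq> \<sigma> \<Longrightarrow> \<sigma> \<in> ?T"
      and B: "{\<phi> j, \<phi> (j + 1), \<phi> (j + k + 1)} \<supseteq> \<sigma> \<Longrightarrow> \<sigma> \<in> ?T" for j
      using simplex_nonempty[OF fc \<sigma>] unfolding two_step_complex_def by blast+
    have "{b, c} \<in> {{\<phi> (i + 1), \<phi> (i + k + 1)}, {\<phi> (i + k + 1), \<phi> (i + k)}, {\<phi> (i + k), \<phi> (i - 1)},
       {\<phi> (i - 1), \<phi> (i - k - 1)}, {\<phi> (i - k - 1), \<phi> (i - k)}, {\<phi> (i - k), \<phi> (i + 1)}}"
      using hex[of i] abc(2) by (simp add: link_hexagon_def i)
    moreover have "\<sigma> \<subseteq> insert (\<phi> i) {b, c}" using abc(1) i by simp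
    ultimately show "\<sigma> \<in> ?T"
      using A[of i] B[of i] A[of "i - k - 1"] B[of "i - 1"] B[of "i - k - 1"] A[of "i - k"]
      by (elim insertE emptyE) (simp_all add: insert_commute)
  qed
  ultimately have "cyclic_torus n k K \<phi>" unfolding cyclic_torus_def using \<phi>_eq by blast
  moreover have "nondegenerate (int n) k"
  proof -
    have mod: "i mod int n = j mod int n \<longleftrightarrow> \<phi> i = \<phi> j" for i j
      by (simp add: \<phi>_eq mod_eq_dvd_iff)
    have "distinct [\<phi> 0, \<phi> 1, \<phi> (k + 1), \<phi> k, \<phi> (- 1), \<phi> (- k - 1), \<phi> (- k)]"
      using conjunct1[OF hex[of 0, unfolded link_hexagon_def]] by (simp add: algebra_simps)
    then show ?thesis unfolding nondegenerate_def star_offsets_def by (simp only: list.map distinct.simps list.set insert_iff empty_iff mod) simp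
  qed
  ultimately show ?thesis using that by blast
qed

end

theorem chi0_cyclic_torus:
  assumes M: "dr_manifold_chi0 n K" and n: "prime n" "odd n"
  obtains k \<phi> where "cyclic_torus n k K \<phi>" "nondegenerate (int n) k"
proof -
  have hex: "hexagonal K" by (rule chi0_hexagonal[OF M]) (use n prime_gt_0_nat in blast)
  interpret hexagonal_complex K by standard (rule hex)
  obtain act where act: "Z2_action act" "\<And>f. f \<in> frames K \<Longrightarrow> act 1 0 f = shift1 K f"
      "\<And>f. f \<in> frames K \<Longrightarrow> act 0 1 f = shift2 K f" "\<And>i j f. f \<in> frames K \<Longrightarrow> act i j f \<in> frames K"
    by (rule Z2_action_of_commuting[OF finite_frames inj_shift1 _ inj_shift2 _ shifts_commute])
      (auto simp: frames_closed)
  interpret Z2_action act by (rule act(1))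
  interpret hexagonal_action K act by standard (use act in auto)
  have V: "card (vertices K) = n" using M by (simp add: dr_manifold_chi0_def)
  then have "K \<noteq> {}" using n prime_gt_0_nat by (auto simp: vertices_def)
  then obtain a b c where "tri K a b c" using hexagonalD(2)[OF hex] by blast
  then have "(a, b, c) \<in> frames K" by (simp add: frames_def)
  from cyclic_coordinates[OF this chi0_edge_connected[OF M] V n] show ?thesis using that by blast
qed

section \<open>Cyclic tori and their classification\<close>

lemma two_step_nonempty: "\<sigma> \<in> two_step_complex \<phi> \<alpha> \<beta> \<Longrightarrow> \<sigma> \<noteq> {}"
  by (simp add: two_step_complex_def)

lemma two_step_subset:
  assumes "\<sigma> \<in> two_step_complex \<phi> \<alpha> \<beta>" "\<tau> \<subseteq> \<sigma>" "\<tau> \<noteq> {}"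
  shows "\<tau> \<in> two_step_complex \<phi> \<alpha> \<beta>"
proof -
  obtain i where "\<sigma> \<subseteq> {\<phi> i, \<phi> (i + \<beta>), \<phi> (i + \<beta> + \<alpha>)} \<or> \<sigma> \<subseteq> {\<phi> i, \<phi> (i + \<alpha>), \<phi> (i + \<beta> + \<alpha>)}"
    using assms(1) by (auto simp: two_step_complex_def)
  then have "\<tau> \<subseteq> {\<phi> i, \<phi> (i + \<beta>), \<phi> (i + \<beta> + \<alpha>)} \<or> \<tau> \<subseteq> {\<phi> i, \<phi> (i + \<alpha>), \<phi> (i + \<beta> + \<alpha>)}"
    using assms(2) by (elim disjE) (auto dest: subset_trans)
  then show ?thesis using assms(3) unfolding two_step_complex_def by (intro CollectI conjI exI[of _ i])
qed

lemma two_step_commute: "two_step_complex \<phi> \<alpha> \<beta> = two_step_complex \<phi> \<beta> \<alpha>"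
  by (auto simp: two_step_complex_def add.commute add.left_commute)

text \<open>Both kinds of triangles are merely listed from another corner.\<close>

lemma two_step_third: "two_step_complex \<phi> \<alpha> \<beta> = two_step_complex \<phi> \<beta> (- \<alpha> - \<beta>)"
proof -
  have shift: "(\<exists>i. P i) \<longleftrightarrow> (\<exists>i. P (i + c))" for P :: "int \<Rightarrow> bool" and c
    by (metis diff_add_cancel)
  have "(\<exists>i. \<sigma> \<subseteq> {\<phi> i, \<phi> (i + (- \<alpha> - \<beta>)), \<phi> (i + (- \<alpha> - \<beta>) + \<beta>)}) \<longleftrightarrow>
      (\<exists>i. \<sigma> \<subseteq> {\<phi> i, \<phi> (i + \<beta>), \<phi> (i + \<beta> + \<alpha>)})" for \<sigma>
    by (subst shift[of _ "\<alpha> + \<beta>"]) (simp add: insert_commute algebra_simps)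
  moreover have "(\<exists>i. \<sigma> \<subseteq> {\<phi> i, \<phi> (i + \<beta>), \<phi> (i + (- \<alpha> - \<beta>) + \<beta>)}) \<longleftrightarrow>
      (\<exists>i. \<sigma> \<subseteq> {\<phi> i, \<phi> (i + \<alpha>), \<phi> (i + \<beta> + \<alpha>)})" for \<sigma>
    by (subst shift[of _ "\<alpha>"]) (simp add: insert_commute algebra_simps)
  ultimately show ?thesis unfolding two_step_complex_def ex_disj_distrib by simp
qed

lemma two_step_cong:
  assumes per: "\<And>i j. \<phi> i = \<phi> j \<longleftrightarrow> int n dvd i - j"
    and "\<alpha> mod int n = \<alpha>' mod int n" "\<beta> mod int n = \<beta>' mod int n"
  shows "two_step_complex \<phi> \<alpha> \<beta> = two_step_complex \<phi> \<alpha>' \<beta>'"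
proof -
  have "int n dvd \<alpha> - \<alpha>'" "int n dvd \<beta> - \<beta>'" using assms(2,3) by (auto simp: mod_eq_dvd_iff)
  then have "\<phi> (i + \<alpha>) = \<phi> (i + \<alpha>')" "\<phi> (i + \<beta>) = \<phi> (i + \<beta>')" "\<phi> (i + \<beta> + \<alpha>) = \<phi> (i + \<beta>' + \<alpha>')" for i
    unfolding per using dvd_add[of "int n" "\<beta> - \<beta>'" "\<alpha> - \<alpha>'"] by (auto simp: algebra_simps)
  then show ?thesis by (simp add: two_step_complex_def)
qed

text \<open>The six pairs are those formed from the three directions \<open>1\<close>, \<open>k\<close> and \<open>- 1 - k\<close>; by the symmetry of
  the triangles any such pair can serve as steps. If it equals \<open>(m, m k')\<close> for a unit \<open>m\<close>, relabelling the
  residues by \<open>m\<close> turns the steps into \<open>1\<close> and \<open>k'\<close>.\<close>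

lemma cyclic_torus_rescale:
  assumes T: "cyclic_torus n k K \<phi>" and m: "coprime m (int n)"
    and eq: "(m mod int n, m * k' mod int n) \<in> (\<lambda>(a, b). (a mod int n, b mod int n)) `
       {(1, k), (k, 1), (k, - 1 - k), (- 1 - k, k), (1, - 1 - k), (- 1 - k, 1)}"
  shows "cyclic_torus n k' K (\<lambda>i. \<phi> (m * i))"
proof -
  have per: "\<phi> i = \<phi> j \<longleftrightarrow> int n dvd i - j" and K: "K = two_step_complex \<phi> 1 k" for i j
    using T by (auto simp: cyclic_torus_def)
  have per': "\<phi> (m * i) = \<phi> (m * j) \<longleftrightarrow> int n dvd i - j" for i j
    unfolding per right_diff_distrib[symmetric] using m
    by (simp add: coprime_dvd_mult_right_iff coprime_commute)
  obtain a b where ab: "m mod int n = a mod int n" "m * k' mod int n = b mod int n"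
    "(a, b) \<in> {(1, k), (k, 1), (k, - 1 - k), (- 1 - k, k), (1, - 1 - k), (- 1 - k, 1)}"
    using eq by auto
  have t: "two_step_complex \<phi> 1 k = two_step_complex \<phi> k (- 1 - k)"
    "two_step_complex \<phi> k (- 1 - k) = two_step_complex \<phi> (- 1 - k) 1"
    using two_step_third[of \<phi> 1 k] two_step_third[of \<phi> k "- 1 - k"] by simp_all
  have K': "K = two_step_complex \<phi> a b"
    using ab(3) two_step_commute[of \<phi> k 1] two_step_commute[of \<phi> k "- 1 - k"] two_step_commute[of \<phi> 1 "- 1 - k"]
    by (auto simp: K t)
  also have "\<dots> = two_step_complex \<phi> m (m * k')"
    by (rule two_step_cong[OF per]) (simp_all add: ab)
  also have "\<dots> = two_step_complex (\<lambda>i. \<phi> (m * i)) 1 k'"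
  proof -
    \<comment> \<open>every residue is a multiple of the unit \<open>m\<close>\<close>
    have surj: "\<exists>j. \<forall>d. \<phi> (i + d) = \<phi> (m * j + d)" for i
    proof -
      obtain c d where "c * m + d * int n = 1"
        using bezout_int[of m "int n"] m by (metis coprime_iff_gcd_eq_1)
      then have "1 - m * c = d * int n" by (simp add: algebra_simps)
      then have "int n dvd 1 - m * c" by simp
      then have "int n dvd i * (1 - m * c)" by simp
      then show ?thesis unfolding per by (intro exI[of _ "c * i"]) (simp add: algebra_simps)
    qed
    have e: "(\<exists>i. P (\<phi> i) (\<phi> (i + p)) (\<phi> (i + q))) \<longleftrightarrow>
        (\<exists>i. P (\<phi> (m * i)) (\<phi> (m * i + p)) (\<phi> (m * i + q)))" for P p q
    proof
      assume "\<exists>i. P (\<phi> i) (\<phi> (i + p)) (\<phi> (i + q))"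
      then obtain i where i: "P (\<phi> i) (\<phi> (i + p)) (\<phi> (i + q))" by blast
      obtain j where j: "\<And>d. \<phi> (i + d) = \<phi> (m * j + d)" using surj by blast
      show "\<exists>i. P (\<phi> (m * i)) (\<phi> (m * i + p)) (\<phi> (m * i + q))"
        using i j[of 0] j[of p] j[of q] by auto
    qed blast
    have A: "(\<exists>i. \<sigma> \<subseteq> {\<phi> i, \<phi> (i + p), \<phi> (i + q)}) \<longleftrightarrow> (\<exists>i. \<sigma> \<subseteq> {\<phi> (m * i), \<phi> (m * i + p), \<phi> (m * i + q)})"
      for \<sigma> p q by (rule e[of "\<lambda>x y z. \<sigma> \<subseteq> {x, y, z}"])
    show ?thesis
      unfolding two_step_complex_def ex_disj_distrib add.assoc A by (simp add: algebra_simps)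
  qed
  finally show ?thesis using per' by (simp add: cyclic_torus_def)
qed

lemma cyclic_torus_vertices:
  assumes "cyclic_torus n k K \<phi>"
  shows "vertices K = range \<phi>"
proof
  have K: "K = two_step_complex \<phi> 1 k" using assms by (simp add: cyclic_torus_def)
  show "vertices K \<subseteq> range \<phi>" by (auto simp: vertices_def K two_step_complex_def)
  have "{\<phi> i} \<in> K" for i by (auto simp: K two_step_complex_def)
  then show "range \<phi> \<subseteq> vertices K" by (auto simp: vertices_def)
qed

lemma two_step_image:
  assumes "\<sigma> \<in> two_step_complex \<phi> \<alpha> \<beta>" and h: "\<And>i. h (\<phi> i) = \<psi> i"
  shows "h ` \<sigma> \<in> two_step_complex \<psi> \<alpha> \<beta>"
proof -
  obtain i where i: "\<sigma> \<noteq> {}" "\<sigma> \<subseteq> {\<phi> i, \<phi> (i + \<beta>), \<phi> (i + \<beta> + \<alpha>)} \<or> \<sigma> \<subseteq> {\<phi> i, \<phi> (i + \<alpha>), \<phi> (i + \<beta> + \<alpha>)}"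
    using assms(1) by (auto simp: two_step_complex_def)
  have "h ` \<sigma> \<subseteq> h ` {\<phi> i, \<phi> (i + \<beta>), \<phi> (i + \<beta> + \<alpha>)} \<or> h ` \<sigma> \<subseteq> h ` {\<phi> i, \<phi> (i + \<alpha>), \<phi> (i + \<beta> + \<alpha>)}"
    using i(2) image_mono by metis
  then show ?thesis using i(1) by (auto simp: two_step_complex_def h)
qed

lemma cyclic_torus_isomorphic:
  assumes T: "cyclic_torus n k K \<phi>" and U: "cyclic_torus n k L \<psi>"
  shows "K \<simeq>\<^sub>s L"
proof -
  have per: "\<phi> i = \<phi> j \<longleftrightarrow> \<psi> i = \<psi> j" for i j
    using T U by (simp add: cyclic_torus_def)
  have K: "K = two_step_complex \<phi> 1 k" and L: "L = two_step_complex \<psi> 1 k"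
    using T U by (simp_all add: cyclic_torus_def)
  define h where "h v = \<psi> (SOME i. \<phi> i = v)" for v
  have h: "h (\<phi> i) = \<psi> i" for i
    unfolding h_def by (rule someI2[of _ i]) (auto simp: per)
  define h' where "h' v = \<phi> (SOME i. \<psi> i = v)" for v
  have h': "h' (\<psi> i) = \<phi> i" for i
    unfolding h'_def by (rule someI2[of _ i]) (auto simp: per)
  have "bij_betw h (range \<phi>) (range \<psi>)"
    by (rule bij_betw_byWitness[where f' = h']) (auto simp: h h')
  moreover have "\<sigma> \<in> K \<longleftrightarrow> h ` \<sigma> \<in> L" if \<sigma>: "\<sigma> \<subseteq> range \<phi>" for \<sigma>
  proof
    show "\<sigma> \<in> K \<Longrightarrow> h ` \<sigma> \<in> L" unfolding K L by (rule two_step_image[where \<phi> = \<phi> and \<psi> = \<psi>]) (simp_all add: h)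
    assume "h ` \<sigma> \<in> L"
    then have "h' ` h ` \<sigma> \<in> K" unfolding K L by (rule two_step_image[where \<phi> = \<psi> and \<psi> = \<phi>]) (simp_all add: h')
    moreover have "h' (h v) = v" if "v \<in> \<sigma>" for v using that \<sigma> by (auto simp: h h')
    then have "h' ` h ` \<sigma> = \<sigma>" by (simp add: image_image)
    ultimately show "\<sigma> \<in> K" by simp
  qed
  ultimately show ?thesis
    unfolding complex_isomorphic_def cyclic_torus_vertices[OF T] cyclic_torus_vertices[OF U] by blast
qed

lemma cyclic_torus_T1:
  assumes n: "n > 0"
  shows "cyclic_torus n (int k) (T1 n k) (\<lambda>i. nat ((i - 1) mod int n) + 1)"
proof -
  define \<phi> where "\<phi> i = nat ((i - 1) mod int n) + 1" for i :: int
  have per: "\<phi> i = \<phi> j \<longleftrightarrow> int n dvd i - j" for i j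
  proof -
    have "\<phi> i = \<phi> j \<longleftrightarrow> (i - 1) mod int n = (j - 1) mod int n" using n by (simp add: \<phi>_def eq_nat_nat_iff)
    also have "\<dots> \<longleftrightarrow> int n dvd i - j" by (simp add: mod_eq_dvd_iff)
    finally show ?thesis .
  qed
  have wrap: "wrap n m = \<phi> (int m)" if "m > 0" for m
  proof -
    have "nat ((int m - 1) mod int n) = (m - 1) mod n"
    proof -
      have "int m - 1 = int (m - 1)" using that by simp
      then show ?thesis by (simp only: nat_int flip: zmod_int)
    qed
    then show ?thesis by (simp add: wrap_def \<phi>_def)
  qed
  have self: "\<phi> (int i) = i" if mem: "i \<in> {1..n}" for i
  proof -
    have "(int i - 1) mod int n = int i - 1" using mem by (intro mod_pos_pos_trivial) auto
    moreover obtain m where "i = Suc m" using mem by (cases i) auto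
    ultimately show ?thesis by (simp add: \<phi>_def)
  qed
  have rep: "\<phi> i \<in> {1..n} \<and> (\<forall>d. \<phi> (i + d) = \<phi> (int (\<phi> i) + d))" for i
  proof -
    have "nat ((i - 1) mod int n) < n" using n by (simp add: nat_less_iff)
    then have r: "\<phi> i \<in> {1..n}" by (simp add: \<phi>_def)
    have "int n dvd i - int (\<phi> i)" using self[OF r] per by metis
    then show ?thesis using r by (simp add: per)
  qed
  have ex: "(\<exists>i\<in>{1..n}. P i (wrap n (i + p)) (wrap n (i + q))) \<longleftrightarrow>
     (\<exists>i. P (\<phi> i) (\<phi> (i + int p)) (\<phi> (i + int q)))" for P p q
  proof
    assume "\<exists>i\<in>{1..n}. P i (wrap n (i + p)) (wrap n (i + q))"
    then obtain i where i: "i \<in> {1..n}" "P i (wrap n (i + p)) (wrap n (i + q))" by blast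
    then have "P (\<phi> (int i)) (\<phi> (int i + int p)) (\<phi> (int i + int q))"
      using self[OF i(1)] by (simp add: wrap)
    then show "\<exists>i. P (\<phi> i) (\<phi> (i + int p)) (\<phi> (i + int q))" by blast
  next
    assume "\<exists>i. P (\<phi> i) (\<phi> (i + int p)) (\<phi> (i + int q))"
    then obtain i where i: "P (\<phi> i) (\<phi> (i + int p)) (\<phi> (i + int q))" by blast
    have "\<phi> i > 0" using rep[of i] by simp
    then have "P (\<phi> i) (wrap n (\<phi> i + p)) (wrap n (\<phi> i + q))"
      using i rep[of i] by (simp add: wrap)
    then show "\<exists>i\<in>{1..n}. P i (wrap n (i + p)) (wrap n (i + q))" using rep[of i] by blast
  qed
  have A: "(\<exists>i\<in>{1..n}. \<sigma> \<subseteq> {i, wrap n (i + p), wrap n (i + q)}) \<longleftrightarrow>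
     (\<exists>i. \<sigma> \<subseteq> {\<phi> i, \<phi> (i + int p), \<phi> (i + int q)})" for \<sigma> p q
    by (rule ex[of "\<lambda>x y z. \<sigma> \<subseteq> {x, y, z}"])
  have "T1 n k = two_step_complex \<phi> 1 (int k)"
    unfolding T1_def two_step_complex_def bex_disj_distrib ex_disj_distrib add.assoc A by (simp add: add.commute)
  then have "cyclic_torus n (int k) (T1 n k) \<phi>" using per by (simp add: cyclic_torus_def)
  then show ?thesis unfolding \<phi>_def[abs_def] .
qed

text \<open>The triangles at \<open>i\<close> are obtained by letting \<open>i\<close> be each of the three corners of either kind of
  triangle.\<close>

lemma cyclic_torus_hexagon:
  assumes T: "cyclic_torus n k K \<phi>" and dist: "nondegenerate (int n) k"
  shows "link_hexagon K (\<phi> i) (\<phi> (i + 1)) (\<phi> (i + (k + 1))) (\<phi> (i + k)) (\<phi> (i + - 1))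
     (\<phi> (i + (- k - 1))) (\<phi> (i + - k))"
proof -
  have per: "\<phi> i = \<phi> j \<longleftrightarrow> int n dvd i - j" and K: "K = two_step_complex \<phi> 1 k" for i j
    using T by (auto simp: cyclic_torus_def)
  have shift: "\<phi> (i + d) = \<phi> (i + e) \<longleftrightarrow> d mod int n = e mod int n" for d e
    by (simp add: per mod_eq_dvd_iff)
  have distinct: "distinct [\<phi> i, \<phi> (i + 1), \<phi> (i + (k + 1)), \<phi> (i + k), \<phi> (i + - 1),
     \<phi> (i + (- k - 1)), \<phi> (i + - k)]"
  proof -
    have "inj_on (\<lambda>d. \<phi> (i + d)) (set (0 # star_offsets k))"
      using dist unfolding nondegenerate_def distinct_map by (auto simp: inj_on_def shift)
    moreover have "distinct (0 # star_offsets k)" using dist by (simp only: nondegenerate_def distinct_map)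
    ultimately have "distinct (map (\<lambda>d. \<phi> (i + d)) (0 # star_offsets k))" by (simp only: distinct_map simp_thms)
    then show ?thesis by (simp add: star_offsets_def)
  qed
  have tri_mem: "{\<phi> j, \<phi> (j + k), \<phi> (j + k + 1)} \<in> K" "{\<phi> j, \<phi> (j + 1), \<phi> (j + k + 1)} \<in> K" for j
    by (auto simp: K two_step_complex_def)
  let ?P = "{{\<phi> (i + 1), \<phi> (i + (k + 1))}, {\<phi> (i + (k + 1)), \<phi> (i + k)}, {\<phi> (i + k), \<phi> (i + - 1)},
     {\<phi> (i + - 1), \<phi> (i + (- k - 1))}, {\<phi> (i + (- k - 1)), \<phi> (i + - k)}, {\<phi> (i + - k), \<phi> (i + 1)}}"
  have "tri K (\<phi> i) u w \<longleftrightarrow> {u, w} \<in> ?P" for u w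
  proof
    assume P: "{u, w} \<in> ?P"
    have "\<forall>\<tau>\<in>?P. insert (\<phi> i) \<tau> \<in> K"
      using tri_mem(2)[of i] tri_mem(1)[of i] tri_mem(2)[of "i - 1"] tri_mem(1)[of "i - 1 - k"]
        tri_mem(2)[of "i - 1 - k"] tri_mem(1)[of "i - k"]
      by (simp add: insert_commute algebra_simps)
    from bspec[OF this P] have "{\<phi> i, u, w} \<in> K" .
    moreover have "\<phi> i \<noteq> u \<and> u \<noteq> w \<and> \<phi> i \<noteq> w"
      using P distinct by (elim insertE emptyE) (auto simp: doubleton_eq_iff)
    ultimately show "tri K (\<phi> i) u w" by (simp add: tri_def)
  next
    assume t: "tri K (\<phi> i) u w"
    then obtain j where j: "{\<phi> i, u, w} \<subseteq> {\<phi> j, \<phi> (j + k), \<phi> (j + k + 1)} \<or>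
        {\<phi> i, u, w} \<subseteq> {\<phi> j, \<phi> (j + 1), \<phi> (j + k + 1)}"
      by (auto simp: tri_def K two_step_complex_def)
    have move: "\<phi> (j + d) = \<phi> (i + (d - e))" if "\<phi> i = \<phi> (j + e)" for d e
      using that[symmetric] by (simp add: per algebra_simps)
    have rest: "{u, w} = {\<phi> (i + (d1 - e)), \<phi> (i + (d2 - e))}"
      if "\<phi> i = \<phi> (j + e)" "{\<phi> i, u, w} \<subseteq> {\<phi> (j + e), \<phi> (j + d1), \<phi> (j + d2)}" for e d1 d2
      using that t move[OF that(1), of d1] move[OF that(1), of d2] unfolding tri_def by auto
    from j show "{u, w} \<in> ?P"
    proof
      assume s: "{\<phi> i, u, w} \<subseteq> {\<phi> j, \<phi> (j + k), \<phi> (j + k + 1)}"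
      then consider "\<phi> i = \<phi> (j + 0)" | "\<phi> i = \<phi> (j + k)" | "\<phi> i = \<phi> (j + (k + 1))" by (auto simp: add.assoc)
      then show ?thesis
      proof cases
        case 1
        from rest[OF 1, of k "k + 1"] s have "{u, w} = {\<phi> (i + k), \<phi> (i + (k + 1))}" by (simp add: add.assoc insert_commute)
        then show ?thesis by (simp add: insert_commute)
      next
        case 2
        from rest[OF 2, of 0 "k + 1"] s have "{u, w} = {\<phi> (i + - k), \<phi> (i + 1)}" by (simp add: add.assoc insert_commute)
        then show ?thesis by (simp add: insert_commute)
      next
        case 3
        from rest[OF 3, of 0 k] s have "{u, w} = {\<phi> (i + (- k - 1)), \<phi> (i + - 1)}" by (simp add: add.assoc insert_commute)
        then show ?thesis by (simp add: insert_commute)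
      qed
    next
      assume s: "{\<phi> i, u, w} \<subseteq> {\<phi> j, \<phi> (j + 1), \<phi> (j + k + 1)}"
      then consider "\<phi> i = \<phi> (j + 0)" | "\<phi> i = \<phi> (j + 1)" | "\<phi> i = \<phi> (j + (k + 1))" by (auto simp: add.assoc)
      then show ?thesis
      proof cases
        case 1
        from rest[OF 1, of 1 "k + 1"] s have "{u, w} = {\<phi> (i + 1), \<phi> (i + (k + 1))}" by (simp add: add.assoc insert_commute)
        then show ?thesis by (simp add: insert_commute)
      next
        case 2
        from rest[OF 2, of 0 "k + 1"] s have "{u, w} = {\<phi> (i + - 1), \<phi> (i + k)}" by (simp add: add.assoc insert_commute)
        then show ?thesis by (simp add: insert_commute)
      next
        case 3
        from rest[OF 3, of 0 1] s have "{u, w} = {\<phi> (i + (- k - 1)), \<phi> (i + - k)}" by (simp add: add.assoc insert_commute)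
        then show ?thesis by (simp add: insert_commute)
      qed
    qed
  qed
  then show ?thesis using distinct unfolding link_hexagon_def by blast
qed

lemma cyclic_torus_hexagonal:
  assumes T: "cyclic_torus n k K \<phi>" and n: "n > 0"
    and dist: "nondegenerate (int n) k"
  shows "hexagonal K" "card (vertices K) = n" "edge_connected K"
proof -
  have per: "\<phi> i = \<phi> j \<longleftrightarrow> int n dvd i - j" and K: "K = two_step_complex \<phi> 1 k" for i j
    using T by (auto simp: cyclic_torus_def)
  note V = cyclic_torus_vertices[OF T]
  have red: "\<phi> i = \<phi> (i mod int n)" for i by (simp add: per minus_mod_eq_mult_div)
  have img: "range \<phi> = \<phi> ` {0..<int n}"
  proof
    show "range \<phi> \<subseteq> \<phi> ` {0..<int n}"
    proof clarify
      fix i show "\<phi> i \<in> \<phi> ` {0..<int n}"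
        using red[of i] n by (intro image_eqI[of _ _ "i mod int n"]) auto
    qed
  qed auto
  have "inj_on \<phi> {0..<int n}"
  proof (rule inj_onI)
    fix i j assume "i \<in> {0..<int n}" "j \<in> {0..<int n}" "\<phi> i = \<phi> j"
    then have "i mod int n = j mod int n" by (simp only: per mod_eq_dvd_iff)
    moreover have "i mod int n = i" "j mod int n = j" using \<open>i \<in> _\<close> \<open>j \<in> _\<close> by simp_all
    ultimately show "i = j" by (simp only:)
  qed
  then show "card (vertices K) = n" by (simp add: V img card_image)
  have "finite (range \<phi>)" by (simp add: img)
  moreover have sub: "\<sigma> \<subseteq> range \<phi>" if "\<sigma> \<in> K" for \<sigma> using that V by (auto simp: vertices_def)
  ultimately have fin: "finite \<sigma>" if "\<sigma> \<in> K" for \<sigma> using that finite_subset by metis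
  have "K \<subseteq> Pow (range \<phi>)" using sub by blast
  then have finK: "finite K" by (rule finite_subset) (simp add: img)
  have fc: "finite_complex K"
    unfolding finite_complex_def
  proof (intro conjI ballI allI impI)
    show "\<sigma> \<noteq> {}" if "\<sigma> \<in> K" for \<sigma> using that unfolding K by (rule two_step_nonempty)
    show "\<tau> \<in> K" if "\<sigma> \<in> K" "\<tau> \<subseteq> \<sigma> \<and> \<tau> \<noteq> {}" for \<sigma> \<tau>
      using that(1) unfolding K by (rule two_step_subset) (use that(2) in simp_all)
  qed (use finK fin in blast)+
  note hex = cyclic_torus_hexagon[OF T dist]
  have "\<exists>a b c. \<sigma> \<subseteq> {a, b, c} \<and> tri K a b c" if \<sigma>: "\<sigma> \<in> K" for \<sigma>
  proof -
    obtain i where "\<sigma> \<subseteq> {\<phi> i, \<phi> (i + k), \<phi> (i + k + 1)} \<or> \<sigma> \<subseteq> {\<phi> i, \<phi> (i + 1), \<phi> (i + k + 1)}"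
      using \<sigma> by (auto simp: K two_step_complex_def)
    moreover have "tri K (\<phi> i) (\<phi> (i + k)) (\<phi> (i + k + 1))" "tri K (\<phi> i) (\<phi> (i + 1)) (\<phi> (i + k + 1))"
      using hex[of i] by (simp_all add: link_hexagon_def insert_commute add.assoc)
    ultimately show ?thesis by blast
  qed
  moreover have "\<exists>b c d e f g. link_hexagon K a b c d e f g" if "a \<in> vertices K" for a
    using that hex unfolding V by blast
  ultimately show "hexagonal K" unfolding hexagonal_def using fc by simp
  show "edge_connected K"
    unfolding edge_connected_def
  proof (intro allI impI equalityI)
    fix A assume A: "A \<subseteq> vertices K" "A \<noteq> {}" and step: "\<forall>u\<in>A. \<forall>v. {u, v} \<in> K \<longrightarrow> v \<in> A"
    obtain u where u: "u \<in> A" using A(2) by blast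
    then have "u \<in> range \<phi>" using A(1) unfolding V by blast
    then obtain i where i: "\<phi> i \<in> A" using u by blast
    have edge: "{\<phi> j, \<phi> (j + 1)} \<in> K" for j by (auto simp: K two_step_complex_def)
    have up: "\<phi> (i + int m) \<in> A" for m
    proof (induction m)
      case (Suc m)
      then show ?case using step edge[of "i + int m"] by (metis add.assoc of_nat_Suc add.commute)
    qed (simp add: i)
    show "vertices K \<subseteq> A"
      unfolding V
    proof clarify
      fix j
      have "\<phi> j = \<phi> (i + int (nat ((j - i) mod int n)))"
        using n by (simp add: per minus_mod_eq_mult_div diff_diff_add[symmetric])
      then show "\<phi> j \<in> A" by (simp only: up)
    qed
  qed blast
qed

lemma T1_dr_manifold:
  assumes "n > 0" "nondegenerate (int n) (int k)"
  shows "dr_manifold_chi0 n (T1 n k)"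
  using cyclic_torus_hexagonal[OF cyclic_torus_T1[OF assms(1)] assms]
  by (intro hexagonal_dr_manifold assms(1))

definition common_neighbours :: "'a set set \<Rightarrow> 'a \<Rightarrow> 'a \<Rightarrow> 'a set" where
  "common_neighbours K u v = {w. {u, w} \<in> K \<and> {v, w} \<in> K \<and> w \<noteq> u \<and> w \<noteq> v}"

lemma common_neighbours_subset: "common_neighbours K u v \<subseteq> vertices K"
  by (auto simp: common_neighbours_def vertices_def)

lemma isomorphic_common_neighbours:
  assumes "K \<simeq>\<^sub>s L"
  obtains f where "bij_betw f (vertices K) (vertices L)"
    "\<And>u v. u \<in> vertices K \<Longrightarrow> v \<in> vertices K \<Longrightarrow> {u, v} \<in> K \<longleftrightarrow> {f u, f v} \<in> L"
    "\<And>u v. u \<in> vertices K \<Longrightarrow> v \<in> vertices K \<Longrightarrow>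
       card (common_neighbours L (f u) (f v)) = card (common_neighbours K u v)"
proof -
  obtain f where f: "bij_betw f (vertices K) (vertices L)"
    and s: "\<And>\<sigma>. \<sigma> \<subseteq> vertices K \<Longrightarrow> \<sigma> \<in> K \<longleftrightarrow> f ` \<sigma> \<in> L"
    using assms unfolding complex_isomorphic_def by blast
  have e: "{u, v} \<in> K \<longleftrightarrow> {f u, f v} \<in> L" if "u \<in> vertices K" "v \<in> vertices K" for u v
    using s[of "{u, v}"] that by simp
  note sub = common_neighbours_subset
  have "card (common_neighbours L (f u) (f v)) = card (common_neighbours K u v)"
    if uv: "u \<in> vertices K" "v \<in> vertices K" for u v
  proof -
    have inj: "f x = f y \<longleftrightarrow> x = y" if "x \<in> vertices K" "y \<in> vertices K" for x y
      using f that by (auto simp: bij_betw_def inj_on_def)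
    have mem: "f w \<in> common_neighbours L (f u) (f v) \<longleftrightarrow> w \<in> common_neighbours K u v" if "w \<in> vertices K" for w
      using uv that by (simp add: common_neighbours_def e inj)
    have VL: "vertices L = f ` vertices K" using f by (simp add: bij_betw_def)
    have "common_neighbours L (f u) (f v) = f ` common_neighbours K u v"
    proof (intro equalityI subsetI)
      fix x assume x: "x \<in> common_neighbours L (f u) (f v)"
      then have "x \<in> f ` vertices K" using sub[of L "f u" "f v"] unfolding VL by blast
      then obtain w where w: "x = f w" "w \<in> vertices K" by blast
      then show "x \<in> f ` common_neighbours K u v" using x mem by blast
    next
      fix x assume "x \<in> f ` common_neighbours K u v"
      then obtain w where w: "x = f w" "w \<in> common_neighbours K u v" by blast
      moreover have "w \<in> vertices K" using w(2) sub[of K u v] by blast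
      ultimately show "x \<in> common_neighbours L (f u) (f v)" using mem by blast
    qed
    moreover have "inj_on f (common_neighbours K u v)"
      using f sub[of K u v] unfolding bij_betw_def by (blast intro: inj_on_subset)
    ultimately show ?thesis by (simp add: card_image)
  qed
  then show ?thesis using that[OF f] e by blast
qed

definition residue_adjacent :: "int \<Rightarrow> int \<Rightarrow> int \<Rightarrow> bool" where
  "residue_adjacent n k d \<longleftrightarrow> d mod n \<in> set (map (\<lambda>d. d mod n) (star_offsets k))"

definition residue_common :: "int \<Rightarrow> int \<Rightarrow> int \<Rightarrow> nat" where
  "residue_common n k d = length (filter (\<lambda>x. residue_adjacent n k x \<and> residue_adjacent n k (x - d)) [0..n - 1])"

lemma cyclic_torus_adjacent:
  assumes T: "cyclic_torus n k K \<phi>" and n: "n > 0"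
    and dist: "nondegenerate (int n) k"
  shows "{\<phi> i, \<phi> j} \<in> K \<and> \<phi> j \<noteq> \<phi> i \<longleftrightarrow> residue_adjacent (int n) k (j - i)"
proof -
  have per: "\<phi> i = \<phi> j \<longleftrightarrow> int n dvd i - j" for i j
    using T by (auto simp: cyclic_torus_def)
  have shift: "\<phi> j = \<phi> (i + d) \<longleftrightarrow> (j - i) mod int n = d mod int n" for d
    by (simp add: per mod_eq_dvd_iff algebra_simps)
  show ?thesis
    unfolding hexagonal_neighbours[OF cyclic_torus_hexagonal(1)[OF T n dist] cyclic_torus_hexagon[OF T dist]]
    by (simp only: shift residue_adjacent_def star_offsets_def list.map list.set insert_iff empty_iff)
qed

text \<open>Translations act transitively on the vertices, so only the difference of the two residues matters.\<close>

lemma cyclic_torus_common_neighbours: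
  assumes T: "cyclic_torus n k K \<phi>" and n: "n > 0"
    and dist: "nondegenerate (int n) k"
  shows "card (common_neighbours K (\<phi> i) (\<phi> j)) = residue_common (int n) k (j - i)"
proof -
  have per: "\<phi> i = \<phi> j \<longleftrightarrow> int n dvd i - j" for i j
    using T by (auto simp: cyclic_torus_def)
  let ?X = "{x \<in> {0..<int n}. residue_adjacent (int n) k x \<and> residue_adjacent (int n) k (x - (j - i))}"
  have adj: "\<phi> l \<in> common_neighbours K (\<phi> i) (\<phi> j) \<longleftrightarrow>
      residue_adjacent (int n) k (l - i) \<and> residue_adjacent (int n) k (l - j)" for l
    unfolding common_neighbours_def using cyclic_torus_adjacent[OF T n dist] by blast
  have "common_neighbours K (\<phi> i) (\<phi> j) = (\<lambda>x. \<phi> (i + x)) ` ?X"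
  proof
    show "(\<lambda>x. \<phi> (i + x)) ` ?X \<subseteq> common_neighbours K (\<phi> i) (\<phi> j)"
      by (auto simp: adj algebra_simps)
    show "common_neighbours K (\<phi> i) (\<phi> j) \<subseteq> (\<lambda>x. \<phi> (i + x)) ` ?X"
    proof
      fix w assume w: "w \<in> common_neighbours K (\<phi> i) (\<phi> j)"
      then have "w \<in> range \<phi>"
        using cyclic_torus_vertices[OF T] by (auto simp: common_neighbours_def vertices_def)
      then obtain l where l: "w = \<phi> l" by blast
      define x where "x = (l - i) mod int n"
      have "w = \<phi> (i + x)" using l per[of l "i + x"] by (simp add: x_def minus_mod_eq_mult_div diff_diff_add[symmetric])
      moreover have "x \<in> {0..<int n}" using n by (simp add: x_def)
      ultimately show "w \<in> (\<lambda>x. \<phi> (i + x)) ` ?X" using w adj[of "i + x"] by (auto simp: algebra_simps)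
    qed
  qed
  moreover have "inj_on (\<lambda>x. \<phi> (i + x)) ?X"
  proof (rule inj_onI)
    fix x y assume xy: "x \<in> ?X" "y \<in> ?X" "\<phi> (i + x) = \<phi> (i + y)"
    have "x mod int n = y mod int n" using xy(3) by (simp add: per mod_eq_dvd_iff)
    moreover have "x mod int n = x" "y mod int n = y" using xy(1,2) by simp_all
    ultimately show "x = y" by (simp only:)
  qed
  moreover have "?X = set (filter (\<lambda>x. residue_adjacent (int n) k x \<and> residue_adjacent (int n) k (x - (j - i))) [0..int n - 1])"
    by auto
  moreover have "distinct (filter P [0..int n - 1])" for P by simp
  ultimately show ?thesis
    unfolding residue_common_def by (simp only: card_image distinct_card)
qed

text \<open>An isomorphism preserves the number of common neighbours of two vertices. The comparison runs over
  all pairs of distinct vertices, or, if \<open>all_pairs\<close> is false, over the adjacent ones: \<open>k\<close> has a pair with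
  more common neighbours than any pair for \<open>l\<close>.\<close>

lemma cyclic_tori_not_isomorphic:
  assumes T: "cyclic_torus n k K \<phi>" "nondegenerate (int n) k"
    and U: "cyclic_torus n l L \<psi>" "nondegenerate (int n) l"
    and n: "n > 0"
    and d: "d mod int n \<noteq> 0" "residue_adjacent (int n) k d \<or> all_pairs"
    and less: "\<forall>e\<in>{1..<int n}. residue_adjacent (int n) l e \<or> all_pairs \<longrightarrow> residue_common (int n) l e < residue_common (int n) k d"
  shows "\<not> K \<simeq>\<^sub>s L"
proof
  assume iso: "K \<simeq>\<^sub>s L"
  obtain f where f: "bij_betw f (vertices K) (vertices L)"
    "\<And>u v. u \<in> vertices K \<Longrightarrow> v \<in> vertices K \<Longrightarrow> {u, v} \<in> K \<longleftrightarrow> {f u, f v} \<in> L"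
    "\<And>u v. u \<in> vertices K \<Longrightarrow> v \<in> vertices K \<Longrightarrow>
       card (common_neighbours L (f u) (f v)) = card (common_neighbours K u v)"
    by (rule isomorphic_common_neighbours[OF iso]) (rule that)
  note VK = cyclic_torus_vertices[OF T(1)] and VL = cyclic_torus_vertices[OF U(1)]
  have perK: "\<phi> i = \<phi> j \<longleftrightarrow> int n dvd i - j" and perL: "\<psi> i = \<psi> j \<longleftrightarrow> int n dvd i - j" for i j
    using T U by (auto simp: cyclic_torus_def)
  have mem: "\<phi> 0 \<in> vertices K" "\<phi> d \<in> vertices K" by (auto simp: VK)
  then have "f (\<phi> 0) \<in> range \<psi>" "f (\<phi> d) \<in> range \<psi>" using f(1) VL by (auto simp: bij_betw_def)
  then obtain i j where ij: "f (\<phi> 0) = \<psi> i" "f (\<phi> d) = \<psi> j" by blast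
  define e where "e = (j - i) mod int n"
  have e: "\<psi> (i + e) = \<psi> j"
    by (simp add: perL e_def mod_eq_dvd_iff[symmetric] mod_simps)
  have "\<phi> 0 \<noteq> \<phi> d" using d(1) by (simp add: perK dvd_eq_mod_eq_0[symmetric])
  then have ne: "\<psi> i \<noteq> \<psi> j" using f(1) mem ij by (auto simp: bij_betw_def inj_on_def)
  then have "e \<noteq> 0" using e by (metis add.right_neutral)
  moreover have "0 \<le> e" "e < int n" using n by (simp_all add: e_def)
  ultimately have "e \<in> {1..<int n}" by simp
  moreover have "residue_adjacent (int n) l e \<or> all_pairs"
  proof (cases all_pairs)
    case False
    then have "{\<phi> 0, \<phi> d} \<in> K" using d(2) cyclic_torus_adjacent[OF T(1) n T(2), of 0 d] by simp
    then have "{\<psi> i, \<psi> j} \<in> L" using f(2)[OF mem] ij by simp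
    then show ?thesis using cyclic_torus_adjacent[OF U(1) n U(2), of i "i + e"] ne e by simp
  qed simp
  ultimately have "residue_common (int n) l e < residue_common (int n) k d" using less by blast
  moreover have "residue_common (int n) l e = residue_common (int n) k d"
    using f(3)[OF mem] ij e cyclic_torus_common_neighbours[OF T(1) n T(2), of 0 d]
      cyclic_torus_common_neighbours[OF U(1) n U(2), of i "i + e"] by simp
  ultimately show False by simp
qed

text \<open>The condition of \<open>cyclic_torus_rescale\<close> in a form that the simplifier can evaluate for numerals.\<close>

definition unit_reduces :: "int \<Rightarrow> int \<Rightarrow> int \<Rightarrow> int \<Rightarrow> bool" where
  "unit_reduces n k k' m \<longleftrightarrow> (m mod n, m * k' mod n) \<in> set (map (\<lambda>(a, b). (a mod n, b mod n))
       [(1, k), (k, 1), (k, - 1 - k), (- 1 - k, k), (1, - 1 - k), (- 1 - k, 1)])"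

text \<open>The parameter \<open>k\<close> matters only modulo \<open>n\<close>, so it remains to search for a unit for each residue \<open>k\<close>
  that makes the six neighbours distinct.\<close>

lemma chi0_isomorphic_T1:
  fixes K :: "'a set set"
  assumes M: "dr_manifold_chi0 n K" and n: "prime n" "odd n"
    and red: "list_all (\<lambda>k. \<not> nondegenerate (int n) k \<or>
      list_ex (\<lambda>k'. list_ex (unit_reduces (int n) k k') [1..int n - 1]) (map int ks)) [0..int n - 1]"
  shows "\<exists>k'\<in>set ks. K \<simeq>\<^sub>s T1 n k'"
proof -
  have n0: "n > 0" using n prime_gt_0_nat by blast
  obtain k \<phi> where T: "cyclic_torus n k K \<phi>"
    and dist: "nondegenerate (int n) k"
    using chi0_cyclic_torus[OF M n] .
  define k0 where "k0 = k mod int n"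
  have per: "\<phi> i = \<phi> j \<longleftrightarrow> int n dvd i - j" for i j
    using T by (auto simp: cyclic_torus_def)
  have "two_step_complex \<phi> 1 k = two_step_complex \<phi> 1 k0"
    by (rule two_step_cong[OF per]) (simp_all add: k0_def)
  then have T0: "cyclic_torus n k0 K \<phi>" using T by (simp add: cyclic_torus_def)
  have "map (\<lambda>d. d mod int n) (0 # star_offsets k0) = map (\<lambda>d. d mod int n) (0 # star_offsets k)"
  proof -
    have k0: "int n dvd k - k0" by (simp add: k0_def minus_mod_eq_mult_div)
    then have "int n dvd k0 - k" by (simp add: dvd_diff_commute)
    with k0 show ?thesis by (simp add: star_offsets_def mod_eq_dvd_iff)
  qed
  then have "nondegenerate (int n) k0" using dist by (simp only: nondegenerate_def)
  moreover have "k0 \<in> set [0..int n - 1]" using n0 by (simp add: k0_def)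
  ultimately obtain k' m where k': "k' \<in> set ks" and m: "m \<in> {1..int n - 1}"
    and u: "unit_reduces (int n) k0 (int k') m"
    using red unfolding list_all_iff list_ex_iff by fastforce
  have "coprime m (int n)"
  proof -
    have "\<not> int n dvd m" using m zdvd_not_zless[of m "int n"] by auto
    then show ?thesis using n(1) prime_imp_coprime[of "int n" m] by (simp add: coprime_commute)
  qed
  from cyclic_torus_rescale[OF T0 this] u have "cyclic_torus n (int k') K (\<lambda>i. \<phi> (m * i))"
    unfolding unit_reduces_def by simp
  then show ?thesis using cyclic_torus_isomorphic[OF _ cyclic_torus_T1[OF n0]] k' by blast
qed

theorem corollary5:
  shows "(\<forall>n\<in>{13, 17}.
      dr_manifold_chi0 n (T1 n 2) \<and> dr_manifold_chi0 n (T1 n 3) \<and>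
      \<not> (T1 n 2 \<simeq>\<^sub>s T1 n 3) \<and>
      (\<forall>K :: 'a set set. dr_manifold_chi0 n K \<longrightarrow> K \<simeq>\<^sub>s T1 n 2 \<or> K \<simeq>\<^sub>s T1 n 3)) \<and>
    (dr_manifold_chi0 19 (T1 19 2) \<and> dr_manifold_chi0 19 (T1 19 3) \<and>
      dr_manifold_chi0 19 (T1 19 7) \<and>
      \<not> (T1 19 2 \<simeq>\<^sub>s T1 19 3) \<and> \<not> (T1 19 2 \<simeq>\<^sub>s T1 19 7) \<and>
      \<not> (T1 19 3 \<simeq>\<^sub>s T1 19 7) \<and>
      (\<forall>K :: 'a set set. dr_manifold_chi0 19 K \<longrightarrow>
         K \<simeq>\<^sub>s T1 19 2 \<or> K \<simeq>\<^sub>s T1 19 3 \<or> K \<simeq>\<^sub>s T1 19 7))"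
proof -
  have dist: "list_all (\<lambda>(n, k). nondegenerate n k)
      [(13, 2), (13, 3), (17, 2), (17, 3), (19, 2), (19, 3), (19, 7)]"
    by code_simp
  have M: "dr_manifold_chi0 13 (T1 13 2)" "dr_manifold_chi0 13 (T1 13 3)" "dr_manifold_chi0 17 (T1 17 2)"
    "dr_manifold_chi0 17 (T1 17 3)" "dr_manifold_chi0 19 (T1 19 2)" "dr_manifold_chi0 19 (T1 19 3)" "dr_manifold_chi0 19 (T1 19 7)"
    by (rule T1_dr_manifold; use dist in simp)+
  \<comment> \<open>adjacent vertices can have four common neighbours for \<open>k = 2\<close>, but at most two for \<open>k = 3\<close> and \<open>k = 7\<close>\<close>
  have ad: "list_all (\<lambda>(n, k, l). list_all (\<lambda>e. residue_adjacent n l e \<longrightarrow>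
      residue_common n l e < residue_common n k 1) [1..n - 1])
      [(13, 2, 3), (17, 2, 3), (19, 2, 3), (19, 2, 7)]"
    by code_simp
  \<comment> \<open>for \<open>n = 19\<close> and \<open>k = 3\<close> the residues 0 and 2 have three common neighbours; for \<open>k = 7\<close> there are at most two\<close>
  have al: "list_all (\<lambda>e. residue_common 19 7 e < residue_common 19 3 2) [1..18]"
    by code_simp
  have adj: "list_all (\<lambda>n. residue_adjacent n 2 1) [13, 17, 19]" by code_simp
  have r13: "list_all (\<lambda>k. \<not> nondegenerate 13 k \<or>
      list_ex (\<lambda>k'. list_ex (unit_reduces 13 k k') [1..12]) [2, 3]) [0..12]"
    by code_simp
  have r17: "list_all (\<lambda>k. \<not> nondegenerate 17 k \<or>
      list_ex (\<lambda>k'. list_ex (unit_reduces 17 k k') [1..16]) [2, 3]) [0..16]"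
    by code_simp
  have r19: "list_all (\<lambda>k. \<not> nondegenerate 19 k \<or>
      list_ex (\<lambda>k'. list_ex (unit_reduces 19 k k') [1..18]) [2, 3, 7]) [0..18]"
    by code_simp
  have not23: "\<not> T1 13 2 \<simeq>\<^sub>s T1 13 3" "\<not> T1 17 2 \<simeq>\<^sub>s T1 17 3" "\<not> T1 19 2 \<simeq>\<^sub>s T1 19 3"
    by (rule cyclic_tori_not_isomorphic[OF cyclic_torus_T1 _ cyclic_torus_T1, where d = 1 and all_pairs = False];
      use dist ad adj in \<open>simp add: list_all_iff\<close>)+
  have not27: "\<not> T1 19 2 \<simeq>\<^sub>s T1 19 7"
    by (rule cyclic_tori_not_isomorphic[OF cyclic_torus_T1 _ cyclic_torus_T1, where d = 1 and all_pairs = False])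
      (use dist ad adj in \<open>simp_all add: list_all_iff\<close>)
  have not37: "\<not> T1 19 3 \<simeq>\<^sub>s T1 19 7"
    by (rule cyclic_tori_not_isomorphic[OF cyclic_torus_T1 _ cyclic_torus_T1, where d = 2 and all_pairs = True])
      (use dist al in \<open>simp_all add: list_all_iff\<close>)
  have pr: "prime (13::nat)" "prime (17::nat)" "prime (19::nat)" "odd (13::nat)" "odd (17::nat)" "odd (19::nat)"
    by simp_all
  have c13: "K \<simeq>\<^sub>s T1 13 2 \<or> K \<simeq>\<^sub>s T1 13 3" if "dr_manifold_chi0 13 K" for K :: "'a set set"
    using chi0_isomorphic_T1[OF that pr(1,4), of "[2, 3]"] r13 by simp
  have c17: "K \<simeq>\<^sub>s T1 17 2 \<or> K \<simeq>\<^sub>s T1 17 3" if "dr_manifold_chi0 17 K" for K :: "'a set set"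
    using chi0_isomorphic_T1[OF that pr(2,5), of "[2, 3]"] r17 by simp
  have c19: "K \<simeq>\<^sub>s T1 19 2 \<or> K \<simeq>\<^sub>s T1 19 3 \<or> K \<simeq>\<^sub>s T1 19 7" if "dr_manifold_chi0 19 K" for K :: "'a set set"
    using chi0_isomorphic_T1[OF that pr(3,6), of "[2, 3, 7]"] r19 by simp
  show ?thesis using M not23 not27 not37 c13 c17 c19 by blast
qed

end
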